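(* Let $w>0$. Among h-convex bodies of minimal Lassak width at least $w$ in $\mathbb{H}^2$, the regular horocyclic triangle $T_w$ of minimal Lassak width $w$ minimizes the inradius, and any minimizer is congruent to $T_w$.
   Context: $\mathbb{H}^2$ is the hyperbolic plane of curvature $-1$ with geodesic distance $d$. The inradius $r(K)$ of $K$ is the largest radius of a ball (disk) contained in $K$. A horoball is a closed region bounded by a horocycle. A closed set $X\subset\mathbb{H}^2$ is h-convex if for any distinct $x,y\in X$, every horocyclic arc connecting $x$ and $y$ is contained in $X$; every h-convex set is convex. An h-convex body is a compact h-convex set with non-empty interior. Lassak width: for a convex body $K$ (compact convex set with non-empty interior), a line $H$ is a supporting line if $H\cap K\ne\emptyset$ and $K$ lies in one closed half-plane bounded by $H$; the Lassak width of $K$ with respect to $H$ is $\max_{x\in K}d(x,H)$, and the minimal Lassak width $w(K)$ is the minimum of these over all supporting lines $H$. Regular horocyclic triangle: for a disk $B(p,r)$, $r>0$, and three equally spaced points $z_1,z_2,z_3\in\partial B(p,r)$ (pairwise at angle $2\pi/3$ seen from $p$), it is the intersection of the three horoballs containing $B(p,r)$ whose boundaries are tangent to $B(p,r)$ at $z_1,z_2,z_3$, respectively. For each $w>0$ there is, up to congruence, exactly one regular horocyclic triangle $T_w$ of minimal Lassak width $w$. Congruent means equal up to an isometry of $\mathbb{H}^2$. *)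

theory Defs
  imports "HOL-Analysis.Analysis"
begin

section \<open>The hyperbolic plane (hyperboloid model)\<close>

text \<open>The hyperbolic plane of curvature \<open>-1\<close> is the upper sheet of the hyperboloid
  \<open>mink x x = -1\<close> in Minkowski space \<open>\<real>\<^sup>2\<^sup>,\<^sup>1\<close>, represented as \<open>complex \<times> real\<close> with the
  real inner product on the spacelike factor; the geodesic distance satisfies
  \<open>cosh (dist x y) = - mink x y\<close>.\<close>

definition mink :: "complex \<times> real \<Rightarrow> complex \<times> real \<Rightarrow> real" where
  "mink x y = fst x \<bullet> fst y - snd x * snd y"

typedef hyp2 = "{x :: complex \<times> real. mink x x = -1 \<and> snd x > 0}"
  by (rule exI[of _ "(0, 1)"]) (simp add: mink_def)

lemma mink_Rep_self: "mink (Rep_hyp2 x) (Rep_hyp2 x) = -1"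
  and snd_Rep_pos: "snd (Rep_hyp2 x) > 0"
  using Rep_hyp2[of x] by auto

lemma mink_commute: "mink x y = mink y x"
  by (simp add: mink_def inner_commute)

lemma mink_add_left: "mink (x + y) z = mink x z + mink y z"
  and mink_add_right: "mink z (x + y) = mink z x + mink z y"
  and mink_diff_left: "mink (x - y) z = mink x z - mink y z"
  and mink_diff_right: "mink z (x - y) = mink z x - mink z y"
  and mink_scaleR_left: "mink (c *\<^sub>R x) z = c * mink x z"
  and mink_scaleR_right: "mink z (c *\<^sub>R x) = c * mink z x"
  by (auto simp: mink_def inner_simps algebra_simps)

lemmas mink_simps = mink_add_left mink_add_right mink_diff_left mink_diff_right
  mink_scaleR_left mink_scaleR_right

text \<open>The orthogonal complement of a point of the hyperboloid is positive definite.\<close>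

lemma mink_orthogonal_nonneg:
  assumes "mink w (Rep_hyp2 y) = 0"
  shows "mink w w \<ge> 0" and "mink w w = 0 \<Longrightarrow> w = 0"
proof -
  obtain a s where w: "w = (a, s)" by (cases w)
  obtain b t where y: "Rep_hyp2 y = (b, t)" by (cases "Rep_hyp2 y")
  have t: "t > 0" and bt: "b \<bullet> b = t\<^sup>2 - 1"
    using mink_Rep_self[of y] snd_Rep_pos[of y] by (auto simp: y mink_def power2_eq_square)
  have "(s * t)\<^sup>2 = (a \<bullet> b)\<^sup>2"
    using assms by (simp add: w y mink_def)
  also have "\<dots> \<le> (a \<bullet> a) * (b \<bullet> b)"
    by (rule Cauchy_Schwarz_ineq)
  finally have le: "s\<^sup>2 * t\<^sup>2 \<le> (a \<bullet> a) * (t\<^sup>2 - 1)"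
    by (simp add: bt power_mult_distrib)
  then have key: "(a \<bullet> a) \<le> t\<^sup>2 * mink w w"
    by (simp add: w mink_def power2_eq_square algebra_simps)
  have "0 \<le> t\<^sup>2 * mink w w"
    using key inner_ge_zero[of a] by linarith
  then show "mink w w \<ge> 0"
    using t by (simp add: zero_le_mult_iff)
  show "w = 0" if "mink w w = 0"
  proof -
    have "a = 0"
      using key that inner_ge_zero[of a] by simp
    then show ?thesis
      using that by (simp add: w mink_def zero_prod_def)
  qed
qed

lemma mink_orthogonal_Cauchy_Schwarz:
  assumes u: "mink u (Rep_hyp2 y) = 0" and v: "mink v (Rep_hyp2 y) = 0"
  shows "(mink u v)\<^sup>2 \<le> mink u u * mink v v"
proof (cases "mink v v = 0")
  case True
  then have "v = 0" using mink_orthogonal_nonneg(2)[OF v] by simp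
  then show ?thesis by (simp add: mink_def)
next
  case False
  then have pos: "mink v v > 0" using mink_orthogonal_nonneg(1)[OF v] by simp
  define w where "w = mink v v *\<^sub>R u - mink u v *\<^sub>R v"
  have "mink w (Rep_hyp2 y) = 0" by (simp add: w_def mink_simps u v)
  then have "0 \<le> mink w w" by (rule mink_orthogonal_nonneg)
  also have "mink w w = mink v v * (mink u u * mink v v - (mink u v)\<^sup>2)"
    by (simp add: w_def mink_simps mink_commute[of v u] power2_eq_square algebra_simps)
  finally show ?thesis using pos by (simp add: zero_le_mult_iff)
qed

lemma mink_Rep_tangent:
  fixes x y :: hyp2
  defines "u \<equiv> Rep_hyp2 x + mink (Rep_hyp2 x) (Rep_hyp2 y) *\<^sub>R Rep_hyp2 y"
  shows "mink u (Rep_hyp2 y) = 0" "mink u u = (mink (Rep_hyp2 x) (Rep_hyp2 y))\<^sup>2 - 1"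
  by (auto simp: u_def mink_simps mink_Rep_self mink_commute[of "Rep_hyp2 y" "Rep_hyp2 x"]
      power2_eq_square algebra_simps)

lemma mink_Rep_neg: "mink (Rep_hyp2 x) (Rep_hyp2 y) < 0"
proof -
  obtain a s where x: "Rep_hyp2 x = (a, s)" by (cases "Rep_hyp2 x")
  obtain b t where y: "Rep_hyp2 y = (b, t)" by (cases "Rep_hyp2 y")
  have s: "s > 0" "(norm a)\<^sup>2 < s\<^sup>2" and t: "t > 0" "(norm b)\<^sup>2 < t\<^sup>2"
    using mink_Rep_self[of x] snd_Rep_pos[of x] mink_Rep_self[of y] snd_Rep_pos[of y]
    by (auto simp: x y mink_def power2_norm_eq_inner power2_eq_square[of s] power2_eq_square[of t])
  have "norm a < s" "norm b < t"
    using s t by (meson less_imp_le power_less_imp_less_base)+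
  then have "norm a * norm b < s * t"
    using s t by (intro mult_strict_mono') auto
  moreover have "a \<bullet> b \<le> norm a * norm b" by (rule norm_cauchy_schwarz)
  ultimately show ?thesis by (simp add: x y mink_def)
qed

lemma mink_Rep_le: "mink (Rep_hyp2 x) (Rep_hyp2 y) \<le> -1"
proof -
  have "0 \<le> (mink (Rep_hyp2 x) (Rep_hyp2 y))\<^sup>2 - 1"
    using mink_orthogonal_nonneg(1)[OF mink_Rep_tangent(1)[of x y]]
    by (simp add: mink_Rep_tangent(2))
  then have "1 \<le> \<bar>mink (Rep_hyp2 x) (Rep_hyp2 y)\<bar>"
    using abs_le_square_iff[of 1 "mink (Rep_hyp2 x) (Rep_hyp2 y)"] by simp
  then show ?thesis using mink_Rep_neg[of x y] by linarith
qed

lemma mink_Rep_eq_iff: "mink (Rep_hyp2 x) (Rep_hyp2 y) = -1 \<longleftrightarrow> x = y"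
proof
  assume m: "mink (Rep_hyp2 x) (Rep_hyp2 y) = -1"
  have "Rep_hyp2 x + mink (Rep_hyp2 x) (Rep_hyp2 y) *\<^sub>R Rep_hyp2 y = 0"
    using mink_Rep_tangent[of x y] m by (intro mink_orthogonal_nonneg(2)[of _ y]) auto
  then show "x = y" by (simp add: m Rep_hyp2_inject)
qed (simp add: mink_Rep_self)

instantiation hyp2 :: metric_space
begin

definition dist_hyp2 :: "hyp2 \<Rightarrow> hyp2 \<Rightarrow> real" where
  "dist_hyp2 x y = arcosh (- mink (Rep_hyp2 x) (Rep_hyp2 y))"

definition uniformity_hyp2 :: "(hyp2 \<times> hyp2) filter" where
  "uniformity_hyp2 = (INF e\<in>{0 <..}. principal {(x, y). dist x y < e})"

definition open_hyp2 :: "hyp2 set \<Rightarrow> bool" where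
  "open_hyp2 U = (\<forall>x\<in>U. eventually (\<lambda>(x', y). x' = x \<longrightarrow> y \<in> U) uniformity)"

lemma cosh_dist_hyp2: "cosh (dist x y) = - mink (Rep_hyp2 x) (Rep_hyp2 (y :: hyp2))"
  using mink_Rep_le[of x y] by (simp add: dist_hyp2_def cosh_arcosh_real)

lemma dist_hyp2_nonneg: "dist x (y :: hyp2) \<ge> 0"
  using mink_Rep_le[of x y] by (simp add: dist_hyp2_def arcosh_nonneg_real)

instance
proof
  fix x y z :: hyp2
  show "dist x y = 0 \<longleftrightarrow> x = y"
  proof
    assume "dist x y = 0"
    then show "x = y" using cosh_dist_hyp2[of x y] mink_Rep_eq_iff[of x y] by simp
  next
    assume "x = y"
    then show "dist x y = 0" by (simp add: dist_hyp2_def mink_Rep_self)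
  qed
  have tri: "dist x z \<le> dist x y + dist y z" for x y z :: hyp2
  proof -
    define a where "a = dist x y"
    define b where "b = dist y z"
    define u where "u = Rep_hyp2 x + mink (Rep_hyp2 x) (Rep_hyp2 y) *\<^sub>R Rep_hyp2 y"
    define v where "v = Rep_hyp2 z + mink (Rep_hyp2 z) (Rep_hyp2 y) *\<^sub>R Rep_hyp2 y"
    have ab: "a \<ge> 0" "b \<ge> 0" by (simp_all add: a_def b_def dist_hyp2_nonneg)
    have ma: "mink (Rep_hyp2 x) (Rep_hyp2 y) = - cosh a"
      and mb: "mink (Rep_hyp2 z) (Rep_hyp2 y) = - cosh b"
      by (simp_all add: a_def b_def cosh_dist_hyp2 mink_commute)
    have uu: "mink u (Rep_hyp2 y) = 0" "mink u u = (sinh a)\<^sup>2"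
      using mink_Rep_tangent[of x y] by (simp_all add: u_def ma cosh_square_eq)
    have vv: "mink v (Rep_hyp2 y) = 0" "mink v v = (sinh b)\<^sup>2"
      using mink_Rep_tangent[of z y] by (simp_all add: v_def mb cosh_square_eq)
    have "mink u v = mink (Rep_hyp2 x) (Rep_hyp2 z) + cosh a * cosh b"
      by (simp add: u_def v_def mink_simps mink_Rep_self ma mb
          mink_commute[of "Rep_hyp2 y" "Rep_hyp2 z"] algebra_simps)
    moreover have "(mink u v)\<^sup>2 \<le> (sinh a * sinh b)\<^sup>2"
      using mink_orthogonal_Cauchy_Schwarz[OF uu(1) vv(1)]
      by (simp add: uu vv power_mult_distrib)
    then have "\<bar>mink u v\<bar> \<le> sinh a * sinh b"
      using ab by (simp add: abs_le_square_iff[symmetric] abs_mult)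
    ultimately have "cosh (dist x z) \<le> cosh (a + b)"
      by (simp add: cosh_dist_hyp2 cosh_add)
    then show ?thesis
      using ab dist_hyp2_nonneg[of x z] cosh_real_nonneg_le_iff[of "dist x z" "a + b"]
      by (simp add: a_def b_def)
  qed
  have "dist x z = dist z x" for x z :: hyp2
    by (simp add: dist_hyp2_def mink_commute)
  then show "dist x y \<le> dist x z + dist y z"
    using tri[of x y z] by simp
qed (simp_all add: uniformity_hyp2_def open_hyp2_def)

end

definition hyp2_congruent :: "hyp2 set \<Rightarrow> hyp2 set \<Rightarrow> bool" where
  "hyp2_congruent A B \<longleftrightarrow>
    (\<exists>f. bij f \<and> (\<forall>x y. dist (f x) (f y) = dist x y) \<and> f ` A = B)"

text \<open>The angle at \<open>p\<close> between the geodesic rays from \<open>p\<close> to \<open>x\<close> and to \<open>y\<close>: the Riemannian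
  metric is \<open>mink\<close> restricted to the tangent plane, and the ray to \<open>x\<close> starts in the direction
  of the component of \<open>x\<close> orthogonal to \<open>p\<close>.\<close>

definition direction :: "hyp2 \<Rightarrow> hyp2 \<Rightarrow> complex \<times> real" where
  "direction p x = Rep_hyp2 x + mink (Rep_hyp2 x) (Rep_hyp2 p) *\<^sub>R Rep_hyp2 p"

definition angle_at :: "hyp2 \<Rightarrow> hyp2 \<Rightarrow> hyp2 \<Rightarrow> real" where
  "angle_at p x y =
    (let u = direction p x; v = direction p y
     in arccos (mink u v / (sqrt (mink u u) * sqrt (mink v v))))"


section \<open>Lines and Lassak width\<close>

text \<open>Lines are the nonempty intersections of the hyperboloid with linear planes, that is, with
  the \<open>mink\<close>-orthogonal complements of spacelike vectors \<open>u\<close>. The other closed half-plane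
  bounded by \<open>line u\<close> is \<open>half_plane (- u)\<close>, and \<open>line (- u) = line u\<close>.\<close>

definition line :: "complex \<times> real \<Rightarrow> hyp2 set" where
  "line u = {x. mink (Rep_hyp2 x) u = 0}"

definition half_plane :: "complex \<times> real \<Rightarrow> hyp2 set" where
  "half_plane u = {x. mink (Rep_hyp2 x) u \<le> 0}"

definition supporting_line :: "hyp2 set \<Rightarrow> hyp2 set \<Rightarrow> bool" where
  "supporting_line K H \<longleftrightarrow>
    (\<exists>u. mink u u > 0 \<and> H = line u \<and> H \<inter> K \<noteq> {} \<and> K \<subseteq> half_plane u)"

text \<open>Since \<open>K\<close> will be compact, the suprema and infima below are attained.\<close>

definition lassak_width :: "hyp2 set \<Rightarrow> hyp2 set \<Rightarrow> real" where
  "lassak_width K H = (SUP x\<in>K. infdist x H)"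

definition minimal_lassak_width :: "hyp2 set \<Rightarrow> real" where
  "minimal_lassak_width K = (INF H\<in>{H. supporting_line K H}. lassak_width K H)"

definition inradius :: "hyp2 set \<Rightarrow> real" where
  "inradius K = Sup {r. r > 0 \<and> (\<exists>p. cball p r \<subseteq> K)}"


section \<open>Horocycles and h-convexity\<close>

text \<open>The horocycles are the intersections of the hyperboloid with the affine planes
  \<open>mink x l = -1\<close>, where \<open>l\<close> is a future-directed lightlike vector: the ray spanned by \<open>l\<close> is
  the ideal centre, and its scale selects the horocycle. Towards the ideal centre \<open>- mink x l\<close>
  tends to \<open>0\<close>, so the horoball is the side \<open>- mink x l \<le> 1\<close>.\<close>

definition lightlike :: "complex \<times> real \<Rightarrow> bool" where
  "lightlike l \<longleftrightarrow> mink l l = 0 \<and> snd l > 0"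

definition horocycle :: "complex \<times> real \<Rightarrow> hyp2 set" where
  "horocycle l = {x. mink (Rep_hyp2 x) l = -1}"

definition horoball :: "complex \<times> real \<Rightarrow> hyp2 set" where
  "horoball l = {x. mink (Rep_hyp2 x) l \<ge> -1}"

definition h_convex :: "hyp2 set \<Rightarrow> bool" where
  "h_convex X \<longleftrightarrow> closed X \<and>
    (\<forall>x\<in>X. \<forall>y\<in>X. x \<noteq> y \<longrightarrow>
      (\<forall>l g. lightlike l \<and> arc g \<and> path_image g \<subseteq> horocycle l \<and> pathstart g = x \<and> pathfinish g = y
        \<longrightarrow> path_image g \<subseteq> X))"

definition h_convex_body :: "hyp2 set \<Rightarrow> bool" where
  "h_convex_body K \<longleftrightarrow> compact K \<and> h_convex K \<and> interior K \<noteq> {}"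

text \<open>A horocycle is tangent to a circle at \<open>z\<close> iff \<open>z\<close> is their only common point.\<close>

definition tangent_horoball :: "hyp2 \<Rightarrow> real \<Rightarrow> hyp2 \<Rightarrow> hyp2 set \<Rightarrow> bool" where
  "tangent_horoball p r z B \<longleftrightarrow>
    (\<exists>l. lightlike l \<and> B = horoball l \<and> cball p r \<subseteq> B \<and> horocycle l \<inter> sphere p r = {z})"

definition regular_horocyclic_triangle :: "hyp2 set \<Rightarrow> bool" where
  "regular_horocyclic_triangle T \<longleftrightarrow>
    (\<exists>p r z1 z2 z3 B1 B2 B3. r > 0 \<and>
      z1 \<in> sphere p r \<and> z2 \<in> sphere p r \<and> z3 \<in> sphere p r \<and>
      angle_at p z1 z2 = 2 * pi / 3 \<and> angle_at p z2 z3 = 2 * pi / 3 \<and>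
      angle_at p z3 z1 = 2 * pi / 3 \<and>
      tangent_horoball p r z1 B1 \<and> tangent_horoball p r z2 B2 \<and> tangent_horoball p r z3 B3 \<and>
      T = B1 \<inter> B2 \<inter> B3)"

end

theory Submission
  imports Defs
begin

text \<open>Let \<open>r\<close> be the inradius of \<open>K\<close>. By h-convexity, \<open>K\<close> is the intersection of the horoballs
  containing it, and maximality of the inscribed disk \<open>B(p, r)\<close> yields three horoballs containing
  \<open>K\<close> and tangent to the disk whose contact directions \<open>e\<^sub>1, e\<^sub>2, e\<^sub>3\<close> have \<open>0\<close> in their convex hull.
  Two of the directions, say \<open>e\<^sub>2, e\<^sub>3\<close>, form an angle of at most \<open>2\<pi>/3\<close>. Among the points of the
  three horoballs, none is farther from the line touching the disk in direction \<open>e\<^sub>1\<close> than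
  \<open>R + r\<close>, where \<open>R\<close> is the distance from the centre to the vertices of the regular triangle of
  inradius \<open>r\<close>, and only the point at distance \<open>R\<close> from \<open>p\<close> in direction \<open>- e\<^sub>1\<close> is at distance
  \<open>R + r\<close>. Hence the minimal width of \<open>K\<close> is at most \<open>R + r\<close>, which is the minimal width of the
  regular triangle and increases with \<open>r\<close>. In case of equality the three directions are equally
  spaced and \<open>K\<close> contains all vertices of the regular triangle, which is their horocyclically convex
  hull.\<close>

text \<open>The proof is linear algebra in Minkowski space. A horoball is a lightlike vector
  \<open>l\<close>, and \<open>- mink (hvec p) l\<close> is the exponential of minus the depth of
  \<open>p\<close> in it. Finding the incircle thus becomes a minimax problem for a function linear
  in \<open>hvec p\<close> and in \<open>l\<close>, and the contact directions come from its
  first-order condition. The side touched in direction \<open>e\<close> has the equation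
  \<open>X + mink (hvec x) e = exp r\<close> with \<open>X = cosh (dist x p)\<close>. Requiring it
  for \<open>e2\<close> and \<open>e3\<close> at the point at distance \<open>R\<close> in direction
  \<open>- e1\<close> gives \<open>exp r = cosh R + sinh R / 2\<close>, the relation that ties
  \<open>R\<close> to \<open>r\<close> throughout. The upper bound needs a single line, but the
  exact width of the regular triangle needs all supporting lines. The hard ones pass through a
  vertex; there the decisive fact is that \<open>R + r\<close> is at most the distance of two
  vertices. For uniqueness, equality is at first known for one contact direction only. The vertex
  that it puts into \<open>K\<close> lies in the other two horoballs, which makes the bound
  applicable to the other directions as well.\<close>

lemma mink_coords:
  "mink x y = Re (fst x) * Re (fst y) + Im (fst x) * Im (fst y) - snd x * snd y"
  by (simp add: mink_def inner_complex_def)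

lemma mink_zero [simp]: "mink 0 x = 0" "mink x 0 = 0"
  and mink_minus [simp]: "mink (- x) y = - mink x y" "mink x (- y) = - mink x y"
  by (simp_all add: mink_def)

section \<open>Points and lightlike vectors in Minkowski space\<close>

abbreviation hvec :: "hyp2 \<Rightarrow> complex \<times> real" where
  "hvec \<equiv> Rep_hyp2"

lemma mink_hvec_self [simp]: "mink (hvec x) (hvec x) = -1"
  by (rule mink_Rep_self)

lemma one_le_mink: "1 \<le> - mink (hvec x) (hvec y)"
  using mink_Rep_le[of x y] by simp

lemma norm_fst_hvec_less: "norm (fst (hvec x)) < snd (hvec x)"
proof -
  have "(norm (fst (hvec x)))\<^sup>2 < (snd (hvec x))\<^sup>2"
    using mink_Rep_self[of x]
    unfolding power2_norm_eq_inner by (simp add: mink_def power2_eq_square)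
  then show ?thesis
    using snd_Rep_pos[of x] by (meson less_imp_le power_less_imp_less_base)
qed

text \<open>By Cauchy-Schwarz, a causal vector with nonpositive time component has nonnegative
  product with every point. So one product decides the sheet, and points can be constructed without
  coordinates.\<close>

lemma future_directed:
  assumes "mink v v \<le> 0" "mink v (hvec x) < 0"
  shows "snd v > 0"
proof (rule ccontr)
  assume "\<not> snd v > 0"
  then have s: "snd v \<le> 0" by simp
  have "(norm (fst v))\<^sup>2 \<le> (snd v)\<^sup>2"
    using assms(1) unfolding power2_norm_eq_inner by (simp add: mink_def power2_eq_square)
  then have n: "norm (fst v) \<le> - snd v"
    using s by (metis abs_le_square_iff abs_norm_cancel abs_of_nonpos)
  have "- (fst v \<bullet> fst (hvec x)) \<le> norm (fst v) * norm (fst (hvec x))"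
    using norm_cauchy_schwarz[of "- fst v" "fst (hvec x)"] by simp
  also have "\<dots> \<le> - snd v * snd (hvec x)"
    using n norm_fst_hvec_less[of x] s by (intro mult_mono) auto
  finally show False
    using assms(2) by (simp add: mink_def)
qed

lemma obtain_hyp2:
  assumes "mink v v = -1" "mink v (hvec x) < 0"
  obtains y where "hvec y = v"
  using future_directed[of v x] assms Abs_hyp2_inverse[of v] by auto

lemma lightlike_neg:
  assumes "lightlike l"
  shows "mink (hvec x) l < 0"
proof -
  have "norm (fst l) = snd l"
    using assms by (simp add: lightlike_def mink_def norm_eq_sqrt_inner real_sqrt_mult)
  moreover have "fst (hvec x) \<bullet> fst l \<le> norm (fst (hvec x)) * norm (fst l)"
    by (rule norm_cauchy_schwarz)
  moreover have "norm (fst (hvec x)) * snd l < snd (hvec x) * snd l"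
    using norm_fst_hvec_less assms by (simp add: lightlike_def)
  ultimately show ?thesis
    by (simp add: mink_def)
qed

lemma lightlike_iff: "lightlike l \<longleftrightarrow> mink l l = 0 \<and> mink (hvec x) l < 0"
  using lightlike_neg[of l x] future_directed[of l x] by (auto simp: lightlike_def mink_commute)

lemma mink_lightlike_nonpos:
  assumes "lightlike l" "lightlike k"
  shows "mink l k \<le> 0"
proof -
  have "norm (fst l) = snd l" "norm (fst k) = snd k"
    using assms by (simp_all add: lightlike_def mink_def norm_eq_sqrt_inner real_sqrt_mult)
  then show ?thesis
    using norm_cauchy_schwarz[of "fst l" "fst k"] by (simp add: mink_def)
qed

text \<open>The topology of \<open>hyp2\<close> comes from \<open>dist\<close>, so the coordinates
  have to be recovered from distances: those to the three points with coordinates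
  \<open>(0, 1)\<close>, \<open>(1, sqrt 2)\<close> and \<open>(\<i>, sqrt 2)\<close> determine them
  continuously.\<close>

lemma continuous_hvec: "continuous_on UNIV hvec"
proof -
  define o' where "o' = Abs_hyp2 (0, 1)"
  define a where "a = Abs_hyp2 (1, sqrt 2)"
  define b where "b = Abs_hyp2 (\<i>, sqrt 2)"
  have o': "hvec o' = (0, 1)" and a: "hvec a = (1, sqrt 2)" and b: "hvec b = (\<i>, sqrt 2)"
    unfolding o'_def a_def b_def
    by (rule Abs_hyp2_inverse; simp add: mink_coords)+
  have c: "continuous_on UNIV (\<lambda>x. cosh (dist x y))" for y :: hyp2
    by (intro continuous_intros)
  have eq: "hvec x = (Complex (sqrt 2 * cosh (dist x o') - cosh (dist x a))
      (sqrt 2 * cosh (dist x o') - cosh (dist x b)), cosh (dist x o'))" for x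
    by (auto simp: cosh_dist_hyp2 mink_coords o' a b prod_eq_iff complex_eq_iff)
  show ?thesis
    unfolding eq[abs_def] Complex_eq by (intro continuous_intros c)
qed

lemma continuous_mink [continuous_intros]:
  assumes "continuous_on S f" "continuous_on S g"
  shows "continuous_on S (\<lambda>x. mink (f x) (g x))"
  unfolding mink_def using assms by (intro continuous_intros)

lemma continuous_hvec_comp [continuous_intros]:
  assumes "continuous_on S f"
  shows "continuous_on S (\<lambda>x. hvec (f x))"
  using continuous_on_compose2[OF continuous_hvec assms] by auto

lemma continuous_hyp2:
  fixes f :: "'a::topological_space \<Rightarrow> hyp2"
  assumes "continuous_on S (\<lambda>x. hvec (f x))"
  shows "continuous_on S f"
  unfolding continuous_on_def
proof
  fix a assume "a \<in> S"
  have "continuous_on S (\<lambda>x. dist (f x) (f a))"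
    unfolding dist_hyp2_def
  proof (rule continuous_on_compose2[OF continuous_on_arcosh[OF order_refl]])
    show "continuous_on S (\<lambda>x. - mink (hvec (f x)) (hvec (f a)))"
      by (intro continuous_on_minus continuous_mink assms continuous_on_const)
    show "(\<lambda>x. - mink (hvec (f x)) (hvec (f a))) ` S \<subseteq> {1..}"
      using one_le_mink by auto
  qed
  then have "((\<lambda>x. dist (f x) (f a)) \<longlongrightarrow> dist (f a) (f a)) (at a within S)"
    using \<open>a \<in> S\<close> unfolding continuous_on_def by blast
  then show "(f \<longlongrightarrow> f a) (at a within S)"
    by (simp add: tendsto_dist_iff[of f])
qed

section \<open>Lorentz transformations\<close>

definition lorentz :: "(complex \<times> real \<Rightarrow> complex \<times> real) \<Rightarrow> bool" where
  "lorentz L \<longleftrightarrow> linear L \<and> (\<forall>v w. mink (L v) (L w) = mink v w)"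

lemma lorentz_linear: "lorentz L \<Longrightarrow> linear L"
  by (simp add: lorentz_def)

lemma lorentz_mink: "lorentz L \<Longrightarrow> mink (L v) (L w) = mink v w"
  by (metis lorentz_def)

lemma mink_nondegenerate:
  assumes "\<And>w. mink v w = 0"
  shows "v = 0"
  using assms[of "(1, 0)"] assms[of "(\<i>, 0)"] assms[of "(0, 1)"]
  by (auto simp: mink_coords prod_eq_iff complex_eq_iff)

lemma lorentz_inj: "lorentz L \<Longrightarrow> L v = L w \<Longrightarrow> v = w"
proof -
  assume L: "lorentz L" and eq: "L v = L w"
  have "mink (v - w) u = 0" for u
    using lorentz_mink[OF L, of v u] lorentz_mink[OF L, of w u] eq by (simp add: mink_simps)
  then show "v = w" using mink_nondegenerate[of "v - w"] by simp
qed

lemma lorentz_surj: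
  assumes "lorentz L"
  obtains v where "L v = w"
proof -
  have "surj L"
    using lorentz_linear[OF assms] lorentz_inj[OF assms]
    by (intro linear_injective_imp_surjective) (auto simp: inj_on_def)
  then show thesis using that by (metis surjD)
qed

text \<open>The Minkowski reflection exchanging \<open>p\<close> with the base point \<open>(0, 1)\<close>, followed by a
  rotation.\<close>

lemma lorentz_frame:
  assumes n: "mink n (hvec p) = 0" "mink n n = 1"
  obtains L where "lorentz L" "L (hvec p) = (0, 1)" "L n = (1, 0)"
proof -
  obtain S where S: "lorentz S" "S (hvec p) = (0, 1)"
  proof (cases "hvec p = (0, 1)")
    case True
    then show thesis by (intro that[of "\<lambda>v. v"]) (auto simp: lorentz_def linear_id[unfolded id_def])
  next
    case False
    define d where "d = hvec p - (0, 1)"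
    define c where "c = mink d d"
    have "mink (hvec p) (0, 1) = - snd (hvec p)" "mink (0, 1) (hvec p) = - snd (hvec p)"
      "mink (0, 1) (0, 1) = -1"
      by (simp_all add: mink_coords)
    then have c: "c = - 2 + 2 * snd (hvec p)" and dp: "mink (hvec p) d = -1 + snd (hvec p)"
      by (simp_all add: c_def d_def mink_simps)
    have "snd (hvec p) \<noteq> 1"
    proof
      assume 1: "snd (hvec p) = 1"
      then have "(norm (fst (hvec p)))\<^sup>2 = 0"
        using mink_Rep_self[of p] by (simp add: mink_def power2_norm_eq_inner)
      then show False using False 1 by (simp add: prod_eq_iff)
    qed
    then have c0: "c \<noteq> 0" using c by simp
    define S where "S = (\<lambda>v. v - (2 * mink v d / c) *\<^sub>R d)"
    have "linear S"
      by (rule linearI) (simp_all add: S_def mink_simps algebra_simps add_divide_distrib)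
    moreover have "mink (S v) (S w) = mink v w" for v w
      using c0 by (simp add: S_def mink_simps mink_commute[of d v] mink_commute[of d w]
          c_def[symmetric] field_simps)
    moreover have "S (hvec p) = (0, 1)"
    proof -
      have "2 * mink (hvec p) d / c = 1" using c0 by (simp add: c dp field_simps)
      then show ?thesis by (simp add: S_def d_def)
    qed
    ultimately show thesis by (intro that[of S]) (auto simp: lorentz_def)
  qed
  define e where "e = fst (S n)"
  have "snd (S n) = 0"
    using lorentz_mink[OF S(1), of n "hvec p"] n by (simp add: S mink_coords)
  then have "S n = (e, 0)" by (simp add: e_def prod_eq_iff)
  then have "e \<bullet> e = 1"
    using lorentz_mink[OF S(1), of n n] n by (simp add: mink_def)
  then have e: "(Re e)\<^sup>2 + (Im e)\<^sup>2 = 1"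
    by (simp add: inner_complex_def power2_eq_square)
  define L where "L = (\<lambda>v. (cnj e * fst (S v), snd (S v)))"
  have rot: "(cnj e * a) \<bullet> (cnj e * b) = a \<bullet> b" for a b
  proof -
    have "(cnj e * a) \<bullet> (cnj e * b) = ((Re e)\<^sup>2 + (Im e)\<^sup>2) * (a \<bullet> b)"
      by (simp add: inner_complex_def power2_eq_square algebra_simps)
    then show ?thesis by (simp add: e)
  qed
  have lS: "S (v + w) = S v + S w" "S (c *\<^sub>R v) = c *\<^sub>R S v" for v w c
    using lorentz_linear[OF S(1)] by (auto simp: linear_add linear_scale)
  have "linear L"
    by (rule linearI) (simp_all add: L_def lS algebra_simps)
  moreover have "mink (L v) (L w) = mink v w" for v w
    using lorentz_mink[OF S(1), of v w] by (simp add: L_def mink_def rot)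
  moreover have "L n = (1, 0)"
    using \<open>S n = (e, 0)\<close> e by (simp add: L_def complex_eq_iff power2_eq_square)
  ultimately show thesis
    using S by (intro that[of L]) (auto simp: lorentz_def L_def)
qed

section \<open>Lines and widths\<close>

text \<open>The component of \<open>x\<close> tangent at \<open>p\<close> has square norm
  \<open>(mink (hvec x) (hvec p))\<^sup>2 - 1\<close>; this is Cauchy-Schwarz against the unit
  vector \<open>e\<close>.\<close>

lemma tangent_component_le:
  assumes "mink e (hvec p) = 0" "mink e e = 1"
  shows "(mink (hvec x) e)\<^sup>2 \<le> (mink (hvec x) (hvec p))\<^sup>2 - 1"
proof -
  define u where "u = hvec x + mink (hvec x) (hvec p) *\<^sub>R hvec p"
  have "mink u e = mink (hvec x) e"
    using assms(1) by (simp add: u_def mink_simps mink_commute[of "hvec p" e])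
  then show ?thesis
    using mink_orthogonal_Cauchy_Schwarz[of u p e] mink_Rep_tangent[of x p] assms
    by (simp add: u_def)
qed

text \<open>The exponential map at \<open>p\<close>: the point at signed distance \<open>t\<close>
  on the geodesic with initial unit vector \<open>n\<close>.\<close>

lemma obtain_exp:
  assumes "mink n (hvec p) = 0" "mink n n = 1"
  obtains y where "hvec y = cosh t *\<^sub>R hvec p + sinh t *\<^sub>R n"
proof (rule obtain_hyp2[of "cosh t *\<^sub>R hvec p + sinh t *\<^sub>R n" p])
  have "mink (hvec p) n = 0" using assms(1) by (simp add: mink_commute)
  then show "mink (cosh t *\<^sub>R hvec p + sinh t *\<^sub>R n) (cosh t *\<^sub>R hvec p + sinh t *\<^sub>R n) = -1"
    using assms hyperbolic_pythagoras[of t] by (simp add: mink_simps power2_eq_square)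
  show "mink (cosh t *\<^sub>R hvec p + sinh t *\<^sub>R n) (hvec p) < 0"
    using assms by (simp add: mink_simps)
qed

lemma obtain_orthonormal_frame:
  assumes n: "mink n (hvec p) = 0" "mink n n = 1"
  obtains m where "mink m (hvec p) = 0" "mink m n = 0" "mink m m = 1"
    "\<And>v. v = (- mink v (hvec p)) *\<^sub>R hvec p + mink v n *\<^sub>R n + mink v m *\<^sub>R m"
proof -
  obtain L where L: "lorentz L" "L (hvec p) = (0, 1)" "L n = (1, 0)"
    using lorentz_frame[OF n] by blast
  obtain m where m: "L m = (\<i>, 0)" using lorentz_surj[OF L(1)] by blast
  have lin: "L (v + w) = L v + L w" "L (c *\<^sub>R v) = c *\<^sub>R L v" for v w c
    using lorentz_linear[OF L(1)] by (auto simp: linear_add linear_scale)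
  have "mink m (hvec p) = 0" "mink m n = 0" "mink m m = 1"
    using lorentz_mink[OF L(1), of m "hvec p"] lorentz_mink[OF L(1), of m n]
      lorentz_mink[OF L(1), of m m] by (simp_all add: L m mink_coords)
  moreover have "v = (- mink v (hvec p)) *\<^sub>R hvec p + mink v n *\<^sub>R n + mink v m *\<^sub>R m" for v
  proof (rule lorentz_inj[OF L(1)])
    have "mink v (hvec p) = - snd (L v)" "mink v n = Re (fst (L v))" "mink v m = Im (fst (L v))"
      using lorentz_mink[OF L(1), of v "hvec p"] lorentz_mink[OF L(1), of v n]
        lorentz_mink[OF L(1), of v m] by (simp_all add: L m mink_coords)
    then show "L v = L ((- mink v (hvec p)) *\<^sub>R hvec p + mink v n *\<^sub>R n + mink v m *\<^sub>R m)"
      unfolding lin by (simp add: L m prod_eq_iff complex_eq_iff)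
  qed
  ultimately show thesis by (rule that)
qed

text \<open>Split \<open>hvec x\<close> into a multiple of \<open>u\<close> and
  \<open>c *\<^sub>R v\<close> with \<open>v\<close> a point of the line. For \<open>z\<close> on
  the line only the second part contributes, so \<open>cosh (dist x z)\<close> is \<open>c\<close>
  times \<open>cosh (dist y z)\<close>, which is smallest at the foot \<open>y\<close>.\<close>

lemma line_foot:
  assumes u: "mink u u = 1"
  obtains y where "y \<in> line u" "infdist x (line u) = dist x y" "sinh (dist x y) = \<bar>mink (hvec x) u\<bar>"
proof -
  define b where "b = mink (hvec x) u"
  define c where "c = sqrt (1 + b\<^sup>2)"
  have c: "c > 0" "c\<^sup>2 = 1 + b\<^sup>2" by (simp_all add: c_def add_pos_nonneg)
  have ux: "mink u (hvec x) = b" by (simp add: b_def mink_commute)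
  have cc: "c * c = 1 + b * b" using c(2) by (simp add: power2_eq_square)
  define v where "v = (1 / c) *\<^sub>R (hvec x - b *\<^sub>R u)"
  have x: "hvec x = c *\<^sub>R v + b *\<^sub>R u" using c(1) by (simp add: v_def)
  have "mink (hvec x - b *\<^sub>R u) (hvec x - b *\<^sub>R u) = - (c * c)"
    unfolding cc by (simp add: mink_simps ux u b_def[symmetric])
  then have vv: "mink v v = -1"
    using c(1) by (simp only: v_def mink_scaleR_left mink_scaleR_right) simp
  have "mink (hvec x - b *\<^sub>R u) (hvec x) = - (c * c)"
    unfolding cc by (simp add: mink_simps ux)
  then have vx: "mink v (hvec x) = - c"
    using c(1) by (simp only: v_def mink_scaleR_left) simp
  obtain y where y: "hvec y = v"
    using obtain_hyp2[of v x] vv vx c(1) by auto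
  have vu: "mink v u = 0" by (simp add: v_def mink_simps u b_def)
  have ch: "cosh (dist x y) = c"
    using vx by (simp add: cosh_dist_hyp2 y mink_commute)
  have yl: "y \<in> line u" by (simp add: line_def y vu)
  have le: "dist x y \<le> dist x z" if "z \<in> line u" for z
  proof -
    have "- mink (hvec x) (hvec z) = c * (- mink (hvec y) (hvec z))"
      using that by (simp add: x mink_simps y line_def mink_commute[of u])
    moreover have "c * 1 \<le> c * (- mink (hvec y) (hvec z))"
      using c(1) one_le_mink by (intro mult_left_mono) auto
    ultimately have "cosh (dist x y) \<le> cosh (dist x z)"
      unfolding ch by (simp add: cosh_dist_hyp2)
    then show ?thesis by (simp add: cosh_real_nonneg_le_iff)
  qed
  have "infdist x (line u) = dist x y"
  proof (rule antisym)
    show "infdist x (line u) \<le> dist x y" using yl by (rule infdist_le)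
    show "dist x y \<le> infdist x (line u)"
      unfolding infdist_def using yl le by (auto intro!: cINF_greatest)
  qed
  moreover have "sinh (dist x y) = \<bar>b\<bar>"
  proof -
    have "(sinh (dist x y))\<^sup>2 = \<bar>b\<bar>\<^sup>2"
      using ch c(2) by (simp add: sinh_square_eq)
    then show ?thesis by (rule power2_eq_imp_eq) auto
  qed
  ultimately show thesis using yl by (intro that[of y]) (auto simp: b_def)
qed

lemma sinh_infdist_line:
  assumes "mink u u = 1"
  shows "sinh (infdist x (line u)) = \<bar>mink (hvec x) u\<bar>"
  using line_foot[OF assms, of x] by metis

lemma bdd_above_infdist:
  fixes K :: "hyp2 set"
  assumes "compact K"
  shows "bdd_above ((\<lambda>x. infdist x H) ` K)"
  by (intro bounded_imp_bdd_above compact_imp_bounded compact_continuous_image assms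
      continuous_on_infdist continuous_on_id)

lemma le_lassak_width:
  assumes "compact K" "x \<in> K"
  shows "infdist x H \<le> lassak_width K H"
  unfolding lassak_width_def using assms bdd_above_infdist by (intro cSUP_upper) auto

lemma lassak_width_attained:
  assumes "compact K" "K \<noteq> {}"
  obtains x where "x \<in> K" "lassak_width K H = infdist x H"
proof -
  have "continuous_on K (\<lambda>x. infdist x H)"
    by (intro continuous_on_infdist continuous_on_id)
  then obtain x where x: "x \<in> K" "\<And>y. y \<in> K \<Longrightarrow> infdist y H \<le> infdist x H"
    using continuous_attains_sup[OF assms] by blast
  have "lassak_width K H = infdist x H"
    unfolding lassak_width_def using x by (intro cSup_eq_maximum) auto
  then show thesis using that x by blast
qed

lemma supporting_lineE:
  assumes "supporting_line K H"
  obtains u where "mink u u = 1" "H = line u" "H \<inter> K \<noteq> {}" "K \<subseteq> half_plane u"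
proof -
  obtain v where v: "mink v v > 0" "H = line v" "H \<inter> K \<noteq> {}" "K \<subseteq> half_plane v"
    using assms by (auto simp: supporting_line_def)
  define u where "u = (1 / sqrt (mink v v)) *\<^sub>R v"
  have "line u = line v" "half_plane u = half_plane v"
    using v(1) by (auto simp: u_def line_def half_plane_def mink_simps divide_le_0_iff)
  moreover have "mink u u = 1"
    using v(1) by (simp add: u_def mink_simps)
  ultimately show thesis using v by (intro that[of u]) auto
qed

lemma minimal_lassak_width_le:
  assumes "compact K" "supporting_line K H"
  shows "minimal_lassak_width K \<le> lassak_width K H"
  unfolding minimal_lassak_width_def
proof (rule cINF_lower)
  show "bdd_below (lassak_width K ` {H. supporting_line K H})"
  proof (rule bdd_belowI2)
    fix H assume "H \<in> {H. supporting_line K H}"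
    then obtain x where "x \<in> K" by (auto simp: supporting_line_def)
    then show "0 \<le> lassak_width K H"
      using le_lassak_width[OF assms(1), of x H] infdist_nonneg[of x H] by linarith
  qed
qed (use assms in simp)

section \<open>Horocycles\<close>

text \<open>Arc-length parametrization of the horocycle through \<open>x\<close> with ideal centre \<open>l\<close>; outside of
  \<open>horo_tangent x m l\<close> the value of \<open>horo\<close> is junk.\<close>

definition horo :: "hyp2 \<Rightarrow> complex \<times> real \<Rightarrow> complex \<times> real \<Rightarrow> real \<Rightarrow> hyp2" where
  "horo x m l t = Abs_hyp2 (hvec x + t *\<^sub>R m + (t\<^sup>2 / 2) *\<^sub>R l)"

definition horo_tangent :: "hyp2 \<Rightarrow> complex \<times> real \<Rightarrow> complex \<times> real \<Rightarrow> bool" where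
  "horo_tangent x m l \<longleftrightarrow> lightlike l \<and> mink (hvec x) l = -1 \<and>
     mink m (hvec x) = 0 \<and> mink m l = 0 \<and> mink m m = 1"

lemma hvec_horo:
  assumes "horo_tangent x m l"
  shows "hvec (horo x m l t) = hvec x + t *\<^sub>R m + (t\<^sup>2 / 2) *\<^sub>R l"
proof -
  note h = assms[unfolded horo_tangent_def]
  have c: "mink (hvec x) m = 0" "mink l m = 0" "mink l (hvec x) = -1" "mink l l = 0"
    using h by (simp_all add: mink_commute lightlike_def)
  define v where "v = hvec x + t *\<^sub>R m + (t\<^sup>2 / 2) *\<^sub>R l"
  have 1: "mink v v = -1"
    using h c by (simp add: v_def mink_simps power2_eq_square)
  have 2: "mink v (hvec x) < 0"
  proof -
    have "mink v (hvec x) = -1 - t\<^sup>2 / 2"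
      using h c by (simp add: v_def mink_simps)
    then show ?thesis using zero_le_power2[of t] by linarith
  qed
  obtain y where "hvec y = v"
    using obtain_hyp2[OF 1 2] by blast
  then show ?thesis
    unfolding horo_def v_def by (metis Rep_hyp2_inverse)
qed

lemma horo_0 [simp]: "horo x m l 0 = x"
  by (simp add: horo_def Rep_hyp2_inverse)

lemma continuous_horo:
  assumes "horo_tangent x m l" "continuous_on S f"
  shows "continuous_on S (\<lambda>t. horo x m l (f t))"
  by (intro continuous_hyp2) (simp add: hvec_horo[OF assms(1)] continuous_intros assms(2))

lemma horo_mem_horocycle:
  assumes "horo_tangent x m l"
  shows "horo x m l t \<in> horocycle l"
  using assms by (simp add: horocycle_def hvec_horo[OF assms] mink_simps)
    (simp add: horo_tangent_def lightlike_def)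

lemma horo_inj:
  assumes "horo_tangent x m l" "horo x m l s = horo x m l t"
  shows "s = t"
proof -
  have "mink (hvec (horo x m l r)) m = r" for r
    using assms(1) by (simp add: hvec_horo[OF assms(1)] mink_simps)
      (simp add: horo_tangent_def mink_commute)
  then show ?thesis using assms(2) by metis
qed

text \<open>The vector \<open>l - hvec x\<close> is the unit tangent at \<open>x\<close> towards the
  ideal centre. In the frame completed by \<open>m\<close>, the horocycle equation is linear and the
  hyperboloid equation leaves \<open>Y = 1 + t\<^sup>2 / 2\<close>, so \<open>t\<close> is the only
  free coordinate.\<close>

lemma horocycle_param:
  assumes l: "lightlike l" and x: "x \<in> horocycle l"
  obtains m where "horo_tangent x m l"
    "\<And>y. y \<in> horocycle l \<Longrightarrow> y = horo x m l (mink (hvec y) m)"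
proof -
  define f where "f = l - hvec x"
  have xl: "mink (hvec x) l = -1" "mink l (hvec x) = -1" "mink l l = 0"
    using x l by (auto simp: horocycle_def lightlike_def mink_commute)
  have f: "mink f (hvec x) = 0" "mink f f = 1"
    using xl by (simp_all add: f_def mink_simps)
  obtain m where m: "mink m (hvec x) = 0" "mink m f = 0" "mink m m = 1"
    and ex: "\<And>v. v = (- mink v (hvec x)) *\<^sub>R hvec x + mink v f *\<^sub>R f + mink v m *\<^sub>R m"
    using obtain_orthonormal_frame[OF f] by metis
  have lf: "l = hvec x + f" by (simp add: f_def)
  have ht: "horo_tangent x m l"
    using m l xl by (simp add: horo_tangent_def) (simp add: lf mink_simps)
  have "y = horo x m l (mink (hvec y) m)" if y: "y \<in> horocycle l" for y
  proof -
    define t Y F where "t = mink (hvec y) m" and "Y = - mink (hvec y) (hvec x)"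
      and "F = mink (hvec y) f"
    have ey: "hvec y = Y *\<^sub>R hvec x + F *\<^sub>R f + t *\<^sub>R m"
      using ex[of "hvec y"] by (simp add: t_def Y_def F_def)
    have F: "F = Y - 1"
      using y by (simp add: horocycle_def lf mink_simps F_def Y_def)
    have "mink (hvec y) (hvec y) = - (Y * Y) + F * F + t * t"
      by (subst (2) ey) (simp add: mink_simps t_def Y_def F_def)
    then have "Y = 1 + t\<^sup>2 / 2"
      by (simp add: F algebra_simps power2_eq_square)
    then have "hvec y = hvec (horo x m l t)"
      unfolding hvec_horo[OF ht] by (subst ey) (simp add: F lf algebra_simps)
    then show ?thesis by (simp add: Rep_hyp2_inject t_def)
  qed
  then show thesis using that ht by blast
qed

lemma horo_mem_h_convex:
  assumes K: "h_convex K" and h: "horo_tangent x m l"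
    and x: "x \<in> K" and y: "horo x m l t \<in> K" and s: "0 \<le> s" "s \<le> 1"
  shows "horo x m l (s * t) \<in> K"
proof (cases "t = 0")
  case False
  define g where "g = (\<lambda>r. horo x m l (r * t))"
  have "arc g"
    unfolding arc_def path_def g_def
    by (intro conjI continuous_horo[OF h] continuous_intros inj_onI)
      (use False in \<open>auto dest: horo_inj[OF h]\<close>)
  moreover have "path_image g \<subseteq> horocycle l"
    using horo_mem_horocycle[OF h] by (auto simp: path_image_def g_def)
  moreover have "pathstart g = x" "pathfinish g = horo x m l t"
    by (simp_all add: pathstart_def pathfinish_def g_def)
  moreover have "x \<noteq> horo x m l t"
    using horo_inj[OF h, of 0 t] False by auto
  moreover have "lightlike l" using h by (simp add: horo_tangent_def)
  ultimately have "path_image g \<subseteq> K"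
    using K x y unfolding h_convex_def by blast
  then show ?thesis using s by (auto simp: path_image_def g_def)
qed (use x in simp)

lemma closed_horoball: "closed (horoball l)"
  unfolding horoball_def
  by (intro closed_Collect_le continuous_intros continuous_on_id)

lemma mink_horo:
  assumes "horo_tangent x m l"
  shows "mink (hvec (horo x m l t)) k = mink (hvec x) k + t * mink m k + t\<^sup>2 / 2 * mink l k"
  by (simp add: hvec_horo[OF assms] mink_simps)

text \<open>Along the arc the product with \<open>k\<close> is a quadratic polynomial with leading
  coefficient \<open>mink l k / 2\<close>, which is nonpositive for two lightlike vectors. It is
  therefore concave and stays above the smaller of its end values.\<close>

lemma horo_mem_horoball:
  assumes h: "horo_tangent x m l" and k: "lightlike k"
    and "x \<in> horoball k" "horo x m l t \<in> horoball k" "0 \<le> s" "s \<le> 1"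
  shows "horo x m l (s * t) \<in> horoball k"
proof -
  have lk: "mink l k \<le> 0"
    using h k by (auto simp: horo_tangent_def intro: mink_lightlike_nonpos)
  let ?v = "\<lambda>t. mink (hvec (horo x m l t)) k"
  have "?v (s * t) = (1 - s) * ?v 0 + s * ?v t + s * (1 - s) * (- mink l k * t\<^sup>2 / 2)"
    by (simp add: mink_horo[OF h] power2_eq_square algebra_simps) (simp add: field_simps)
  moreover have "(1 - s) * (-1) \<le> (1 - s) * ?v 0" "s * (-1) \<le> s * ?v t"
    using assms by (intro mult_left_mono; simp add: horoball_def)+
  moreover have "0 \<le> s * (1 - s) * (- mink l k * t\<^sup>2 / 2)"
    using assms lk by (intro mult_nonneg_nonneg) (auto simp: zero_le_mult_iff mult_le_0_iff)
  moreover have "(1 - s) * (-1) + s * (-1) = (-1 :: real)" by simp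
  ultimately have "-1 \<le> ?v (s * t)" by linarith
  then show ?thesis by (simp add: horoball_def)
qed

text \<open>An arbitrary arc in a horocycle has a continuous injective parameter \<open>T\<close>,
  hence a monotone one. So it does not leave the part of the horocycle between its end points, to
  which \<open>horo_mem_horoball\<close> applies.\<close>

lemma h_convex_horoball:
  assumes k: "lightlike k"
  shows "h_convex (horoball k)"
  unfolding h_convex_def
proof (intro conjI ballI impI allI closed_horoball)
  fix x y l g
  assume x: "x \<in> horoball k" and y: "y \<in> horoball k" and "x \<noteq> y"
    and g: "lightlike l \<and> arc g \<and> path_image g \<subseteq> horocycle l \<and> pathstart g = x \<and> pathfinish g = y"
  then have gl: "\<And>s. 0 \<le> s \<Longrightarrow> s \<le> 1 \<Longrightarrow> g s \<in> horocycle l"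
    by (auto simp: path_image_def)
  have g01: "g 0 = x" "g 1 = y" using g by (auto simp: pathstart_def pathfinish_def)
  obtain m where h: "horo_tangent x m l"
    and par: "\<And>y. y \<in> horocycle l \<Longrightarrow> y = horo x m l (mink (hvec y) m)"
    using horocycle_param[of l x] g gl[of 0] g01 by auto
  define T where "T = (\<lambda>s. mink (hvec (g s)) m)"
  have gT: "g s = horo x m l (T s)" if "0 \<le> s" "s \<le> 1" for s
    using par[OF gl[OF that]] by (simp add: T_def)
  have T0: "T 0 = 0" using h by (simp add: T_def g01 horo_tangent_def mink_commute)
  have cont: "continuous_on {0..1} T"
    unfolding T_def using g by (intro continuous_intros) (auto simp: arc_def path_def)
  have inj: "inj_on T {0..1}"
  proof (rule inj_onI)
    fix a b assume ab: "a \<in> {0..1}" "b \<in> {0..1}" "T a = T b"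
    then have "g a = g b" using gT[of a] gT[of b] by simp
    then show "a = b" using g ab by (auto simp: arc_def dest: inj_onD)
  qed
  have T1: "horo x m l (T 1) \<in> horoball k" using gT[of 1] g01 y by simp
  show "path_image g \<subseteq> horoball k"
  proof
    fix z assume "z \<in> path_image g"
    then obtain s where s: "0 \<le> s" "s \<le> 1" "z = g s" by (auto simp: path_image_def)
    have "0 \<le> T s / T 1 \<and> T s / T 1 \<le> 1 \<and> T s = T s / T 1 * T 1"
    proof (cases "s = 0 \<or> s = 1")
      case True
      have "T 1 \<noteq> 0" using inj_onD[OF inj, of 1 0] T0 by auto
      then show ?thesis using True T0 by auto
    next
      case False
      then have "(T 0 < T s \<and> T s < T 1) \<or> (T 1 < T s \<and> T s < T 0)"
        using s by (intro continuous_inj_imp_mono cont inj) auto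
      then show ?thesis using T0 by (auto simp: divide_simps)
    qed
    then obtain r where r: "0 \<le> r" "r \<le> 1" "T s = r * T 1" by metis
    show "z \<in> horoball k"
      using horo_mem_horoball[OF h k x T1 r(1,2)] gT[OF s(1,2)] s(3) r(3) by simp
  qed
qed

lemma h_convex_Int:
  assumes "h_convex A" "h_convex B"
  shows "h_convex (A \<inter> B)"
  unfolding h_convex_def
proof (intro conjI ballI impI allI)
  show "closed (A \<inter> B)" using assms by (auto simp: h_convex_def)
  fix x y l g
  assume xy: "x \<in> A \<inter> B" "y \<in> A \<inter> B" "x \<noteq> y"
    and g: "lightlike l \<and> arc g \<and> path_image g \<subseteq> horocycle l \<and> pathstart g = x \<and> pathfinish g = y"
  have "path_image g \<subseteq> A" using assms(1) xy g unfolding h_convex_def by blast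
  moreover have "path_image g \<subseteq> B" using assms(2) xy g unfolding h_convex_def by blast
  ultimately show "path_image g \<subseteq> A \<inter> B" by blast
qed

section \<open>Separation by horoballs\<close>

text \<open>Seen from \<open>p\<close>, the ideal centre lies in direction \<open>- e\<close>. So
  \<open>e\<close> points to the place where a disk growing around \<open>p\<close> first touches
  the boundary of the horoball.\<close>

lemma lightlike_decompose:
  assumes "lightlike l"
  obtains e where "mink e (hvec p) = 0" "mink e e = 1"
    "l = (- mink (hvec p) l) *\<^sub>R (hvec p - e)"
proof -
  define c where "c = - mink (hvec p) l"
  have c: "c > 0" using lightlike_neg[OF assms] by (simp add: c_def)
  define e where "e = hvec p - (1 / c) *\<^sub>R l"
  have l: "mink l l = 0" "mink (hvec p) l = - c" "mink l (hvec p) = - c"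
    using assms by (auto simp: lightlike_def c_def mink_commute)
  have "mink e (hvec p) = 0" "mink e e = 1"
    using c by (simp_all add: e_def mink_simps l)
  moreover have "l = c *\<^sub>R (hvec p - e)" using c by (simp add: e_def)
  ultimately show thesis using that by (simp add: c_def)
qed

lemma lightlike_tangent:
  assumes "mink e (hvec p) = 0" "mink e e = 1" "c > 0"
  shows "lightlike (c *\<^sub>R (hvec p - e))"
  using assms by (simp add: lightlike_iff[of _ p] mink_simps mink_commute[of "hvec p" e])

lemma obtain_direction:
  assumes "z \<noteq> x"
  obtains n where "mink n (hvec z) = 0" "mink n n = 1"
    "hvec x = cosh (dist z x) *\<^sub>R hvec z + sinh (dist z x) *\<^sub>R n"
proof -
  define C S where "C = cosh (dist z x)" and "S = sinh (dist z x)"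
  have S: "S > 0" using assms by (simp add: S_def)
  have CS: "C * C = 1 + S * S"
    using hyperbolic_pythagoras[of "dist z x"] by (simp add: C_def S_def power2_eq_square)
  have m: "mink (hvec z) (hvec x) = - C" "mink (hvec x) (hvec z) = - C"
    by (simp_all add: C_def cosh_dist_hyp2 mink_commute)
  define n where "n = (1 / S) *\<^sub>R (hvec x - C *\<^sub>R hvec z)"
  have "mink n (hvec z) = 0" by (simp add: n_def mink_simps m)
  moreover have "mink (hvec x - C *\<^sub>R hvec z) (hvec x - C *\<^sub>R hvec z) = S * S"
    using CS by (simp add: mink_simps m)
  then have "mink n n = 1"
    using S by (simp only: n_def mink_scaleR_left mink_scaleR_right) simp
  moreover have "hvec x = C *\<^sub>R hvec z + S *\<^sub>R n"
    using S by (simp add: n_def)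
  ultimately show thesis using that by (simp add: C_def S_def)
qed

text \<open>A point outside the horoball with outer normal \<open>n\<close> at \<open>z\<close> can be joined to \<open>z\<close> by a
  horocyclic arc which starts on the side of \<open>n\<close>. Here \<open>Y, b, c\<close> are the coordinates of the
  point in a frame at \<open>z\<close> with \<open>n\<close> as second vector, and \<open>\<tau>\<close> is the length of the arc.\<close>

lemma arc_direction_positive:
  fixes b c Y \<tau> :: real
  assumes Y: "Y\<^sup>2 = 1 + b\<^sup>2 + c\<^sup>2" and out: "Y + b > 1" and \<tau>: "\<tau>\<^sup>2 = 2 * (Y - 1)" "\<tau> > 0"
  shows "b + \<bar>c\<bar> * \<tau> / 2 > 0"
proof (cases "b > 0")
  case False
  have b: "- b < \<tau>\<^sup>2 / 2" using out \<tau> by simp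
  then have "b\<^sup>2 < (\<tau>\<^sup>2 / 2)\<^sup>2"
    using False by (subst power2_minus[of b, symmetric]) (intro power_strict_mono, auto)
  moreover have "Y = 1 + \<tau>\<^sup>2 / 2" using \<tau>(1) by (simp add: field_simps)
  then have "b\<^sup>2 + c\<^sup>2 = (\<tau>\<^sup>2 / 2)\<^sup>2 + \<tau>\<^sup>2"
    using Y by (simp add: power2_eq_square algebra_simps)
  ultimately have "\<tau>\<^sup>2 < \<bar>c\<bar>\<^sup>2" by simp
  then have "\<tau> < \<bar>c\<bar>" by (rule power2_less_imp_less) simp
  then have "\<tau> * \<tau> < \<bar>c\<bar> * \<tau>" using \<tau> by simp
  then show ?thesis using b by (simp add: power2_eq_square)
qed (use \<tau> in \<open>simp add: add_pos_nonneg\<close>)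

text \<open>The horocyclic counterpart of a supporting half-space at a nearest point. A point
  \<open>y\<close> of \<open>K\<close> outside the horoball would be joined to \<open>z\<close> by a
  horocyclic arc in \<open>K\<close> that sets out on the side of \<open>n\<close>, that is towards
  \<open>x\<close>, so some point of \<open>K\<close> would be nearer to \<open>x\<close> than
  \<open>z\<close>.\<close>

lemma nearest_point_horoball:
  assumes K: "h_convex K" "z \<in> K" and n: "mink n (hvec z) = 0" "mink n n = 1" and d: "d > 0"
    and x: "hvec x = cosh d *\<^sub>R hvec z + sinh d *\<^sub>R n"
    and nearest: "\<And>y. y \<in> K \<Longrightarrow> dist x z \<le> dist x y"
  shows "K \<subseteq> horoball (hvec z - n)"
proof (rule ccontr)
  assume "\<not> K \<subseteq> horoball (hvec z - n)"
  then obtain y where "y \<in> K" "y \<notin> horoball (hvec z - n)" by blast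
  then have y: "y \<in> K" "mink (hvec y) (hvec z - n) < -1" by (auto simp: horoball_def)
  obtain k where k: "mink k (hvec z) = 0" "mink k n = 0" "mink k k = 1"
    and ex: "\<And>v. v = (- mink v (hvec z)) *\<^sub>R hvec z + mink v n *\<^sub>R n + mink v k *\<^sub>R k"
    using obtain_orthonormal_frame[OF n] by metis
  have com: "mink (hvec z) n = 0" "mink (hvec z) k = 0" "mink n k = 0"
    using n k by (simp_all add: mink_commute)
  define Y b c where "Y = - mink (hvec y) (hvec z)" and "b = mink (hvec y) n"
    and "c = mink (hvec y) k"
  have ey: "hvec y = Y *\<^sub>R hvec z + b *\<^sub>R n + c *\<^sub>R k"
    using ex[of "hvec y"] by (simp add: Y_def b_def c_def)
  have "mink (hvec y) (hvec y) = - (Y * Y) + b * b + c * c"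
    by (subst (2) ey) (simp add: mink_simps Y_def b_def c_def)
  then have YY: "Y\<^sup>2 = 1 + b\<^sup>2 + c\<^sup>2" by (simp add: power2_eq_square)
  have out: "Y + b > 1" using y(2) by (simp add: mink_simps Y_def b_def)
  have "Y \<noteq> 1"
  proof
    assume "Y = 1"
    then have "b\<^sup>2 + c\<^sup>2 = 0" using YY by simp
    then have "b = 0" by (simp add: sum_power2_eq_zero_iff)
    then show False using out \<open>Y = 1\<close> by simp
  qed
  then have Y1: "Y > 1" using one_le_mink[of y z] by (simp add: Y_def)
  define \<tau> where "\<tau> = sqrt (2 * (Y - 1))"
  have \<tau>: "\<tau>\<^sup>2 = 2 * (Y - 1)" "\<tau> > 0" using Y1 by (simp_all add: \<tau>_def)
  \<comment> \<open>The two signs belong to the two horocyclic arcs from \<open>z\<close> to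
    \<open>y\<close>. This one gives \<open>- c * t = \<bar>c\<bar> * \<tau>\<close>, as
    \<open>arc_direction_positive\<close> requires.\<close>
  define t where "t = (if c > 0 then - \<tau> else \<tau>)"
  have t: "t\<^sup>2 = 2 * (Y - 1)" "t \<noteq> 0" "- c * t = \<bar>c\<bar> * \<tau>"
    using \<tau> by (auto simp: t_def)
  define h where "h = Y - 1"
  have th: "t\<^sup>2 / 2 = h" "t * t = 2 * h" using t(1) by (simp_all add: h_def power2_eq_square)
  define Q where "Q = b * b + c * c"
  have Q: "Q = h * h + t * t"
    using YY by (simp add: th(2) h_def Q_def power2_eq_square algebra_simps)
  have Q0: "Q > 0" unfolding Q using t(2) by (metis add_nonneg_pos not_real_square_gt_zero zero_le_square)
  \<comment> \<open>The arc with ideal centre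
    \<open>hvec z + f1 *\<^sub>R n + f2 *\<^sub>R k\<close> ends at \<open>y\<close> if the rotation
    with cosine \<open>f1\<close> and sine \<open>f2\<close> takes \<open>(h, t)\<close> to
    \<open>(b, c)\<close>. This is the complex quotient of the two, of modulus 1 since both have
    square length \<open>Q\<close>.\<close>
  define f1 f2 where "f1 = (b * h + c * t) / Q" and "f2 = (c * h - b * t) / Q"
  have "f1 * f1 + f2 * f2 = ((b * h + c * t) * (b * h + c * t) + (c * h - b * t) * (c * h - b * t)) / (Q * Q)"
    by (simp only: f1_def f2_def times_divide_times_eq add_divide_distrib[symmetric])
  also have "(b * h + c * t) * (b * h + c * t) + (c * h - b * t) * (c * h - b * t)
      = (b * b + c * c) * (h * h + t * t)"
    by (simp add: algebra_simps)
  also have "\<dots> = Q * Q" by (simp only: Q_def[symmetric] Q[symmetric])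
  finally have f: "f1 * f1 + f2 * f2 = 1" using Q0 by simp
  have "h * f1 - t * f2 = (h * (b * h + c * t) - t * (c * h - b * t)) / Q"
    by (simp only: f1_def f2_def times_divide_eq_right diff_divide_distrib[symmetric])
  also have "h * (b * h + c * t) - t * (c * h - b * t) = b * (h * h + t * t)"
    by (simp add: algebra_simps)
  finally have b_eq: "b = h * f1 - t * f2" using Q0 by (simp add: Q[symmetric])
  have "h * f2 + t * f1 = (h * (c * h - b * t) + t * (b * h + c * t)) / Q"
    by (simp only: f1_def f2_def times_divide_eq_right add_divide_distrib[symmetric])
  also have "h * (c * h - b * t) + t * (b * h + c * t) = c * (h * h + t * t)"
    by (simp add: algebra_simps)
  finally have c_eq: "c = h * f2 + t * f1" using Q0 by (simp add: Q[symmetric])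
  define l m where "l = hvec z + f1 *\<^sub>R n + f2 *\<^sub>R k" and "m = f1 *\<^sub>R k - f2 *\<^sub>R n"
  have "mink l l = 0" "mink (hvec z) l = -1" "mink m (hvec z) = 0" "mink m l = 0" "mink m m = 1"
    using f by (simp_all add: l_def m_def mink_simps n k com)
  then have ht: "horo_tangent z m l"
    by (simp add: horo_tangent_def lightlike_iff[of l z])
  have "Y = 1 + h" by (simp add: h_def)
  then have "hvec (horo z m l t) = hvec y"
    unfolding hvec_horo[OF ht] ey th(1)
    by (subst b_eq, subst c_eq) (simp add: l_def m_def algebra_simps)
  then have "horo z m l t \<in> K" using y(1) by (simp add: Rep_hyp2_inject)
  then have inK: "horo z m l (s * t) \<in> K" if "0 \<le> s" "s \<le> 1" for s
    using horo_mem_h_convex[OF K(1) ht K(2)] that by blast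
  define A where "A = t * mink m (hvec x)"
  define B where "B = t\<^sup>2 / 2 * mink l (hvec x)"
  have "b - c * t / 2 > 0"
    using arc_direction_positive[OF YY out \<tau>] t(3) by (simp add: algebra_simps)
  moreover have "t * (- f2) = t\<^sup>2 * (b - c * t / 2) / Q"
    unfolding f2_def th(1)[symmetric] using Q0 by (simp add: field_simps power2_eq_square)
  ultimately have "t * (- f2) > 0" using t(2) Q0 by (metis divide_pos_pos mult_pos_pos zero_less_power2)
  moreover have "A = (t * (- f2)) * sinh d"
    by (simp add: A_def x m_def mink_simps n k com mink_commute)
  ultimately have A: "A > 0" using d by (metis mult_pos_pos sinh_real_pos_iff)
  \<comment> \<open>\<open>A > 0\<close> is the linear coefficient of the product with
    \<open>x\<close> along the arc and \<open>B\<close> the quadratic one; this \<open>s\<close> is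
    small enough for the linear term to win.\<close>
  define s where "s = A / (A + \<bar>B\<bar> + 1)"
  have D: "A + \<bar>B\<bar> + 1 > 0" using A by linarith
  have s: "0 < s" "s \<le> 1" using A D by (simp_all add: s_def)
  have "s * \<bar>B\<bar> < A"
    using A by (simp add: s_def pos_divide_less_eq[OF D])
  then have "A + s * B > 0"
    using s abs_ge_minus_self[of "s * B"] by (simp add: abs_mult)
  then have pos: "s * (A + s * B) > 0" using s by simp
  have "mink (hvec (horo z m l (s * t))) (hvec x) = mink (hvec z) (hvec x) + s * (A + s * B)"
    by (simp add: mink_horo[OF ht] A_def B_def power2_eq_square algebra_simps)
  then have "cosh (dist x (horo z m l (s * t))) < cosh (dist x z)"
    using pos by (simp add: cosh_dist_hyp2 mink_commute[of "hvec x"])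
  then have "dist x (horo z m l (s * t)) < dist x z"
    using cosh_real_nonneg_less_iff zero_le_dist by blast
  then show False using nearest[OF inK, of s] s by simp
qed

lemma h_convex_separation:
  assumes K: "compact K" "h_convex K" "K \<noteq> {}" and x: "x \<notin> K"
  obtains l where "lightlike l" "K \<subseteq> horoball l" "x \<notin> horoball l"
proof -
  have "continuous_on K (\<lambda>y. dist x y)" by (intro continuous_intros)
  then obtain z where z: "z \<in> K" "\<And>y. y \<in> K \<Longrightarrow> dist x z \<le> dist x y"
    using continuous_attains_inf[OF K(1,3)] by blast
  define d where "d = dist z x"
  have "z \<noteq> x" using z x by auto
  then have d: "d > 0" by (simp add: d_def)
  obtain n where n: "mink n (hvec z) = 0" "mink n n = 1"
    and xe: "hvec x = cosh d *\<^sub>R hvec z + sinh d *\<^sub>R n"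
    using obtain_direction[OF \<open>z \<noteq> x\<close>] by (metis d_def)
  have "mink (hvec x) (hvec z - n) = - exp d"
    using n by (simp add: xe mink_simps mink_commute[of "hvec z" n] cosh_plus_sinh[symmetric])
  then have "x \<notin> horoball (hvec z - n)"
    using d by (simp add: horoball_def)
  moreover have "lightlike (hvec z - n)"
    using lightlike_tangent[OF n, of 1] by simp
  ultimately show thesis
    using nearest_point_horoball[OF K(2) z(1) n d xe z(2)] that by blast
qed

text \<open>On the ray from \<open>p\<close> in direction \<open>e\<close>, the value
  \<open>- mink y l\<close> equals \<open>c * exp t\<close> at distance \<open>t\<close>, where
  \<open>c = - mink (hvec p) l\<close>, and no other point at distance \<open>t\<close> has a larger
  value.\<close>

lemma cball_subset_horoball:
  assumes l: "lightlike l" and r: "0 \<le> r"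
  shows "cball p r \<subseteq> horoball l \<longleftrightarrow> - mink (hvec p) l \<le> exp (- r)"
proof -
  define c where "c = - mink (hvec p) l"
  have c: "c > 0" using lightlike_neg[OF l] by (simp add: c_def)
  obtain e where e: "mink e (hvec p) = 0" "mink e e = 1" and le: "l = c *\<^sub>R (hvec p - e)"
    using lightlike_decompose[OF l, of p] by (metis c_def)
  have iff: "c \<le> exp (- r) \<longleftrightarrow> c * exp r \<le> 1"
    by (simp add: exp_minus field_simps)
  have pe: "mink (hvec p) e = 0" using e by (simp add: mink_commute)
  show ?thesis
    unfolding c_def[symmetric] iff
  proof
    assume sub: "cball p r \<subseteq> horoball l"
    obtain y where y: "hvec y = cosh r *\<^sub>R hvec p + sinh r *\<^sub>R e"
      using obtain_exp[OF e, of r] by blast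
    have "cosh (dist p y) = cosh r" by (simp add: cosh_dist_hyp2 y mink_simps pe)
    then have "dist p y = r" using r cosh_real_nonneg_less_iff[of "dist p y" r]
      cosh_real_nonneg_less_iff[of r "dist p y"] by (metis linorder_neqE_linordered_idom less_irrefl zero_le_dist)
    then have "y \<in> horoball l" using sub by auto
    moreover have "mink (hvec y) l = - (c * (cosh r + sinh r))"
      by (simp add: y le mink_simps e pe algebra_simps)
    ultimately show "c * exp r \<le> 1" by (simp add: horoball_def cosh_plus_sinh)
  next
    assume le1: "c * exp r \<le> 1"
    show "cball p r \<subseteq> horoball l"
    proof
      fix x assume "x \<in> cball p r"
      then have xr: "dist p x \<le> r" by simp
      have X: "mink (hvec x) (hvec p) = - cosh (dist p x)"
        by (simp add: cosh_dist_hyp2 mink_commute)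
      have "(mink (hvec x) e)\<^sup>2 \<le> (sinh (dist p x))\<^sup>2"
        using tangent_component_le[OF e, of x] by (simp add: X sinh_square_eq)
      then have "mink (hvec x) e \<le> sinh (dist p x)"
        using abs_le_square_iff[of "mink (hvec x) e" "sinh (dist p x)"] by simp
      then have "c * (cosh (dist p x) + mink (hvec x) e) \<le> c * exp (dist p x)"
        using c by (simp add: cosh_plus_sinh[symmetric])
      then have "- mink (hvec x) l \<le> c * exp (dist p x)"
        by (simp add: le mink_simps X algebra_simps)
      also have "\<dots> \<le> c * exp r" using c xr by simp
      finally show "x \<in> horoball l" using le1 by (simp add: horoball_def)
    qed
  qed
qed

section \<open>The incircle of an h-convex body\<close>

text \<open>The dual of \<open>K\<close>: the horoballs that contain it, as vectors. The zero vector
  is included as the limit of ever larger horoballs, which makes the set closed.\<close>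

definition horo_hull :: "hyp2 set \<Rightarrow> (complex \<times> real) set" where
  "horo_hull K = {l. mink l l = 0 \<and> 0 \<le> snd l \<and> (\<forall>x\<in>K. -1 \<le> mink (hvec x) l)}"

lemma horo_hull_cases:
  assumes "l \<in> horo_hull K"
  obtains "l = 0" | "lightlike l" "K \<subseteq> horoball l"
proof (cases "snd l = 0")
  case True
  then have "fst l = 0" using assms by (simp add: horo_hull_def mink_def)
  then show thesis using that True by (simp add: prod_eq_iff)
next
  case False
  then show thesis using assms that by (auto simp: horo_hull_def lightlike_def horoball_def)
qed

lemma horo_hullI: "lightlike l \<Longrightarrow> K \<subseteq> horoball l \<Longrightarrow> l \<in> horo_hull K"
  by (auto simp: horo_hull_def lightlike_def horoball_def)

text \<open>Boundedness comes from a single point: \<open>hvec x0\<close> lies strictly inside the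
  light cone, so \<open>- mink (hvec x0) l\<close> controls the size of \<open>l\<close>.\<close>

lemma compact_horo_hull:
  assumes "x0 \<in> K"
  shows "compact (horo_hull K)"
proof -
  have "horo_hull K = {l. mink l l = 0} \<inter> {l. 0 \<le> snd l} \<inter> (\<Inter>x\<in>K. {l. -1 \<le> mink (hvec x) l})"
    by (auto simp: horo_hull_def)
  moreover have "closed {l. mink l l = 0}" "closed {l :: complex \<times> real. 0 \<le> snd l}"
    by (intro closed_Collect_eq closed_Collect_le continuous_intros continuous_on_id)+
  moreover have "closed (\<Inter>x\<in>K. {l. -1 \<le> mink (hvec x) l})"
    by (intro closed_INT ballI closed_Collect_le continuous_intros continuous_on_id)
  ultimately have cl: "closed (horo_hull K)" by (simp add: closed_Int)
  define \<delta> where "\<delta> = snd (hvec x0) - norm (fst (hvec x0))"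
  have \<delta>: "\<delta> > 0" using norm_fst_hvec_less[of x0] by (simp add: \<delta>_def)
  have "norm l \<le> 2 / \<delta>" if l: "l \<in> horo_hull K" for l
  proof -
    have nl: "norm (fst l) = snd l"
      using l by (auto simp: horo_hull_def mink_def norm_eq_sqrt_inner real_sqrt_mult)
    have "snd l * \<delta> \<le> - mink (hvec x0) l"
      using norm_cauchy_schwarz[of "fst (hvec x0)" "fst l"]
      by (simp add: nl \<delta>_def mink_def algebra_simps)
    also have "\<dots> \<le> 1" using l assms by (auto simp: horo_hull_def)
    finally have "snd l \<le> 1 / \<delta>" using \<delta> by (simp add: field_simps)
    moreover have "norm l \<le> norm (fst l) + norm (snd l)" by (metis norm_Pair_le prod.collapse)
    moreover have "0 \<le> snd l" using l by (simp add: horo_hull_def)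
    ultimately show ?thesis using nl by simp
  qed
  then have "bounded (horo_hull K)" unfolding bounded_iff by blast
  then show ?thesis using cl by (simp add: compact_eq_bounded_closed)
qed

lemma horo_hull_nontrivial:
  assumes "compact K"
  obtains l where "lightlike l" "K \<subseteq> horoball l"
proof -
  have "compact ((\<lambda>x. snd (hvec x)) ` K)"
    by (intro compact_continuous_image assms continuous_intros continuous_on_id)
  then obtain M where M: "\<And>x. x \<in> K \<Longrightarrow> snd (hvec x) \<le> M"
    using compact_imp_bounded bounded_imp_bdd_above unfolding bdd_above_def by (metis image_eqI)
  define N where "N = max M 1"
  define l where "l = (complex_of_real (1 / (2 * N)), 1 / (2 * N))"
  have N: "N \<ge> 1" "\<And>x. x \<in> K \<Longrightarrow> snd (hvec x) \<le> N" using M by (force simp: N_def)+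
  have "lightlike l" using N(1) by (simp add: lightlike_def l_def mink_coords)
  moreover have "x \<in> horoball l" if "x \<in> K" for x
  proof -
    have "\<bar>Re (fst (hvec x))\<bar> \<le> snd (hvec x)"
      using abs_Re_le_cmod[of "fst (hvec x)"] norm_fst_hvec_less[of x] by linarith
    then have "snd (hvec x) - Re (fst (hvec x)) \<le> 2 * N" using N(2)[OF that] by linarith
    then have "(snd (hvec x) - Re (fst (hvec x))) / (2 * N) \<le> 1"
      using N(1) by (subst pos_divide_le_eq) auto
    moreover have "mink (hvec x) l = - ((snd (hvec x) - Re (fst (hvec x))) / (2 * N))"
      by (simp add: mink_coords l_def diff_divide_distrib)
    ultimately show ?thesis by (simp add: horoball_def)
  qed
  ultimately show thesis using that by blast
qed

lemma cball_subset_iff: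
  assumes K: "compact K" "h_convex K" "K \<noteq> {}" and r: "0 \<le> r"
  shows "cball p r \<subseteq> K \<longleftrightarrow> (\<forall>l\<in>horo_hull K. - mink (hvec p) l \<le> exp (- r))"
proof
  assume sub: "cball p r \<subseteq> K"
  show "\<forall>l\<in>horo_hull K. - mink (hvec p) l \<le> exp (- r)"
  proof
    fix l assume "l \<in> horo_hull K"
    then show "- mink (hvec p) l \<le> exp (- r)"
    proof (cases rule: horo_hull_cases)
      case 2
      then show ?thesis using sub cball_subset_horoball[OF 2(1) r, of p] by blast
    qed simp
  qed
next
  assume le: "\<forall>l\<in>horo_hull K. - mink (hvec p) l \<le> exp (- r)"
  show "cball p r \<subseteq> K"
  proof (rule ccontr)
    assume "\<not> cball p r \<subseteq> K"
    then obtain x where x: "x \<in> cball p r" "x \<notin> K" by blast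
    obtain l where l: "lightlike l" "K \<subseteq> horoball l" "x \<notin> horoball l"
      using h_convex_separation[OF K x(2)] .
    then show False
      using cball_subset_horoball[OF l(1) r, of p] le horo_hullI[OF l(1,2)] x(1) by blast
  qed
qed

text \<open>By \<open>cball_subset_iff\<close>, the largest disk about \<open>q\<close> has radius
  \<open>s\<close> where \<open>exp (- s)\<close> is the maximum of \<open>- mink (hvec q) l\<close>
  over \<open>horo_hull K\<close>. So an incentre minimizes this maximum. The third property is the
  minimality of the value \<open>exp (- r)\<close>, stated for all \<open>q\<close>.\<close>

lemma incenter:
  assumes "h_convex_body K"
  obtains p r where "r > 0" "\<And>l. l \<in> horo_hull K \<Longrightarrow> - mink (hvec p) l \<le> exp (- r)"
    "\<And>q. \<exists>l\<in>horo_hull K. exp (- r) \<le> - mink (hvec q) l" "cball p r \<subseteq> K" "inradius K = r"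
proof -
  have K: "compact K" "h_convex K" "interior K \<noteq> {}" using assms by (auto simp: h_convex_body_def)
  have K0: "K \<noteq> {}" using K(3) interior_subset[of K] by auto
  then obtain x0 where x0: "x0 \<in> K" by blast
  define F where "F = horo_hull K"
  have F: "compact F" using compact_horo_hull[OF x0] by (simp add: F_def)
  have F0: "0 \<in> F" by (simp add: F_def horo_hull_def)
  \<comment> \<open>The epigraph of the maximum, cut off to a compact set by the base
    \<open>K\<close> and the heights at most 1. Its lowest point gives the centre and
    \<open>exp (- r)\<close>.\<close>
  define P where "P = (K \<times> {0..1::real}) \<inter> (\<Inter>l\<in>F. {q. - mink (hvec (fst q)) l \<le> snd q})"
  have "closed {q. - mink (hvec (fst q)) l \<le> snd q}" for l
    by (intro closed_Collect_le continuous_intros continuous_on_id)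
  then have P: "compact P"
    unfolding P_def by (intro compact_Int_closed compact_Times K(1) closed_INT) auto
  obtain q0 \<epsilon> where q0: "\<epsilon> > 0" "cball q0 \<epsilon> \<subseteq> K"
    using K(3) mem_interior_cball by blast
  have q0P: "(q0, exp (- \<epsilon>)) \<in> P"
    using q0 cball_subset_iff[OF K(1,2) K0, of \<epsilon> q0] by (auto simp: P_def F_def)
  have "continuous_on P snd" by (intro continuous_intros)
  then obtain pG where pG: "pG \<in> P" "\<And>q. q \<in> P \<Longrightarrow> snd pG \<le> snd q"
    using continuous_attains_inf[OF P] q0P by blast
  obtain p G where "pG = (p, G)" by (metis surj_pair)
  note pG = pG[unfolded this snd_conv]
  have G1: "G \<le> 1" and pF: "\<And>l. l \<in> F \<Longrightarrow> - mink (hvec p) l \<le> G"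
    using pG(1) by (auto simp: P_def)
  obtain l1 where "lightlike l1" "K \<subseteq> horoball l1" using horo_hull_nontrivial[OF K(1)] .
  then have G0: "G > 0"
    using pF[of l1] lightlike_neg[of l1 p] horo_hullI[of l1 K] by (auto simp: F_def)
  define r where "r = - ln G"
  have er: "exp (- r) = G" using G0 by (simp add: r_def)
  have "G < 1" using pG(2)[OF q0P] q0(1) by (metis exp_less_one_iff le_less_trans neg_less_0_iff_less snd_conv)
  then have r: "r > 0" using G0 by (simp add: r_def)
  have max: "\<exists>l\<in>F. exp (- r) \<le> - mink (hvec q) l" for q
  proof (cases "q \<in> K")
    case True
    have "continuous_on F (\<lambda>l. - mink (hvec q) l)" by (intro continuous_intros continuous_on_id)
    then obtain l where l: "l \<in> F" "\<And>k. k \<in> F \<Longrightarrow> - mink (hvec q) k \<le> - mink (hvec q) l"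
      using continuous_attains_sup[OF F] F0 by blast
    have "(q, - mink (hvec q) l) \<in> P"
      using True l l(2)[OF F0] by (auto simp: P_def F_def horo_hull_def)
    then show ?thesis using pG(2) l er by force
  next
    case False
    \<comment> \<open>For \<open>q\<close> outside of \<open>K\<close>, a separating horoball has a
      value above 1, so cutting off the base loses no minimum.\<close>
    obtain l where "lightlike l" "K \<subseteq> horoball l" "q \<notin> horoball l"
      using h_convex_separation[OF K(1,2) K0 False] .
    then show ?thesis
      using G1 er horo_hullI[of l K] by (intro bexI[of _ l]) (auto simp: horoball_def F_def)
  qed
  have sub: "cball p r \<subseteq> K"
    using cball_subset_iff[OF K(1,2) K0, of r p] r pF er by (simp add: F_def)
  have "inradius K = r"
    unfolding inradius_def
  proof (intro cSup_eq_maximum)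
    show "r \<in> {r. 0 < r \<and> (\<exists>p. cball p r \<subseteq> K)}" using r sub by blast
    fix s assume "s \<in> {r. 0 < r \<and> (\<exists>p. cball p r \<subseteq> K)}"
    then obtain q where s: "s > 0" "cball q s \<subseteq> K" by blast
    obtain l where l: "l \<in> F" "exp (- r) \<le> - mink (hvec q) l" using max by blast
    then have "- mink (hvec q) l \<le> exp (- s)"
      using cball_subset_iff[OF K(1,2) K0, of s q] s by (simp add: F_def)
    then have "exp (- r) \<le> exp (- s)" using l(2) by linarith
    then show "s \<le> r" by simp
  qed
  then show thesis using that[of r p] r pF er max sub by (simp add: F_def)
qed

text \<open>Caratheodory's theorem in real dimension 2. The three points may coincide, so fewer
  points need no separate treatment later.\<close>

lemma convex_hull_3_points:
  fixes A :: "complex set"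
  assumes "0 \<in> convex hull A"
  obtains a b c u v w where "a \<in> A" "b \<in> A" "c \<in> A" "0 \<le> u" "0 \<le> v" "0 \<le> w" "u + v + w = 1"
    "u *\<^sub>R a + v *\<^sub>R b + w *\<^sub>R c = 0"
proof -
  obtain S where S: "finite S" "S \<subseteq> A" "card S \<le> 3" "0 \<in> convex hull S"
    using assms unfolding caratheodory[of A] by auto
  have "S \<noteq> {}" using S(4) by auto
  then have "card S = 1 \<or> card S = 2 \<or> card S = 3"
    using S(1,3) card_0_eq[OF S(1)] by linarith
  then obtain a b c where abc: "S = {a, b, c}"
    by (metis card_1_singletonE card_2_iff card_3_iff insert_absorb2)
  then show thesis
    using S(2,4) that unfolding abc convex_hull_3 by (smt (verit, best) insert_subset mem_Collect_eq)
qed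

text \<open>The first-order condition of the minimax problem. Were 0 outside the convex hull of the
  contact directions, some \<open>a\<close> would have positive product with all of them, and moving
  the centre against \<open>a\<close> would deepen it in all active horoballs. Instead of
  differentiating a maximum, the proof moves the centre by \<open>t n\<close> and picks
  \<open>l n\<close> still attaining at least \<open>exp (- r)\<close>; a limit \<open>l'\<close> of
  these is active with \<open>mink W l' \<ge> 0\<close>, a contradiction.\<close>

lemma contact_points:
  assumes K: "h_convex_body K" and r: "r > 0"
    and le: "\<And>l. l \<in> horo_hull K \<Longrightarrow> - mink (hvec p) l \<le> exp (- r)"
    and max: "\<And>q. \<exists>l\<in>horo_hull K. exp (- r) \<le> - mink (hvec q) l"
  obtains e1 e2 e3 u1 u2 u3 where
    "\<And>e. e \<in> {e1, e2, e3} \<Longrightarrow> mink e (hvec p) = 0 \<and> mink e e = 1 \<and>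
       exp (- r) *\<^sub>R (hvec p - e) \<in> horo_hull K"
    "0 \<le> u1" "0 \<le> u2" "0 \<le> u3" "u1 + u2 + u3 = 1" "u1 *\<^sub>R e1 + u2 *\<^sub>R e2 + u3 *\<^sub>R e3 = 0"
proof -
  define G where "G = exp (- r)"
  have G: "G > 0" by (simp add: G_def)
  define F where "F = horo_hull K"
  obtain x0 where "x0 \<in> K"
    using K interior_subset[of K] by (auto simp: h_convex_body_def)
  then have F: "compact F" using compact_horo_hull by (simp add: F_def)
  obtain l where "l \<in> F" "- mink (hvec p) l \<ge> G" using max by (metis F_def G_def)
  then have "lightlike l" using G by (auto simp: F_def elim!: horo_hull_cases)
  then obtain n where n: "mink n (hvec p) = 0" "mink n n = 1"
    using lightlike_decompose by metis
  obtain L where L: "lorentz L" "L (hvec p) = (0, 1)" using lorentz_frame[OF n] by blast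
  have linL: "linear L" by (rule lorentz_linear[OF L(1)])
  have "inj L" using lorentz_inj[OF L(1)] by (auto simp: inj_on_def)
  then obtain M where M: "linear M" "\<And>v. M (L v) = v"
    using linear_injective_left_inverse[OF linL] by (metis comp_apply id_apply)
  have LM: "L (M v) = v" for v using lorentz_surj[OF L(1), of v] M(2) by metis
  have Mp: "M (0, 1) = hvec p" using M(2)[of "hvec p"] L(2) by simp
  have mM: "mink (M v) (M w) = mink v w" for v w
    using lorentz_mink[OF L(1), of "M v" "M w"] by (simp add: LM)
  have tM: "mink (M (c, 0)) (hvec p) = 0" "mink (M (c, 0)) (M (c', 0)) = c \<bullet> c'" for c c'
    by (simp_all only: Mp[symmetric] mM) (simp_all add: mink_def)
  \<comment> \<open>The contact directions, transported from the tangent plane at \<open>p\<close>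
    to the complex plane, so that Euclidean convexity applies to them.\<close>
  define A where "A = {c. norm c = 1 \<and> G *\<^sub>R (hvec p - M (c, 0)) \<in> F}"
  have M_cont: "continuous_on UNIV (\<lambda>c. M (c, 0))"
    by (intro continuous_on_compose2[OF linear_continuous_on[OF M(1)[unfolded linear_conv_bounded_linear]]] continuous_intros) auto
  have "A = {c. norm c = 1} \<inter> ((\<lambda>c. G *\<^sub>R (hvec p - M (c, 0))) -` F)"
    by (auto simp: A_def)
  moreover have "closed {c :: complex. norm c = 1}"
    by (intro closed_Collect_eq continuous_intros)
  moreover have "closed ((\<lambda>c. G *\<^sub>R (hvec p - M (c, 0))) -` F)"
    by (intro closed_vimage compact_imp_closed[OF F] continuous_intros M_cont)
  moreover have "bounded A" by (auto simp: A_def bounded_iff)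
  ultimately have A: "compact A" by (simp add: compact_eq_bounded_closed closed_Int)
  have active: "\<exists>c\<in>A. l = G *\<^sub>R (hvec p - M (c, 0))" if l: "l \<in> F" "- mink (hvec p) l = G" for l
  proof -
    have "lightlike l" using l G by (auto simp: F_def elim!: horo_hull_cases)
    then obtain e where e: "mink e (hvec p) = 0" "mink e e = 1" "l = G *\<^sub>R (hvec p - e)"
      using lightlike_decompose[of l p] l(2) by metis
    have "snd (L e) = 0"
      using lorentz_mink[OF L(1), of e "hvec p"] e(1) by (simp add: L(2) mink_def)
    then have Le: "L e = (fst (L e), 0)" by (simp add: prod_eq_iff)
    then have eM: "e = M (fst (L e), 0)" using M(2)[of e] by simp
    have "fst (L e) \<bullet> fst (L e) = 1" using e(2) tM(2) eM by metis
    then have "norm (fst (L e)) = 1" by (simp add: norm_eq_sqrt_inner)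
    then show ?thesis using e(3) eM l(1) by (intro bexI[of _ "fst (L e)"]) (auto simp: A_def)
  qed
  have "0 \<in> convex hull A"
  proof (rule ccontr)
    assume "0 \<notin> convex hull A"
    then obtain a b where a: "a \<noteq> 0" "0 < b" "\<And>c. c \<in> A \<Longrightarrow> a \<bullet> c > b"
      using separating_hyperplane_closed_0[OF convex_convex_hull, of A]
        compact_imp_closed[OF compact_convex_hull[OF A]] hull_subset[of A convex] by blast
    define W where "W = M ((1 / norm a) *\<^sub>R a, 0)"
    have "mink (- W) (hvec p) = 0" "mink (- W) (- W) = 1"
      using a(1) by (simp_all add: W_def tM dot_square_norm power2_eq_square)
    note W = this
    define t where "t = (\<lambda>n. inverse (real (Suc n)))"
    have "\<exists>q. hvec q = cosh (t n) *\<^sub>R hvec p + sinh (t n) *\<^sub>R (- W)" for n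
      using obtain_exp[OF W, of "t n"] by metis
    then obtain q where q: "\<And>n. hvec (q n) = cosh (t n) *\<^sub>R hvec p - sinh (t n) *\<^sub>R W"
      by simp metis
    have "\<exists>l\<in>F. G \<le> - mink (hvec (q n)) l" for n using max by (simp add: F_def G_def)
    then obtain l where l: "\<And>n. l n \<in> F" "\<And>n. G \<le> - mink (hvec (q n)) (l n)" by metis
    obtain l' \<sigma> where l': "l' \<in> F" "strict_mono \<sigma>" "(l \<circ> \<sigma>) \<longlonglongrightarrow> l'"
      using F l(1) unfolding compact_eq_seq_compact_metric seq_compact_def by metis
    have t0: "t \<longlonglongrightarrow> 0" unfolding t_def by (rule LIMSEQ_inverse_real_of_nat)
    then have t\<sigma>: "(\<lambda>n. t (\<sigma> n)) \<longlonglongrightarrow> 0"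
      using LIMSEQ_subseq_LIMSEQ[OF t0 l'(2)] by (simp add: o_def)
    have ml: "(\<lambda>n. mink v (l (\<sigma> n))) \<longlonglongrightarrow> mink v l'" for v
      using l'(3) unfolding mink_def o_def by (intro tendsto_intros)
    have lp: "- mink (hvec p) (l n) \<le> G" for n using le l(1) by (simp add: F_def G_def)
    have eq: "- mink (hvec (q n)) (l n) = cosh (t n) * (- mink (hvec p) (l n)) + sinh (t n) * mink W (l n)" for n
      by (simp add: q mink_simps)
    \<comment> \<open>In \<open>eq\<close> the factor of \<open>cosh (t n)\<close> is at most
      \<open>G\<close>, so reaching \<open>G\<close> leaves a deficit of at most
      \<open>G * (cosh (t n) - 1)\<close>, of second order in \<open>sinh (t n)\<close>; dividing by
      \<open>sinh (t n)\<close> leaves an error that tends to 0.\<close>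
    have Wl: "mink W (l n) \<ge> - G * sinh (t n)" for n
    proof -
      have tn: "t n > 0" by (simp add: t_def)
      have "cosh (t n) * (- mink (hvec p) (l n)) \<le> cosh (t n) * G"
        using lp by (intro mult_left_mono) auto
      then have "G * (1 - cosh (t n)) \<le> sinh (t n) * mink W (l n)"
        using l(2)[of n] unfolding eq by (simp add: algebra_simps)
      moreover have "cosh (t n) - 1 \<le> (sinh (t n))\<^sup>2"
      proof -
        have "(sinh (t n))\<^sup>2 = (cosh (t n) - 1) * (cosh (t n) + 1)"
          using hyperbolic_pythagoras[of "t n"] by (simp add: power2_eq_square algebra_simps)
        moreover have "(cosh (t n) - 1) * 1 \<le> (cosh (t n) - 1) * (cosh (t n) + 1)"
          using cosh_real_ge_1[of "t n"] by (intro mult_left_mono) auto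
        ultimately show ?thesis by simp
      qed
      then have "G * (cosh (t n) - 1) \<le> G * (sinh (t n))\<^sup>2"
        using G by (intro mult_left_mono) auto
      ultimately have "sinh (t n) * (- G * sinh (t n)) \<le> sinh (t n) * mink W (l n)"
        by (simp add: power2_eq_square algebra_simps)
      then show ?thesis using tn by (metis mult_le_cancel_left_pos sinh_real_pos_iff)
    qed
    have sinh0: "(\<lambda>n. - G * sinh (t (\<sigma> n))) \<longlonglongrightarrow> - G * sinh 0"
      by (intro tendsto_intros t\<sigma>)
    have W0: "mink W l' \<ge> 0"
      using LIMSEQ_le[OF sinh0 ml[of W]] Wl by auto
    have "(\<lambda>n. cosh (t (\<sigma> n)) * (- mink (hvec p) (l (\<sigma> n))) + sinh (t (\<sigma> n)) * mink W (l (\<sigma> n)))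
        \<longlonglongrightarrow> cosh 0 * (- mink (hvec p) l') + sinh 0 * mink W l'"
      by (intro tendsto_intros t\<sigma> ml)
    then have "(\<lambda>n. - mink (hvec (q (\<sigma> n))) (l (\<sigma> n))) \<longlonglongrightarrow> - mink (hvec p) l'"
      by (simp add: eq)
    then have "G \<le> - mink (hvec p) l'"
      using l(2) by (intro LIMSEQ_le_const) auto
    moreover have "- mink (hvec p) l' \<le> G" using le l'(1) by (simp add: F_def G_def)
    ultimately obtain c where c: "c \<in> A" "l' = G *\<^sub>R (hvec p - M (c, 0))"
      using active[OF l'(1)] by force
    have "mink W (hvec p) = 0" by (simp add: W_def tM)
    then have "mink W l' = - G * (a \<bullet> c / norm a)"
      by (simp add: c(2) mink_simps) (simp add: W_def tM)
    moreover have "a \<bullet> c / norm a > 0" using a(1,2) a(3)[OF c(1)] by simp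
    then have "G * (a \<bullet> c / norm a) > 0" using G by (rule mult_pos_pos[rotated])
    ultimately show False using W0 by simp
  qed
  then obtain c1 c2 c3 u v w where c: "c1 \<in> A" "c2 \<in> A" "c3 \<in> A"
    and uvw: "0 \<le> u" "0 \<le> v" "0 \<le> w" "u + v + w = 1" "u *\<^sub>R c1 + v *\<^sub>R c2 + w *\<^sub>R c3 = 0"
    by (rule convex_hull_3_points) blast
  have "u *\<^sub>R M (c1, 0) + v *\<^sub>R M (c2, 0) + w *\<^sub>R M (c3, 0) = M (u *\<^sub>R c1 + v *\<^sub>R c2 + w *\<^sub>R c3, 0)"
    by (simp add: linear_scale[OF M(1), symmetric] linear_add[OF M(1), symmetric])
  also have "\<dots> = 0" using linear_0[OF M(1)] by (simp add: uvw zero_prod_def)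
  finally have "u *\<^sub>R M (c1, 0) + v *\<^sub>R M (c2, 0) + w *\<^sub>R M (c3, 0) = 0" .
  moreover have "mink e (hvec p) = 0 \<and> mink e e = 1 \<and> exp (- r) *\<^sub>R (hvec p - e) \<in> horo_hull K"
    if "e \<in> {M (c1, 0), M (c2, 0), M (c3, 0)}" for e
    using that c tM by (auto simp: A_def F_def G_def dot_square_norm)
  ultimately show thesis using that uvw by metis
qed

section \<open>The upper bound for the minimal width\<close>

definition unit_tangent :: "hyp2 \<Rightarrow> complex \<times> real \<Rightarrow> bool" where
  "unit_tangent p e \<longleftrightarrow> mink e (hvec p) = 0 \<and> mink e e = 1"

lemma unit_tangentD:
  assumes "unit_tangent p e"
  shows "mink e (hvec p) = 0" "mink (hvec p) e = 0" "mink e e = 1"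
  using assms by (simp_all add: unit_tangent_def mink_commute)

text \<open>With \<open>V\<close> the component of \<open>x\<close> tangent at \<open>p\<close>, the horoball tangent to the disk of
  radius \<open>r\<close> about \<open>p\<close> in direction \<open>e\<close> is given by \<open>cosh (dist x p) + V \<bullet> e \<le> exp r\<close>.\<close>

definition horo_polygon :: "hyp2 \<Rightarrow> (complex \<times> real) set \<Rightarrow> real \<Rightarrow> hyp2 set" where
  "horo_polygon p A r = {x. \<forall>e\<in>A. - mink (hvec x) (hvec p) + mink (hvec x) e \<le> exp r}"

lemma horoball_exp_iff:
  "x \<in> horoball (exp (- r) *\<^sub>R (hvec p - e)) \<longleftrightarrow> - mink (hvec x) (hvec p) + mink (hvec x) e \<le> exp r"
proof -
  have "mink (hvec x) (exp (- r) *\<^sub>R (hvec p - e)) = (mink (hvec x) (hvec p) - mink (hvec x) e) / exp r"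
    by (simp add: mink_simps exp_minus field_simps)
  moreover have "-1 \<le> y / exp r \<longleftrightarrow> - y \<le> exp r" for y :: real
    unfolding pos_le_divide_eq[OF exp_gt_zero] by linarith
  ultimately show ?thesis by (simp add: horoball_def)
qed

text \<open>Here \<open>s\<close> and \<open>t\<close> are the coefficients of a vector of length
  \<open>N\<close> along two unit vectors with product \<open>c\<close>, at an angle of at most
  \<open>2\<pi>/3\<close>. The claim is that the vector makes an angle of at most
  \<open>\<pi>/3\<close> with the one having the larger coefficient.\<close>

lemma sum_in_wedge:
  fixes s t c N :: real
  assumes "c \<ge> -1/2" "0 \<le> t" "t \<le> s" "N\<^sup>2 = s\<^sup>2 + t\<^sup>2 + 2 * s * t * c"
  shows "N / 2 \<le> s + t * c"
proof -
  define d where "d = c + 1/2"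
  have d: "d \<ge> 0" "c = d - 1/2" using assms(1) by (simp_all add: d_def)
  have "(N / 2)\<^sup>2 \<le> (s + t * c)\<^sup>2"
  proof -
    have "4 * (s + t * c)\<^sup>2 - N\<^sup>2 = 3 * (s * (s - t)) + d * (t * (6 * s - 4 * t)) + 4 * (t * d)\<^sup>2"
      unfolding assms(4) d(2) by (simp add: power2_eq_square algebra_simps)
    moreover have "0 \<le> s * (s - t)" "0 \<le> d * (t * (6 * s - 4 * t))"
      using assms d by (intro mult_nonneg_nonneg; simp)+
    ultimately have "N\<^sup>2 \<le> 4 * (s + t * c)\<^sup>2" using zero_le_power2[of "t * d"] by linarith
    then show ?thesis by (simp add: power_divide)
  qed
  moreover have "0 \<le> s + t * c"
  proof -
    have "t * (-1/2) \<le> t * c" using assms by (intro mult_left_mono) auto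
    then show ?thesis using assms by linarith
  qed
  ultimately show ?thesis by (metis power2_le_imp_le)
qed

lemma unit_tangent_proportional:
  assumes "unit_tangent p e" "unit_tangent p f" "\<alpha> *\<^sub>R e + \<beta> *\<^sub>R f = 0" "0 \<le> \<alpha>" "0 \<le> \<beta>" "\<alpha> + \<beta> > 0"
  shows "f = - e"
proof -
  note e = unit_tangentD[OF assms(1)] and f = unit_tangentD[OF assms(2)]
  have "mink (\<alpha> *\<^sub>R e + \<beta> *\<^sub>R f) e = 0" "mink (\<alpha> *\<^sub>R e + \<beta> *\<^sub>R f) f = 0"
    by (simp_all add: assms(3))
  then have "\<alpha> + \<beta> * mink f e = 0" "\<alpha> * mink f e + \<beta> = 0"
    by (simp_all add: mink_simps e f mink_commute[of e f])
  then have "(\<alpha> + \<beta>) * (1 + mink f e) = 0" by (simp add: algebra_simps)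
  then have "mink f e = -1" using assms(6) by simp
  then have "mink (e + f) (e + f) = 0" by (simp add: mink_simps e f mink_commute[of e f])
  moreover have "mink (e + f) (hvec p) = 0" by (simp add: mink_simps e f)
  ultimately have "e + f = 0" using mink_orthogonal_nonneg(2) by blast
  then show ?thesis by (simp add: eq_neg_iff_add_eq_0 add.commute)
qed

text \<open>The tangent plane is covered by the three sectors spanned by pairs of the directions.
  Expand in the basis \<open>e2, e3\<close>, then shift along the positive relation \<open>u\<close>
  until all coefficients are nonnegative and one of them vanishes.\<close>

lemma positive_representation:
  assumes e: "unit_tangent p e1" "unit_tangent p e2" "unit_tangent p e3"
    and u: "u1 > 0" "u2 > 0" "u3 > 0" "u1 *\<^sub>R e1 + u2 *\<^sub>R e2 + u3 *\<^sub>R e3 = 0"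
    and c: "\<bar>mink e2 e3\<bar> < 1"
  obtains s1 s2 s3 where "0 \<le> s1" "0 \<le> s2" "0 \<le> s3" "s1 = 0 \<or> s2 = 0 \<or> s3 = 0"
    "hvec x = (- mink (hvec x) (hvec p)) *\<^sub>R hvec p + s1 *\<^sub>R e1 + s2 *\<^sub>R e2 + s3 *\<^sub>R e3"
proof -
  define c where "c = mink e2 e3"
  obtain k where k: "mink k (hvec p) = 0" "mink k e2 = 0" "mink k k = 1"
    and ex: "\<And>v. v = (- mink v (hvec p)) *\<^sub>R hvec p + mink v e2 *\<^sub>R e2 + mink v k *\<^sub>R k"
    using obtain_orthonormal_frame[OF unit_tangentD(1,3)[OF e(2)]] by metis
  define g where "g = mink e3 k"
  have e3: "e3 = c *\<^sub>R e2 + g *\<^sub>R k"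
    using ex[of e3] unit_tangentD[OF e(3)] by (simp add: c_def g_def mink_commute[of e3 e2])
  have "g \<noteq> 0"
  proof
    assume "g = 0"
    then have "mink e3 e3 = c * c * mink e2 e2" by (simp add: e3 mink_simps)
    then have "\<bar>c\<bar> * \<bar>c\<bar> = 1" using unit_tangentD[OF e(3)] unit_tangentD[OF e(2)] by simp
    moreover have "\<bar>c\<bar> * \<bar>c\<bar> < 1 * 1"
      using c by (intro mult_strict_mono') (auto simp: c_def)
    ultimately show False by simp
  qed
  then have kk: "k = (1 / g) *\<^sub>R e3 - (c / g) *\<^sub>R e2" by (simp add: e3 algebra_simps)
  define s t where "s = mink (hvec x) e2 - mink (hvec x) k * c / g" and "t = mink (hvec x) k / g"
  have "mink (hvec x) k *\<^sub>R k = t *\<^sub>R e3 - (mink (hvec x) k * c / g) *\<^sub>R e2"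
    by (subst kk) (simp add: t_def scaleR_diff_right)
  then have tang: "mink (hvec x) e2 *\<^sub>R e2 + mink (hvec x) k *\<^sub>R k = s *\<^sub>R e2 + t *\<^sub>R e3"
    by (simp add: s_def scaleR_diff_left)
  \<comment> \<open>The largest multiple of the relation whose subtraction leaves all three
    coefficients nonnegative; the minimum is attained, so one coefficient becomes 0.\<close>
  define \<mu> where "\<mu> = min 0 (min (s / u2) (t / u3))"
  have \<mu>: "\<mu> \<le> 0" "\<mu> * u2 \<le> s" "\<mu> * u3 \<le> t"
    using u by (auto simp: \<mu>_def pos_le_divide_eq[symmetric])
  have "\<mu> = 0 \<or> \<mu> = s / u2 \<or> \<mu> = t / u3" by (auto simp: \<mu>_def min_def)
  then have z: "- \<mu> * u1 = 0 \<or> s - \<mu> * u2 = 0 \<or> t - \<mu> * u3 = 0" using u by auto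
  have "\<mu> *\<^sub>R (u1 *\<^sub>R e1 + u2 *\<^sub>R e2 + u3 *\<^sub>R e3) = 0" by (simp add: u(4))
  then have shift: "s *\<^sub>R e2 + t *\<^sub>R e3 = (- \<mu> * u1) *\<^sub>R e1 + ((s - \<mu> * u2) *\<^sub>R e2 + (t - \<mu> * u3) *\<^sub>R e3)"
    by (simp add: algebra_simps)
  have "hvec x = (- mink (hvec x) (hvec p)) *\<^sub>R hvec p
      + (mink (hvec x) e2 *\<^sub>R e2 + mink (hvec x) k *\<^sub>R k)"
    by (rule ex[of "hvec x", unfolded add.assoc])
  also have "\<dots> = (- mink (hvec x) (hvec p)) *\<^sub>R hvec p
      + (- \<mu> * u1) *\<^sub>R e1 + (s - \<mu> * u2) *\<^sub>R e2 + (t - \<mu> * u3) *\<^sub>R e3"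
    unfolding tang shift by (simp only: add.assoc)
  finally have "hvec x = (- mink (hvec x) (hvec p)) *\<^sub>R hvec p
      + (- \<mu> * u1) *\<^sub>R e1 + (s - \<mu> * u2) *\<^sub>R e2 + (t - \<mu> * u3) *\<^sub>R e3" .
  moreover have "0 \<le> - \<mu> * u1" using \<mu>(1) u(1) by (simp add: mult_nonpos_nonneg)
  ultimately show thesis using that[of "- \<mu> * u1" "s - \<mu> * u2" "t - \<mu> * u3"] z \<mu> by auto
qed

text \<open>If \<open>x\<close> is farther from \<open>p\<close> than the vertices of the regular triangle, the constraints force
  its direction to differ by more than \<open>\<pi>/3\<close> from each \<open>e\<^sub>i\<close>. So it is not in the sector of
  \<open>e\<^sub>2, e\<^sub>3\<close>, whose angle is at most \<open>2\<pi>/3\<close>, and hence in the sector of \<open>e\<^sub>1\<close> and another \<open>e\<^sub>j\<close>;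
  there \<open>mink x e\<^sub>1 + mink x e\<^sub>j\<close> is nonnegative.\<close>

lemma far_point_bound:
  assumes e: "unit_tangent p e1" "unit_tangent p e2" "unit_tangent p e3"
    and u: "0 \<le> u1" "0 \<le> u2" "0 \<le> u3" "u1 + u2 + u3 = 1" "u1 *\<^sub>R e1 + u2 *\<^sub>R e2 + u3 *\<^sub>R e3 = 0"
    and c: "mink e2 e3 \<ge> -1/2"
    and X: "X = - mink (hvec x) (hvec p)" "X > C" and C: "C\<^sup>2 = 1 + S\<^sup>2" "C > 0" "S > 0"
    and le: "X + mink (hvec x) e1 \<le> C + S / 2" "X + mink (hvec x) e2 \<le> C + S / 2"
      "X + mink (hvec x) e3 \<le> C + S / 2"
  shows "0 \<le> mink (hvec x) e1 \<or> X - mink (hvec x) e1 \<le> C + S / 2"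
proof (rule ccontr)
  define a1 a2 a3 where "a1 = mink (hvec x) e1" and "a2 = mink (hvec x) e2" and "a3 = mink (hvec x) e3"
  assume neg: "\<not> (0 \<le> mink (hvec x) e1 \<or> X - mink (hvec x) e1 \<le> C + S / 2)"
  then have a: "a1 < 0" "a2 < - a1" "a3 < - a1" using le by (auto simp: a1_def a2_def a3_def)
  define N where "N = sqrt (X\<^sup>2 - 1)"
  have X1: "X \<ge> 1" using one_le_mink[of x p] X(1) by simp
  then have N2: "N\<^sup>2 = X\<^sup>2 - 1" by (simp add: N_def)
  have "S\<^sup>2 < N\<^sup>2" using C X(2) power_strict_mono[of C X 2] by (simp add: N2)
  then have "S < N" by (rule power2_less_imp_less) (simp add: N_def X1)
  then have small: "a2 < N / 2" "a3 < N / 2" using le X(2) by (auto simp: a2_def a3_def)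
  note D1 = unit_tangentD[OF e(1)] and D2 = unit_tangentD[OF e(2)] and D3 = unit_tangentD[OF e(3)]
  \<comment> \<open>A vanishing weight would make the other two directions opposite. For
    \<open>u1\<close> this contradicts \<open>c\<close>; for the others it contradicts
    \<open>a2 < - a1\<close> and \<open>a3 < - a1\<close>.\<close>
  have u1: "u1 > 0"
  proof (rule ccontr)
    assume "\<not> u1 > 0"
    then have "u2 *\<^sub>R e2 + u3 *\<^sub>R e3 = 0" "u2 + u3 > 0" using u by auto
    then have "e3 = - e2" using unit_tangent_proportional[OF e(2,3)] u by blast
    then show False using c D2 by simp
  qed
  have ne: "e2 \<noteq> - e1" "e3 \<noteq> - e1" using a by (auto simp: a1_def a2_def a3_def)
  have u2: "u2 > 0"
  proof (rule ccontr)
    assume "\<not> u2 > 0"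
    then have "u1 *\<^sub>R e1 + u3 *\<^sub>R e3 = 0" "u1 + u3 > 0" using u by auto
    then show False using unit_tangent_proportional[OF e(1,3)] u ne by blast
  qed
  have u3: "u3 > 0"
  proof (rule ccontr)
    assume "\<not> u3 > 0"
    then have "u1 *\<^sub>R e1 + u2 *\<^sub>R e2 = 0" "u1 + u2 > 0" using u by auto
    then show False using unit_tangent_proportional[OF e(1,2)] u ne by blast
  qed
  have CS: "(mink f g)\<^sup>2 \<le> 1" if "unit_tangent p f" "unit_tangent p g" for f g
    using mink_orthogonal_Cauchy_Schwarz[of f p g] that by (simp add: unit_tangent_def)
  have ge: "-1 \<le> mink f g" "mink f g \<le> 1" if "unit_tangent p f" "unit_tangent p g" for f g
    using CS[OF that] by (simp_all add: abs_square_le_1 abs_le_iff)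
  have "mink e2 e3 \<noteq> 1"
  proof
    assume "mink e2 e3 = 1"
    then have "mink (e2 - e3) (e2 - e3) = 0" by (simp add: mink_simps D2 D3 mink_commute[of e3 e2])
    moreover have "mink (e2 - e3) (hvec p) = 0" by (simp add: mink_simps D2 D3)
    ultimately have "e2 = e3" using mink_orthogonal_nonneg(2) by fastforce
    then have "u1 *\<^sub>R e1 + (u2 + u3) *\<^sub>R e2 = 0" using u(5) by (simp add: algebra_simps)
    then have "e2 = - e1" using unit_tangent_proportional[OF e(1,2)] u u1 by auto
    then show False using ne by simp
  qed
  then have "\<bar>mink e2 e3\<bar> < 1" using c ge(2)[OF e(2,3)] by (simp add: abs_less_iff)
  then obtain s1 s2 s3 where s: "0 \<le> s1" "0 \<le> s2" "0 \<le> s3" "s1 = 0 \<or> s2 = 0 \<or> s3 = 0"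
    and x: "hvec x = (- mink (hvec x) (hvec p)) *\<^sub>R hvec p + s1 *\<^sub>R e1 + s2 *\<^sub>R e2 + s3 *\<^sub>R e3"
    using positive_representation[OF e u1 u2 u3 u(5)] by metis
  have x': "hvec x = X *\<^sub>R hvec p + s1 *\<^sub>R e1 + s2 *\<^sub>R e2 + s3 *\<^sub>R e3"
    using x X(1) by simp
  note com = mink_commute[of e2 e1] mink_commute[of e3 e1] mink_commute[of e3 e2]
  have A: "a1 = s1 + s2 * mink e1 e2 + s3 * mink e1 e3" "a2 = s1 * mink e1 e2 + s2 + s3 * mink e2 e3"
    "a3 = s1 * mink e1 e3 + s2 * mink e2 e3 + s3"
    by (simp_all add: a1_def a2_def a3_def x' mink_simps D1 D2 D3 com)
  show False
  proof (cases "s1 = 0")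
    case True
    have "mink (hvec x) (hvec x) = - X\<^sup>2 + (s2\<^sup>2 + s3\<^sup>2 + 2 * s2 * s3 * mink e2 e3)"
      by (simp add: x' True mink_simps D2 D3 com power2_eq_square algebra_simps)
    then have N: "N\<^sup>2 = s2\<^sup>2 + s3\<^sup>2 + 2 * s2 * s3 * mink e2 e3" by (simp add: N2)
    show False
    proof (cases "s3 \<le> s2")
      case True
      show False using sum_in_wedge[OF c s(3) True N] small A(2) \<open>s1 = 0\<close> by simp
    next
      case False
      have N': "N\<^sup>2 = s3\<^sup>2 + s2\<^sup>2 + 2 * s3 * s2 * mink e2 e3" using N by (simp add: algebra_simps)
      show False using sum_in_wedge[OF c s(2) _ N'] False small A(3) \<open>s1 = 0\<close> by simp
    qed
  next
    case False
    then consider "s2 = 0" | "s3 = 0" using s by blast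
    then show False
    proof cases
      case 1
      then have "a1 + a3 = (s1 + s3) * (1 + mink e1 e3)" by (simp add: A algebra_simps)
      moreover have "0 \<le> (s1 + s3) * (1 + mink e1 e3)"
        using s(1,3) ge(1)[OF e(1,3)] by (intro mult_nonneg_nonneg) auto
      ultimately show False using a by linarith
    next
      case 2
      then have "a1 + a2 = (s1 + s2) * (1 + mink e1 e2)" by (simp add: A algebra_simps)
      moreover have "0 \<le> (s1 + s2) * (1 + mink e1 e2)"
        using s(1,2) ge(1)[OF e(1,2)] by (intro mult_nonneg_nonneg) auto
      ultimately show False using a by linarith
    qed
  qed
qed

text \<open>The left side is sinh of the signed distance of \<open>x\<close> from the line touching
  the disk in direction \<open>e1\<close>. If \<open>x\<close> is no farther from \<open>p\<close>
  than \<open>R\<close>, both terms are bounded separately, by \<open>cosh R * sinh r\<close> and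
  \<open>sinh R * cosh r\<close>; if it is farther, \<open>far_point_bound\<close> gives a strict
  inequality. Equality therefore fixes both coordinates of \<open>x\<close>, and these determine
  it.\<close>

lemma constraint_distance_bound:
  assumes e: "unit_tangent p e1" "unit_tangent p e2" "unit_tangent p e3"
    and u: "0 \<le> u1" "0 \<le> u2" "0 \<le> u3" "u1 + u2 + u3 = 1" "u1 *\<^sub>R e1 + u2 *\<^sub>R e2 + u3 *\<^sub>R e3 = 0"
    and c: "mink e2 e3 \<ge> -1/2"
    and r: "r > 0" and R: "R > 0" "exp r = cosh R + sinh R / 2"
    and x: "x \<in> horo_polygon p {e1, e2, e3} r"
  shows "- mink (hvec x) (hvec p) * sinh r - mink (hvec x) e1 * cosh r \<le> sinh (R + r)" (is ?le)
    and "- mink (hvec x) (hvec p) * sinh r - mink (hvec x) e1 * cosh r = sinh (R + r) \<Longrightarrow>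
      hvec x = cosh R *\<^sub>R hvec p - sinh R *\<^sub>R e1"
proof -
  define X a where "X = - mink (hvec x) (hvec p)" and "a = mink (hvec x) e1"
  define C S Cr Sr where "C = cosh R" and "S = sinh R" and "Cr = cosh r" and "Sr = sinh r"
  have C: "C\<^sup>2 = 1 + S\<^sup>2" "C > 0" "S > 0"
    using R(1) cosh_square_eq[of R] by (simp_all add: C_def S_def)
  have Cr: "Cr > 0" "Sr > 0" using r by (simp_all add: Cr_def Sr_def)
  have le: "X + mink (hvec x) e1 \<le> C + S / 2" "X + mink (hvec x) e2 \<le> C + S / 2"
    "X + mink (hvec x) e3 \<le> C + S / 2"
    using x R(2) by (simp_all add: horo_polygon_def X_def C_def S_def)
  have sum: "sinh (R + r) = S * Cr + C * Sr" by (simp add: sinh_add C_def S_def Cr_def Sr_def)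
  have CSr: "Cr - Sr > 0" by (simp add: Cr_def Sr_def cosh_minus_sinh)
  have far: "X * Sr - a * Cr < S * Cr + C * Sr" if "X > C"
  proof -
    from far_point_bound[OF e u c X_def that C le, folded a_def]
    show ?thesis
    proof
      assume "0 \<le> a"
      then have "X * Sr \<le> (C + S / 2) * Sr" "0 \<le> a * Cr" using le(1) Cr by (auto simp: a_def)
      moreover have "(C + S / 2) * Sr < S * Cr + C * Sr"
      proof -
        have "S * Sr < S * Cr" "0 < S * Sr" using C(3) CSr Cr by simp_all
        then show ?thesis by (simp add: algebra_simps)
      qed
      ultimately show ?thesis by linarith
    next
      assume "X - a \<le> C + S / 2"
      then have "- a * Cr \<le> (C + S / 2 - X) * Cr" using Cr by (intro mult_right_mono) auto
      moreover have "C * (Cr - Sr) < X * (Cr - Sr)" using that CSr by simp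
      moreover have "S * Cr > 0" using C Cr by simp
      ultimately show ?thesis by (simp add: algebra_simps)
    qed
  qed
  have a2: "a\<^sup>2 \<le> X\<^sup>2 - 1"
    using tangent_component_le[of e1 p x] unit_tangentD[OF e(1)] by (simp add: a_def X_def)
  have near: "- a \<le> S" if "X \<le> C"
  proof -
    have "X\<^sup>2 \<le> C\<^sup>2" using that one_le_mink[of x p] by (intro power_mono) (auto simp: X_def)
    then have "a\<^sup>2 \<le> S\<^sup>2" using a2 C by simp
    then show ?thesis using C abs_le_square_iff[of a S] by simp
  qed
  have nearle: "X * Sr \<le> C * Sr" "- a * Cr \<le> S * Cr" if "X \<le> C"
    using that near Cr by (intro mult_right_mono; simp)+
  show ?le
    using far nearle unfolding sum X_def[symmetric] a_def[symmetric] Cr_def[symmetric] Sr_def[symmetric]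
    by (cases "X > C") auto
  assume "- mink (hvec x) (hvec p) * sinh r - mink (hvec x) e1 * cosh r = sinh (R + r)"
  then have eq: "X * Sr - a * Cr = S * Cr + C * Sr"
    unfolding sum by (simp add: X_def a_def Cr_def Sr_def)
  then have "X \<le> C" using far by force
  note nl = nearle[OF this]
  have "X * Sr = C * Sr" using nl eq by linarith
  then have XC: "X = C" using Cr by simp
  have "(a + S) * Cr = 0" using eq unfolding XC by (simp add: algebra_simps)
  then have aS: "a = - S" using Cr by (simp add: eq_neg_iff_add_eq_0)
  obtain y where y: "hvec y = cosh R *\<^sub>R hvec p + sinh R *\<^sub>R (- e1)"
    using obtain_exp[of "- e1" p R] unit_tangentD[OF e(1)] by auto
  have "mink (hvec x) (hvec y) = - (C * C) + S * S"
  proof -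
    have "mink (hvec x) (hvec p) = - C" using XC by (simp add: X_def)
    then show ?thesis
      using aS by (simp add: y mink_simps a_def[symmetric] C_def[symmetric] S_def[symmetric])
  qed
  then have "mink (hvec x) (hvec y) = -1" using C(1) by (simp add: power2_eq_square)
  then have "x = y" using mink_Rep_eq_iff by blast
  then show "hvec x = cosh R *\<^sub>R hvec p - sinh R *\<^sub>R e1" using y by simp
qed

text \<open>The horoball lies behind the geodesic tangent to it at the contact point. Away from
  \<open>p\<close> the horoball inequality itself suffices; within distance \<open>r\<close> of
  \<open>p\<close> the reason is that the disk lies behind its tangent.\<close>

lemma horoball_in_half_plane:
  assumes e: "unit_tangent p e" and r: "r > 0"
    and le: "- mink (hvec x) (hvec p) + mink (hvec x) e \<le> exp r"
  shows "mink (hvec x) (cosh r *\<^sub>R e + sinh r *\<^sub>R hvec p) \<le> 0"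
proof -
  define X a where "X = - mink (hvec x) (hvec p)" and "a = mink (hvec x) e"
  define Cr Sr where "Cr = cosh r" and "Sr = sinh r"
  have C: "Cr\<^sup>2 = 1 + Sr\<^sup>2" "Cr > 0" "Sr > 0"
    using r cosh_square_eq[of r] by (simp_all add: Cr_def Sr_def)
  have X: "X \<ge> 1" using one_le_mink by (simp add: X_def)
  have le: "X + a \<le> Cr + Sr" using le by (simp add: X_def a_def Cr_def Sr_def cosh_plus_sinh)
  have a2: "a\<^sup>2 \<le> X\<^sup>2 - 1"
    using tangent_component_le[of e p x] unit_tangentD[OF e] by (simp add: a_def X_def)
  have "a * Cr \<le> X * Sr"
  proof (cases "X \<ge> Cr")
    case True
    have "a * Cr \<le> (Cr + Sr - X) * Cr" using le C by (intro mult_right_mono) auto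
    moreover have "Cr * (Cr + Sr) \<le> X * (Cr + Sr)" using True C by (intro mult_right_mono) auto
    ultimately show ?thesis by (simp add: algebra_simps)
  next
    case False
    then have "X\<^sup>2 \<le> Cr\<^sup>2" using X by (intro power_mono) auto
    then have "(X\<^sup>2 - 1) * Cr\<^sup>2 \<le> X\<^sup>2 * Sr\<^sup>2" using C(1) by (simp add: algebra_simps)
    moreover have "a\<^sup>2 * Cr\<^sup>2 \<le> (X\<^sup>2 - 1) * Cr\<^sup>2" using a2 by (intro mult_right_mono) auto
    ultimately have "(a * Cr)\<^sup>2 \<le> (X * Sr)\<^sup>2" by (simp add: power_mult_distrib)
    moreover have "0 \<le> X * Sr" using X C by simp
    ultimately show ?thesis by (rule power2_le_imp_le)
  qed
  then show ?thesis by (simp add: mink_simps X_def a_def Cr_def Sr_def algebra_simps)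
qed

lemma contact_supporting_line:
  assumes e: "unit_tangent p e" and r: "r > 0" and K: "cball p r \<subseteq> K" "K \<subseteq> horo_polygon p {e} r"
  shows "supporting_line K (line (cosh r *\<^sub>R e + sinh r *\<^sub>R hvec p))"
proof -
  note D = unit_tangentD[OF e]
  define v where "v = cosh r *\<^sub>R e + sinh r *\<^sub>R hvec p"
  have v: "mink v v = 1"
    using hyperbolic_pythagoras[of r] by (simp add: v_def mink_simps D power2_eq_square)
  have sub: "K \<subseteq> half_plane v"
    using horoball_in_half_plane[OF e r] K(2)
    by (auto simp: half_plane_def v_def horo_polygon_def)
  obtain z where z: "hvec z = cosh r *\<^sub>R hvec p + sinh r *\<^sub>R e"
    using obtain_exp[OF D(1,3)] by blast
  have "mink (hvec z) v = 0" by (simp add: z v_def mink_simps D)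
  then have zl: "z \<in> line v" by (simp add: line_def)
  have "cosh (dist p z) = cosh r" by (simp add: cosh_dist_hyp2 z mink_simps D)
  then have "dist p z = r"
    by (metis arcosh_cosh_real less_imp_le r zero_le_dist)
  then have "z \<in> K" using K(1) by auto
  then show ?thesis
    unfolding supporting_line_def v_def[symmetric] using v zl sub by (intro exI[of _ v]) auto
qed

lemma contact_width_bound:
  assumes K: "compact K" "cball p r \<subseteq> K" "K \<subseteq> horo_polygon p {e1, e2, e3} r"
    and e: "unit_tangent p e1" "unit_tangent p e2" "unit_tangent p e3"
    and u: "0 \<le> u1" "0 \<le> u2" "0 \<le> u3" "u1 + u2 + u3 = 1" "u1 *\<^sub>R e1 + u2 *\<^sub>R e2 + u3 *\<^sub>R e3 = 0"
    and c: "mink e2 e3 \<ge> -1/2"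
    and r: "r > 0" and R: "R > 0" "exp r = cosh R + sinh R / 2"
  shows "minimal_lassak_width K \<le> R + r" (is ?le)
    and "minimal_lassak_width K \<ge> R + r \<Longrightarrow> \<exists>x\<in>K. hvec x = cosh R *\<^sub>R hvec p - sinh R *\<^sub>R e1"
proof -
  note D1 = unit_tangentD[OF e(1)]
  define v where "v = cosh r *\<^sub>R e1 + sinh r *\<^sub>R hvec p"
  have v: "mink v v = 1"
    using hyperbolic_pythagoras[of r] by (simp add: v_def mink_simps D1 power2_eq_square)
  have pol: "K \<subseteq> horo_polygon p {e1} r" using K(3) by (auto simp: horo_polygon_def)
  have sub: "K \<subseteq> half_plane v"
    using horoball_in_half_plane[OF e(1) r] pol
    by (auto simp: half_plane_def v_def horo_polygon_def)
  have sup: "supporting_line K (line v)"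
    unfolding v_def by (rule contact_supporting_line[OF e(1) r K(2) pol])
  have "p \<in> K" using K(2) r by (auto dest: subsetD[of _ _ p])
  obtain x where x: "x \<in> K" "lassak_width K (line v) = infdist x (line v)"
    using lassak_width_attained[OF K(1)] \<open>p \<in> K\<close> by blast
  have xv: "mink (hvec x) v \<le> 0" using sub x(1) by (auto simp: half_plane_def)
  then have sw: "sinh (lassak_width K (line v)) = - mink (hvec x) v"
    using sinh_infdist_line[OF v, of x] x(2) by simp
  have xvv: "- mink (hvec x) v = - mink (hvec x) (hvec p) * sinh r - mink (hvec x) e1 * cosh r"
    by (simp add: v_def mink_simps)
  have xp: "x \<in> horo_polygon p {e1, e2, e3} r" using x(1) K(3) by blast
  have "sinh (lassak_width K (line v)) \<le> sinh (R + r)"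
    unfolding sw xvv by (rule constraint_distance_bound(1)[OF e u c r R xp])
  then have w: "lassak_width K (line v) \<le> R + r" by simp
  note m = minimal_lassak_width_le[OF K(1) sup]
  then show ?le using w by linarith
  assume "minimal_lassak_width K \<ge> R + r"
  then have "lassak_width K (line v) = R + r" using m w by linarith
  then have "- mink (hvec x) (hvec p) * sinh r - mink (hvec x) e1 * cosh r = sinh (R + r)"
    using sw xvv by simp
  then show "\<exists>x\<in>K. hvec x = cosh R *\<^sub>R hvec p - sinh R *\<^sub>R e1"
    using constraint_distance_bound(2)[OF e u c r R xp] x(1) by blast
qed

definition tripod :: "hyp2 \<Rightarrow> complex \<times> real \<Rightarrow> complex \<times> real \<Rightarrow> complex \<times> real \<Rightarrow> bool" where
  "tripod p e1 e2 e3 \<longleftrightarrow> unit_tangent p e1 \<and> unit_tangent p e2 \<and> unit_tangent p e3 \<and>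
    mink e1 e2 = -1/2 \<and> mink e2 e3 = -1/2 \<and> mink e3 e1 = -1/2"

lemma inscribed_width_bound:
  assumes K: "h_convex_body K" and R: "R > 0" "exp (inradius K) = cosh R + sinh R / 2"
  shows "minimal_lassak_width K \<le> R + inradius K" (is ?le)
    and "minimal_lassak_width K \<ge> R + inradius K \<Longrightarrow>
      \<exists>p e1 e2 e3. tripod p e1 e2 e3 \<and> K \<subseteq> horo_polygon p {e1, e2, e3} (inradius K) \<and>
        (\<forall>e\<in>{e1, e2, e3}. \<exists>x\<in>K. hvec x = cosh R *\<^sub>R hvec p - sinh R *\<^sub>R e)"
proof -
  define r where "r = inradius K"
  note R = R(1) R(2)[folded r_def]
  have cK: "compact K" using K by (simp add: h_convex_body_def)
  obtain p where r: "r > 0" and le: "\<And>l. l \<in> horo_hull K \<Longrightarrow> - mink (hvec p) l \<le> exp (- r)"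
    and max: "\<And>q. \<exists>l\<in>horo_hull K. exp (- r) \<le> - mink (hvec q) l" and sub: "cball p r \<subseteq> K"
    using incenter[OF K] r_def by metis
  obtain e1 e2 e3 u1 u2 u3 where
    e: "\<And>e. e \<in> {e1, e2, e3} \<Longrightarrow> mink e (hvec p) = 0 \<and> mink e e = 1 \<and>
       exp (- r) *\<^sub>R (hvec p - e) \<in> horo_hull K"
    and u: "0 \<le> u1" "0 \<le> u2" "0 \<le> u3" "u1 + u2 + u3 = 1" "u1 *\<^sub>R e1 + u2 *\<^sub>R e2 + u3 *\<^sub>R e3 = 0"
    using contact_points[OF K r le max] by metis
  have ut: "unit_tangent p e1" "unit_tangent p e2" "unit_tangent p e3"
    using e by (auto simp: unit_tangent_def)
  note D = unit_tangentD[OF ut(1)] unit_tangentD[OF ut(2)] unit_tangentD[OF ut(3)]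
  have pol: "K \<subseteq> horo_polygon p {e1, e2, e3} r"
  proof
    fix x assume x: "x \<in> K"
    have "- mink (hvec x) (hvec p) + mink (hvec x) f \<le> exp r" if "f \<in> {e1, e2, e3}" for f
      using e[OF that] x unfolding horo_hull_def
      by (subst horoball_exp_iff[symmetric]) (auto simp: horoball_def)
    then show "x \<in> horo_polygon p {e1, e2, e3} r" by (simp add: horo_polygon_def)
  qed
  have rot: "{e2, e3, e1} = {e1, e2, e3}" "{e3, e1, e2} = {e1, e2, e3}" by auto
  have u': "u2 + u3 + u1 = 1" "u3 + u1 + u2 = 1" "u2 *\<^sub>R e2 + u3 *\<^sub>R e3 + u1 *\<^sub>R e1 = 0"
    "u3 *\<^sub>R e3 + u1 *\<^sub>R e1 + u2 *\<^sub>R e2 = 0"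
    using u by (simp_all add: algebra_simps)
  note b1 = contact_width_bound[OF cK sub pol ut u _ r R]
  note b2 = contact_width_bound[OF cK sub pol[folded rot(1)] ut(2,3,1) u(2,3,1) u'(1,3) _ r R]
  note b3 = contact_width_bound[OF cK sub pol[folded rot(2)] ut(3,1,2) u(3,1,2) u'(2,4) _ r R]
  \<comment> \<open>The sum of the three unit vectors has nonnegative square, so their products
    cannot all be below \<open>-1/2\<close>.\<close>
  have "mink (e1 + e2 + e3) (hvec p) = 0" by (simp add: mink_simps D)
  then have "0 \<le> mink (e1 + e2 + e3) (e1 + e2 + e3)" by (rule mink_orthogonal_nonneg(1))
  then have "0 \<le> 3 + 2 * mink e1 e2 + 2 * mink e2 e3 + 2 * mink e3 e1"
    by (simp add: mink_simps D mink_commute[of e2 e1] mink_commute[of e3 e2] mink_commute[of e1 e3])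
  then have pos: "0 \<le> 3 + 2 * mink e1 e2 + 2 * mink e2 e3 + 2 * mink e3 e1" .
  have cases: "mink e2 e3 \<ge> -1/2 \<or> mink e3 e1 \<ge> -1/2 \<or> mink e1 e2 \<ge> -1/2"
  proof (rule ccontr)
    assume "\<not> ?thesis"
    then have "mink e2 e3 < -1/2" "mink e3 e1 < -1/2" "mink e1 e2 < -1/2" by auto
    then show False using pos by linarith
  qed
  show ?le using cases b1(1) b2(1) b3(1) unfolding r_def[symmetric] by blast
  assume "minimal_lassak_width K \<ge> R + inradius K"
  then have w: "minimal_lassak_width K \<ge> R + r" by (simp add: r_def)
  note b1 = b1(2)[OF _ w] and b2 = b2(2)[OF _ w] and b3 = b3(2)[OF _ w]
  \<comment> \<open>The vertex opposite to \<open>f\<close> lies in \<open>K\<close> and so in the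
    horoball of \<open>g\<close>; in view of \<open>exp r = cosh R + sinh R / 2\<close>, this says
    exactly that \<open>f\<close> and \<open>g\<close> form an angle of at most
    \<open>2\<pi>/3\<close>. Hence all products are at least \<open>-1/2\<close>.\<close>
  have spread: "mink f g \<ge> -1/2"
    if f: "\<exists>x\<in>K. hvec x = cosh R *\<^sub>R hvec p - sinh R *\<^sub>R f" "f \<in> {e1, e2, e3}" and g: "g \<in> {e1, e2, e3}" for f g
  proof -
    obtain x where x: "x \<in> K" "hvec x = cosh R *\<^sub>R hvec p - sinh R *\<^sub>R f" using f(1) by blast
    have "- mink (hvec x) (hvec p) + mink (hvec x) g \<le> cosh R + sinh R / 2"
      using pol x(1) g R(2) unfolding horo_polygon_def by force
    then have "sinh R * (-1/2) \<le> sinh R * mink f g"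
      using e[OF f(2)] e[OF g] by (simp add: x(2) mink_simps mink_commute[of "hvec p" g])
    moreover have "sinh R > 0" using R(1) by simp
    ultimately show ?thesis by (metis mult_le_cancel_left_pos)
  qed
  note com = mink_commute[of e1 e2] mink_commute[of e2 e3] mink_commute[of e3 e1]
  have "mink e1 e2 \<ge> -1/2 \<and> mink e2 e3 \<ge> -1/2 \<and> mink e3 e1 \<ge> -1/2"
    using cases
  proof (elim disjE)
    assume "mink e2 e3 \<ge> -1/2"
    then show ?thesis
      using spread[OF b1, of e2] spread[OF b1, of e3] com by auto
  next
    assume "mink e3 e1 \<ge> -1/2"
    then show ?thesis
      using spread[OF b2, of e1] spread[OF b2, of e3] com by auto
  next
    assume "mink e1 e2 \<ge> -1/2"
    then show ?thesis
      using spread[OF b3, of e1] spread[OF b3, of e2] com by auto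
  qed
  then have c: "mink e1 e2 \<ge> -1/2" "mink e2 e3 \<ge> -1/2" "mink e3 e1 \<ge> -1/2" by auto
  have zero: "mink (u1 *\<^sub>R e1 + u2 *\<^sub>R e2 + u3 *\<^sub>R e3) f = 0" for f by (simp add: u(5))
  \<comment> \<open>Pairing the relation with each direction bounds each weight by half the sum of
    the other two, that is by \<open>1/3\<close>. So all weights are \<open>1/3\<close>, and the
    products add up to \<open>-1\<close> in pairs.\<close>
  have "u1 + u2 * mink e1 e2 + u3 * mink e3 e1 = 0" "u1 * mink e1 e2 + u2 + u3 * mink e2 e3 = 0"
    "u1 * mink e3 e1 + u2 * mink e2 e3 + u3 = 0"
    using zero[of e1] zero[of e2] zero[of e3]
    by (simp_all add: mink_simps D mink_commute[of e2 e1] mink_commute[of e3 e2] mink_commute[of e1 e3])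
  moreover have mono: "a * (-1/2) \<le> a * b" if "0 \<le> a" "-1/2 \<le> b" for a b :: real
    using that by (intro mult_left_mono) auto
  ultimately have "u1 \<le> 1/3" "u2 \<le> 1/3" "u3 \<le> 1/3"
    using mono[OF u(2) c(1)] mono[OF u(3) c(3)] mono[OF u(1) c(1)] mono[OF u(3) c(2)]
      mono[OF u(1) c(3)] mono[OF u(2) c(2)] u(4) by - linarith+
  then have third: "u1 = 1/3" "u2 = 1/3" "u3 = 1/3" using u(4) by - linarith+
  then have "mink e1 e2 + mink e3 e1 = -1" "mink e1 e2 + mink e2 e3 = -1" "mink e3 e1 + mink e2 e3 = -1"
    using \<open>u1 + u2 * mink e1 e2 + u3 * mink e3 e1 = 0\<close> \<open>u1 * mink e1 e2 + u2 + u3 * mink e2 e3 = 0\<close>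
      \<open>u1 * mink e3 e1 + u2 * mink e2 e3 + u3 = 0\<close> unfolding third by - linarith+
  then have "mink e1 e2 = -1/2" "mink e2 e3 = -1/2" "mink e3 e1 = -1/2"
    by - linarith+
  then have "tripod p e1 e2 e3" using ut by (simp add: tripod_def)
  moreover have "\<forall>e\<in>{e1, e2, e3}. \<exists>x\<in>K. hvec x = cosh R *\<^sub>R hvec p - sinh R *\<^sub>R e"
    using b1 b2 b3 c by auto
  ultimately show "\<exists>p e1 e2 e3. tripod p e1 e2 e3 \<and> K \<subseteq> horo_polygon p {e1, e2, e3} (inradius K) \<and>
        (\<forall>e\<in>{e1, e2, e3}. \<exists>x\<in>K. hvec x = cosh R *\<^sub>R hvec p - sinh R *\<^sub>R e)"
    using pol unfolding r_def by blast
qed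

section \<open>Regular triangles\<close>

text \<open>With \<open>E = exp r\<close> and \<open>C + S = exp R\<close>, the subtracted half sum
  is \<open>cosh (R + r)\<close>, while \<open>1 + 3/2 * S\<^sup>2\<close> is cosh of the distance
  of two vertices, by the law of cosines for the angle \<open>2\<pi>/3\<close> at the centre. The
  positive right side shows that the width is at most this distance.\<close>

lemma regular_triangle_identity:
  fixes C S E :: real
  assumes C: "C\<^sup>2 = 1 + S\<^sup>2" and E: "E = C + S / 2" "E > 0"
  shows "1 + 3/2 * S\<^sup>2 - (E * (C + S) + (C - S) / E) / 2 = 3/8 * S\<^sup>2 * (C - S) / E"
proof -
  have CC: "C * C = 1 + S * S" using C by (simp add: power2_eq_square)
  define q where "q = (C - S) / E"
  have q: "E * q = C - S" using E(2) by (simp add: q_def)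
  have EE: "2 * E = 2 * C + S" using E(1) by simp
  have "8 * E + 12 * E * S * S - 4 * E * E * (C + S) - 4 * E * q - 3 * S * S * E * q = 0"
    using CC q EE by algebra
  moreover have "8 * (E * (1 + 3/2 * S\<^sup>2 - (E * (C + S) + q) / 2 - 3/8 * S\<^sup>2 * q))
      = 8 * E + 12 * E * S * S - 4 * E * E * (C + S) - 4 * E * q - 3 * S * S * E * q"
    by (simp add: power2_eq_square field_simps)
  ultimately have "E * (1 + 3/2 * S\<^sup>2 - (E * (C + S) + q) / 2 - 3/8 * S\<^sup>2 * q) = 0" by simp
  then have "1 + 3/2 * S\<^sup>2 - (E * (C + S) + q) / 2 - 3/8 * S\<^sup>2 * q = 0" using E(2) by simp
  then show ?thesis by (simp add: q_def)
qed

text \<open>With \<open>cw\<close>, \<open>sw\<close> the cosh and sinh of the width and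
  \<open>D\<close> the cosh of the side length, the claim says that \<open>A * x - B * y\<close> is
  at least \<open>E\<close> times tanh of half the width. Over the admissible directions
  \<open>(x, y)\<close> the left quantity is smallest along \<open>(C3, B)\<close>, where
  \<open>rel\<close> makes it \<open>E\<close> times tanh of half the side length; and
  \<open>cw \<le> D\<close>.\<close>

lemma tanh_half_bound:
  fixes x y A B C3 D E S cw sw g :: real
  assumes xy: "x\<^sup>2 + y\<^sup>2 = 1" "0 \<le> x" "0 \<le> y" "y * C3 \<le> x * B"
    and pos: "C3 > 0" "B \<ge> 0" "E > 0" "S > 0" "D > 1" "sw \<ge> 0" "cw \<ge> 1"
    and rel: "A * C3 - B\<^sup>2 = 3/2 * S * E" "C3\<^sup>2 + B\<^sup>2 = 3/2 * (D + 1)" "3/2 * S\<^sup>2 = D - 1"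
    and w: "cw \<le> D" "sw\<^sup>2 = (cw - 1) * (cw + 1)"
  shows "E * (cw - 1) \<le> sw * (A * x - B * y)"
proof -
  define g where "g = A * x - B * y"
  have "B * (y * C3) \<le> B * (x * B)" using xy(4) pos(2) by (rule mult_left_mono)
  then have "(A * C3 - B\<^sup>2) * x \<le> C3 * g"
    by (simp add: g_def power2_eq_square algebra_simps)
  then have g1: "3/2 * S * E * x \<le> C3 * g" by (simp add: rel)
  have "0 \<le> 3/2 * S * E * x" using pos xy by simp
  then have "0 \<le> C3 * g" using g1 by linarith
  then have g0: "0 \<le> g" using pos(1) by (simp add: zero_le_mult_iff)
  have "(3/2 * S * E * x)\<^sup>2 \<le> (C3 * g)\<^sup>2"
    using g1 \<open>0 \<le> 3/2 * S * E * x\<close> by (intro power_mono) auto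
  then have "(3/2 * S * E)\<^sup>2 * x\<^sup>2 \<le> C3\<^sup>2 * g\<^sup>2" by (simp only: power_mult_distrib)
  then have "(3/2 * S * E)\<^sup>2 * x\<^sup>2 * (C3\<^sup>2 + B\<^sup>2) \<le> C3\<^sup>2 * g\<^sup>2 * (C3\<^sup>2 + B\<^sup>2)"
    by (intro mult_right_mono) auto
  moreover have "C3\<^sup>2 \<le> x\<^sup>2 * (C3\<^sup>2 + B\<^sup>2)"
  proof -
    have "(y * C3)\<^sup>2 \<le> (x * B)\<^sup>2" using xy pos by (intro power_mono) auto
    moreover have "C3\<^sup>2 = x\<^sup>2 * C3\<^sup>2 + y\<^sup>2 * C3\<^sup>2" using xy(1) by (simp add: distrib_right[symmetric])
    ultimately show ?thesis by (simp add: power_mult_distrib algebra_simps)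
  qed
  then have "(3/2 * S * E)\<^sup>2 * C3\<^sup>2 \<le> (3/2 * S * E)\<^sup>2 * (x\<^sup>2 * (C3\<^sup>2 + B\<^sup>2))"
    by (intro mult_left_mono) auto
  ultimately have "C3\<^sup>2 * (3/2 * S * E)\<^sup>2 \<le> C3\<^sup>2 * (g\<^sup>2 * (C3\<^sup>2 + B\<^sup>2))"
    by (simp add: mult.assoc mult.left_commute mult.commute)
  then have le: "(3/2 * S * E)\<^sup>2 \<le> g\<^sup>2 * (C3\<^sup>2 + B\<^sup>2)"
    using pos(1) by simp
  have sq: "(3/2 * S * E)\<^sup>2 = 3/2 * (E\<^sup>2 * (D - 1))"
    by (simp only: rel(3)[symmetric]) (simp add: power2_eq_square)
  have "3/2 * (E\<^sup>2 * (D - 1)) \<le> 3/2 * (g\<^sup>2 * (D + 1))"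
    using le unfolding sq rel(2) by (simp only: mult.left_commute)
  then have gD: "E\<^sup>2 * (D - 1) \<le> g\<^sup>2 * (D + 1)" by (rule mult_left_le_imp_le) simp
  have "(cw - 1) * (D + 1) \<le> (D - 1) * (cw + 1)" using w by (simp add: algebra_simps)
  then have "E\<^sup>2 * ((cw - 1) * (D + 1)) \<le> E\<^sup>2 * ((D - 1) * (cw + 1))" by (intro mult_left_mono) auto
  also have "\<dots> = E\<^sup>2 * (D - 1) * (cw + 1)" by simp
  also have "\<dots> \<le> g\<^sup>2 * (D + 1) * (cw + 1)" using gD pos by (intro mult_right_mono) auto
  finally have "(D + 1) * (E\<^sup>2 * (cw - 1)) \<le> (D + 1) * (g\<^sup>2 * (cw + 1))"
    by (simp add: mult.assoc mult.left_commute mult.commute)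
  then have "E\<^sup>2 * (cw - 1) \<le> g\<^sup>2 * (cw + 1)" using pos by simp
  then have "E\<^sup>2 * (cw - 1) * (cw - 1) \<le> g\<^sup>2 * (cw + 1) * (cw - 1)"
    using pos by (intro mult_right_mono) auto
  also have "\<dots> = (sw * g)\<^sup>2" by (simp add: power_mult_distrib w(2))
  finally have "(E * (cw - 1))\<^sup>2 \<le> (sw * g)\<^sup>2" by (simp add: power2_eq_square mult.assoc mult.left_commute)
  then show ?thesis
    unfolding g_def[symmetric] using pos g0 by (metis mult_nonneg_nonneg power2_le_imp_le)
qed

text \<open>On the unit circle, the inner product with \<open>(C3, B)\<close> decreases as one rotates away, so on the
  sector between \<open>(C3, B)\<close> and \<open>(A, B)\<close> it is minimal at the unit vector \<open>(A, B) / E\<close>.\<close>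

lemma sector_inner_bound:
  fixes x y A B C3 E :: real
  assumes xy: "x\<^sup>2 + y\<^sup>2 = 1" "0 \<le> x" "0 \<le> y" "x * B \<le> y * C3" "y * A \<le> x * B"
    and pos: "C3 > 0" "B > 0" "A > 0" "E > 0" "A \<le> C3" "A\<^sup>2 + B\<^sup>2 = E\<^sup>2"
  shows "(A * C3 + B\<^sup>2) / E \<le> x * C3 + y * B"
proof (rule ccontr)
  \<comment> \<open>\<open>i, j\<close> are the components of \<open>(x, y)\<close> along and across
    \<open>(C3, B)\<close>, and \<open>i2, j2\<close> those of \<open>(A, B) / E\<close>, in the
    same scale. Since \<open>i\<^sup>2 + j\<^sup>2 = i2\<^sup>2 + j2\<^sup>2\<close>, a smaller
    \<open>i\<close> means a larger \<open>j\<close>, so \<open>(x, y)\<close> would lie beyond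
    \<open>(A, B)\<close>, against \<open>y * A \<le> x * B\<close>.\<close>
  define i where "i = x * C3 + y * B"
  define j where "j = y * C3 - x * B"
  define i2 where "i2 = (A * C3 + B\<^sup>2) / E"
  define j2 where "j2 = B * (C3 - A) / E"
  assume "\<not> ?thesis"
  then have ii: "i < i2" by (simp add: i_def i2_def)
  have i0: "0 \<le> i" and j0: "0 \<le> j" and j20: "0 \<le> j2"
    using xy pos by (auto simp: i_def j_def j2_def)
  have "0 < A * C3 + B\<^sup>2" using pos by (intro add_pos_pos) auto
  then have i20: "0 < i2" using pos by (simp add: i2_def)
  have "i\<^sup>2 + j\<^sup>2 = (x\<^sup>2 + y\<^sup>2) * (C3\<^sup>2 + B\<^sup>2)"
    by (simp add: i_def j_def power2_eq_square algebra_simps)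
  moreover have "i2\<^sup>2 + j2\<^sup>2 = (A\<^sup>2 + B\<^sup>2) * (C3\<^sup>2 + B\<^sup>2) / E\<^sup>2"
    by (simp add: i2_def j2_def power_divide add_divide_distrib[symmetric])
      (simp add: power2_eq_square algebra_simps)
  ultimately have eq: "i\<^sup>2 + j\<^sup>2 = i2\<^sup>2 + j2\<^sup>2" using xy(1) pos by simp
  have "i\<^sup>2 < i2\<^sup>2" using ii i0 by (intro power_strict_mono) auto
  then have "j2\<^sup>2 < j\<^sup>2" using eq by linarith
  then have jj: "j2 < j" using j0 by (rule power2_less_imp_less)
  have "j2 * i \<le> j2 * i2" using ii j20 by (intro mult_left_mono) auto
  moreover have "j2 * i2 < j * i2" using jj i20 by simp
  ultimately have "0 < E * (i2 * j - j2 * i)" using pos by (simp add: mult.commute)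
  also have "E * (i2 * j - j2 * i) = (A * C3 + B\<^sup>2) * j - B * (C3 - A) * i"
    using pos by (simp add: i2_def j2_def field_simps)
  also have "\<dots> = (C3\<^sup>2 + B\<^sup>2) * (A * y - B * x)"
    by (simp add: i_def j_def power2_eq_square algebra_simps)
  finally have "0 < (C3\<^sup>2 + B\<^sup>2) * (A * y - B * x)" .
  moreover have "(C3\<^sup>2 + B\<^sup>2) * (A * y - B * x) \<le> 0"
    using xy(5) by (intro mult_nonneg_nonpos) (auto simp: mult.commute)
  ultimately show False by linarith
qed

lemma quadratic_nonpos:
  fixes b c \<epsilon> :: real
  assumes "\<epsilon> > 0" "\<And>t. 0 < t \<Longrightarrow> t < \<epsilon> \<Longrightarrow> t * b + t\<^sup>2 * c \<le> 0"
  shows "b \<le> 0"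
proof (rule ccontr)
  assume "\<not> b \<le> 0"
  then have b: "b > 0" by simp
  define t where "t = min (\<epsilon> / 2) (b / (2 * (\<bar>c\<bar> + 1)))"
  have t: "0 < t" "t < \<epsilon>" using assms(1) b by (auto simp: t_def)
  have "t * (\<bar>c\<bar> + 1) \<le> b / (2 * (\<bar>c\<bar> + 1)) * (\<bar>c\<bar> + 1)"
    unfolding t_def by (intro mult_right_mono) auto
  also have "\<dots> = b / 2" by (simp add: field_simps)
  finally have "t * (\<bar>c\<bar> + 1) \<le> b / 2" .
  moreover have "t * (- c) \<le> t * (\<bar>c\<bar> + 1)" using t by (intro mult_left_mono) auto
  ultimately have "0 < b + t * c" using b by simp
  then have "0 < t * (b + t * c)" using t by simp
  then show False using assms(2)[OF t] by (simp add: power2_eq_square algebra_simps)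
qed

text \<open>Closed disks of the hyperbolic plane are compact, since they correspond to closed
  bounded subsets of Minkowski space.\<close>

lemma compact_mink_sublevel: "compact {x. - mink (hvec x) (hvec p) \<le> M}"
proof -
  define P where "P = {v. mink v v = -1} \<inter> {v. 0 \<le> snd v} \<inter> {v. - mink v (hvec p) \<le> M}"
  have "closed P"
    unfolding P_def
    by (intro closed_Int closed_Collect_eq closed_Collect_le continuous_intros continuous_on_id)
  moreover have snd_pos: "snd v > 0" if "v \<in> P" for v
    using that inner_ge_zero[of "fst v"] by (cases "snd v = 0") (auto simp: P_def mink_def)
  moreover have "bounded P"
  proof -
    define \<delta> where "\<delta> = snd (hvec p) - norm (fst (hvec p))"
    have \<delta>: "\<delta> > 0" using norm_fst_hvec_less[of p] by (simp add: \<delta>_def)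
    have "norm v \<le> 2 * (M / \<delta>)" if v: "v \<in> P" for v
    proof -
      obtain y where y: "hvec y = v"
        using v snd_pos[OF v] Abs_hyp2_inverse[of v] by (auto simp: P_def)
      have nv: "norm (fst v) \<le> snd v" using norm_fst_hvec_less[of y] y by simp
      have "norm (fst v) * norm (fst (hvec p)) \<le> snd v * norm (fst (hvec p))"
        using nv by (intro mult_right_mono) auto
      then have "snd v * \<delta> \<le> - mink v (hvec p)"
        using norm_cauchy_schwarz[of "fst v" "fst (hvec p)"]
        by (simp add: \<delta>_def mink_def algebra_simps)
      also have "\<dots> \<le> M" using v by (simp add: P_def)
      finally have "snd v \<le> M / \<delta>" using \<delta> by (simp add: field_simps)
      moreover have "norm v \<le> norm (fst v) + norm (snd v)" by (metis norm_Pair_le prod.collapse)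
      ultimately show ?thesis using nv snd_pos[OF v] by simp
    qed
    then show ?thesis unfolding bounded_iff by blast
  qed
  ultimately have "compact P" by (simp add: compact_eq_bounded_closed)
  have inv: "hvec (Abs_hyp2 v) = v" if "v \<in> P" for v
    using that snd_pos[OF that] Abs_hyp2_inverse[of v] by (auto simp: P_def)
  have "continuous_on P Abs_hyp2"
    by (intro continuous_hyp2) (use inv in \<open>simp cong: continuous_on_cong\<close>)
  then have "compact (Abs_hyp2 ` P)" using \<open>compact P\<close> by (rule compact_continuous_image)
  moreover have "Abs_hyp2 ` P = {x. - mink (hvec x) (hvec p) \<le> M}"
  proof (intro equalityI subsetI)
    fix x assume "x \<in> Abs_hyp2 ` P"
    then show "x \<in> {x. - mink (hvec x) (hvec p) \<le> M}" using inv by (auto simp: P_def)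
  next
    fix x assume "x \<in> {x. - mink (hvec x) (hvec p) \<le> M}"
    then have "hvec x \<in> P" using snd_Rep_pos[of x] by (simp add: P_def)
    then show "x \<in> Abs_hyp2 ` P" by (metis Rep_hyp2_inverse image_eqI)
  qed
  ultimately show ?thesis by simp
qed

text \<open>\<open>r\<close> is the inradius and \<open>R\<close> the distance from the centre to the vertices; the last
  assumption says that the point at distance \<open>R\<close> in direction \<open>- e1\<close> lies on the horocycles
  tangent at \<open>e2\<close> and \<open>e3\<close>.\<close>

locale regular_triangle =
  fixes p :: hyp2 and e1 e2 e3 :: "complex \<times> real" and r R :: real
  assumes tripod: "tripod p e1 e2 e3" and r: "r > 0" and R: "R > 0"
    and E: "exp r = cosh R + sinh R / 2"
begin

section \<open>The regular triangle as an h-convex body, its inradius and its vertices\<close>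

abbreviation "T \<equiv> horo_polygon p {e1, e2, e3} r"

lemma rotate: "regular_triangle p e2 e3 e1 r R"
  using tripod r R E by unfold_locales (auto simp: tripod_def)

lemma swap: "regular_triangle p e1 e3 e2 r R"
  using tripod r R E by unfold_locales (auto simp: tripod_def mink_commute)

lemma unit_tangents: "unit_tangent p e1" "unit_tangent p e2" "unit_tangent p e3"
  using tripod by (auto simp: tripod_def)

lemma products:
  "mink e1 e1 = 1" "mink e2 e2 = 1" "mink e3 e3 = 1"
  "mink e1 e2 = -1/2" "mink e2 e1 = -1/2" "mink e2 e3 = -1/2" "mink e3 e2 = -1/2"
  "mink e3 e1 = -1/2" "mink e1 e3 = -1/2"
  "mink e1 (hvec p) = 0" "mink (hvec p) e1 = 0" "mink e2 (hvec p) = 0" "mink (hvec p) e2 = 0"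
  "mink e3 (hvec p) = 0" "mink (hvec p) e3 = 0"
  using tripod by (auto simp: tripod_def unit_tangent_def mink_commute)

lemma sum_zero: "e1 + e2 + e3 = 0"
proof -
  have "mink (e1 + e2 + e3) (hvec p) = 0" "mink (e1 + e2 + e3) (e1 + e2 + e3) = 0"
    by (simp_all add: mink_simps products)
  then show ?thesis using mink_orthogonal_nonneg(2) by blast
qed

lemma basis:
  obtains k where "mink k (hvec p) = 0" "mink k e1 = 0" "mink k k = 1"
    "e2 = (-1/2) *\<^sub>R e1 + (sqrt 3 / 2) *\<^sub>R k" "e3 = (-1/2) *\<^sub>R e1 - (sqrt 3 / 2) *\<^sub>R k"
    "\<And>v. v = (- mink v (hvec p)) *\<^sub>R hvec p + mink v e1 *\<^sub>R e1 + mink v k *\<^sub>R k"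
proof -
  obtain k' where k': "mink k' (hvec p) = 0" "mink k' e1 = 0" "mink k' k' = 1"
    and ex': "\<And>v. v = (- mink v (hvec p)) *\<^sub>R hvec p + mink v e1 *\<^sub>R e1 + mink v k' *\<^sub>R k'"
    using obtain_orthonormal_frame[OF unit_tangentD(1,3)[OF unit_tangents(1)]] by metis
  define k where "k = (if mink e2 k' \<ge> 0 then k' else - k')"
  have k: "mink k (hvec p) = 0" "mink k e1 = 0" "mink k k = 1" "mink e2 k \<ge> 0"
    using k' by (auto simp: k_def)
  have ex: "v = (- mink v (hvec p)) *\<^sub>R hvec p + mink v e1 *\<^sub>R e1 + mink v k *\<^sub>R k" for v
    using ex'[of v] by (simp add: k_def)
  define g where "g = mink e2 k"
  have e2: "e2 = (-1/2) *\<^sub>R e1 + g *\<^sub>R k" using ex[of e2] by (simp add: products g_def)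
  have "mink e2 e2 = 1/4 + g * g"
    by (subst (1 2) e2) (simp add: mink_simps products k mink_commute[of e1 k])
  then have "g\<^sup>2 = (sqrt 3 / 2)\<^sup>2" by (simp add: products power2_eq_square)
  then have g: "g = sqrt 3 / 2" using k(4) by (metis g_def power2_eq_imp_eq real_sqrt_ge_zero zero_le_divide_iff zero_le_numeral)
  have "e3 = - e1 - e2" using sum_zero by (simp add: algebra_simps eq_neg_iff_add_eq_0)
  then have "e3 = (-1/2) *\<^sub>R e1 - (sqrt 3 / 2) *\<^sub>R k"
    by (simp add: e2 g scaleR_left_diff_distrib[symmetric])
      (simp add: algebra_simps scaleR_2[symmetric] flip: scaleR_add_left)
  then show thesis using that k e2 g ex by blast
qed

lemma CS: "(cosh R)\<^sup>2 = 1 + (sinh R)\<^sup>2" "cosh R > 0" "sinh R > 0"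
  using R cosh_square_eq[of R] by simp_all

lemma width_exp:
  "exp (R + r) = (cosh R + sinh R / 2) * (cosh R + sinh R)"
  "exp (- (R + r)) = (cosh R - sinh R) / (cosh R + sinh R / 2)"
  "cosh (R + r) = ((cosh R + sinh R / 2) * (cosh R + sinh R) + (cosh R - sinh R) / (cosh R + sinh R / 2)) / 2"
  "sinh (R + r) = ((cosh R + sinh R / 2) * (cosh R + sinh R) - (cosh R - sinh R) / (cosh R + sinh R / 2)) / 2"
proof -
  show 1: "exp (R + r) = (cosh R + sinh R / 2) * (cosh R + sinh R)"
    by (simp add: exp_add E cosh_plus_sinh)
  have "exp (- (R + r)) = exp (- R) / exp r" by (simp add: exp_diff[symmetric])
  then show 2: "exp (- (R + r)) = (cosh R - sinh R) / (cosh R + sinh R / 2)"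
    by (simp add: E cosh_minus_sinh)
  show "cosh (R + r) = ((cosh R + sinh R / 2) * (cosh R + sinh R) + (cosh R - sinh R) / (cosh R + sinh R / 2)) / 2"
    unfolding 1[symmetric] 2[symmetric] by (simp only: cosh_field_def)
  show "sinh (R + r) = ((cosh R + sinh R / 2) * (cosh R + sinh R) - (cosh R - sinh R) / (cosh R + sinh R / 2)) / 2"
    unfolding 1[symmetric] 2[symmetric] by (simp only: sinh_field_def)
qed

lemma cosh_width_le: "cosh (R + r) \<le> 1 + 3/2 * (sinh R)\<^sup>2"
proof -
  have E0: "cosh R + sinh R / 2 > 0" using CS by (intro add_pos_pos) auto
  have "0 \<le> 3/8 * (sinh R)\<^sup>2 * (cosh R - sinh R) / (cosh R + sinh R / 2)"
    using E0 by (simp add: cosh_minus_sinh)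
  then show ?thesis
    using regular_triangle_identity[OF CS(1) refl E0] unfolding width_exp by linarith
qed

lemma mem_T: "x \<in> T \<longleftrightarrow> - mink (hvec x) (hvec p) + mink (hvec x) e1 \<le> exp r \<and>
    - mink (hvec x) (hvec p) + mink (hvec x) e2 \<le> exp r \<and> - mink (hvec x) (hvec p) + mink (hvec x) e3 \<le> exp r"
  by (simp add: horo_polygon_def)

lemma lightlike_side:
  assumes "unit_tangent p e"
  shows "lightlike (exp (- r) *\<^sub>R (hvec p - e))"
  using lightlike_tangent[of e p "exp (- r)"] assms by (simp add: unit_tangent_def)

lemma T_eq_horoballs:
  "T = horoball (exp (- r) *\<^sub>R (hvec p - e1)) \<inter>
    (horoball (exp (- r) *\<^sub>R (hvec p - e2)) \<inter> horoball (exp (- r) *\<^sub>R (hvec p - e3)))"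
  by (auto simp: mem_T horoball_exp_iff)

lemma h_convex_T: "h_convex T"
  unfolding T_eq_horoballs
  by (intro h_convex_Int h_convex_horoball lightlike_side unit_tangents)

lemma compact_T: "compact T"
proof -
  have "T \<subseteq> {x. - mink (hvec x) (hvec p) \<le> exp r}"
  proof
    fix x assume x: "x \<in> T"
    \<comment> \<open>Adding the three side conditions cancels the tangential terms and bounds the
      distance from \<open>p\<close>.\<close>
    have "mink (hvec x) (e1 + e2 + e3) = 0" by (simp add: sum_zero)
    then have "mink (hvec x) e1 + mink (hvec x) e2 + mink (hvec x) e3 = 0" by (simp add: mink_simps)
    then show "x \<in> {x. - mink (hvec x) (hvec p) \<le> exp r}" using x unfolding mem_T mem_Collect_eq by linarith
  qed
  moreover have "closed T" using h_convex_T by (simp add: h_convex_def)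
  ultimately show ?thesis
    using compact_mink_sublevel[of p "exp r"] by (metis compact_Int_closed inf.absorb_iff2)
qed

lemma cball_subset_T: "cball p r \<subseteq> T"
proof -
  have "cball p r \<subseteq> horoball (exp (- r) *\<^sub>R (hvec p - e))" if "unit_tangent p e" for e
    using r lightlike_side[OF that] unit_tangentD[OF that]
    by (subst cball_subset_horoball) (simp_all add: mink_simps)
  then show ?thesis using unit_tangents unfolding T_eq_horoballs by blast
qed

lemma h_convex_body_T: "h_convex_body T"
proof -
  have "ball p r \<subseteq> interior T"
    using cball_subset_T ball_subset_cball by (intro interior_maximal) auto
  then have "p \<in> interior T" using r by auto
  then show ?thesis using compact_T h_convex_T by (auto simp: h_convex_body_def)
qed

text \<open>For a disk of radius \<open>s\<close> about \<open>q\<close> in \<open>T\<close>, add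
  the three horoball conditions. The tangential terms cancel, leaving
  \<open>exp (- r) * cosh (dist q p) \<le> exp (- s)\<close>, and the cosh is at least 1.\<close>

lemma inradius_T: "inradius T = r"
  unfolding inradius_def
proof (intro cSup_eq_maximum)
  show "r \<in> {r. 0 < r \<and> (\<exists>p. cball p r \<subseteq> T)}" using r cball_subset_T by blast
  fix s assume "s \<in> {r. 0 < r \<and> (\<exists>p. cball p r \<subseteq> T)}"
  then obtain q where s: "s > 0" "cball q s \<subseteq> T" by blast
  have le: "exp (- r) * (- mink (hvec q) (hvec p) + mink (hvec q) e) \<le> exp (- s)"
    if e: "unit_tangent p e" "T \<subseteq> horoball (exp (- r) *\<^sub>R (hvec p - e))" for e
  proof -
    have "cball q s \<subseteq> horoball (exp (- r) *\<^sub>R (hvec p - e))" using s(2) e(2) by blast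
    then have "- mink (hvec q) (exp (- r) *\<^sub>R (hvec p - e)) \<le> exp (- s)"
      using cball_subset_horoball[OF lightlike_side[OF e(1)], of s q] s(1) by simp
    then show ?thesis by (simp add: mink_simps algebra_simps)
  qed
  have sides: "T \<subseteq> horoball (exp (- r) *\<^sub>R (hvec p - e1))" "T \<subseteq> horoball (exp (- r) *\<^sub>R (hvec p - e2))"
    "T \<subseteq> horoball (exp (- r) *\<^sub>R (hvec p - e3))"
    unfolding T_eq_horoballs by auto
  have "mink (hvec q) (e1 + e2 + e3) = 0" by (simp add: sum_zero)
  then have "exp (- r) * (mink (hvec q) e1 + mink (hvec q) e2 + mink (hvec q) e3) = 0"
    by (simp add: mink_simps)
  then have "3 * (exp (- r) * (- mink (hvec q) (hvec p))) \<le> 3 * exp (- s)"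
    using le[OF unit_tangents(1) sides(1)] le[OF unit_tangents(2) sides(2)] le[OF unit_tangents(3) sides(3)]
    unfolding distrib_left by linarith
  moreover have "exp (- r) * 1 \<le> exp (- r) * (- mink (hvec q) (hvec p))"
    using one_le_mink by (intro mult_left_mono) auto
  ultimately have "exp (- r) \<le> exp (- s)" by linarith
  then show "s \<le> r" by simp
qed

lemma vertex:
  obtains v where "hvec v = cosh R *\<^sub>R hvec p - sinh R *\<^sub>R e1" "v \<in> T"
proof -
  obtain v where v: "hvec v = cosh R *\<^sub>R hvec p + sinh R *\<^sub>R (- e1)"
    using obtain_exp[of "- e1" p R] by (auto simp: products)
  then have "v \<in> T" using CS by (simp add: mem_T E mink_simps products)
  then show thesis using that v by simp
qed

text \<open>Equality of two constraints puts \<open>x\<close> on the axis of \<open>e1\<close>, and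
  one quadratic equation remains. The third constraint gives \<open>a \<ge> 0\<close>, which
  excludes its second root.\<close>

lemma two_active:
  assumes "x \<in> T" "- mink (hvec x) (hvec p) + mink (hvec x) e2 = exp r"
    "- mink (hvec x) (hvec p) + mink (hvec x) e3 = exp r"
  shows "hvec x = cosh R *\<^sub>R hvec p - sinh R *\<^sub>R e1"
proof -
  obtain k where k: "mink k (hvec p) = 0" "mink k e1 = 0" "mink k k = 1"
    "e2 = (-1/2) *\<^sub>R e1 + (sqrt 3 / 2) *\<^sub>R k" "e3 = (-1/2) *\<^sub>R e1 - (sqrt 3 / 2) *\<^sub>R k"
    and ex: "\<And>v. v = (- mink v (hvec p)) *\<^sub>R hvec p + mink v e1 *\<^sub>R e1 + mink v k *\<^sub>R k"
    using basis by metis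
  define X a where "X = - mink (hvec x) (hvec p)" and "a = - mink (hvec x) e1 / 2"
  define C S where "C = cosh R" and "S = sinh R"
  have C: "C * C = 1 + S * S" "C > 0" "S > 0" using CS by (simp_all add: C_def S_def power2_eq_square)
  have "mink (hvec x) e2 = mink (hvec x) e3" using assms(2,3) by linarith
  then have "sqrt 3 * mink (hvec x) k = 0" by (simp add: k(4,5) mink_simps)
  then have xk: "mink (hvec x) k = 0" by simp
  have x: "hvec x = X *\<^sub>R hvec p - (2 * a) *\<^sub>R e1"
    using ex[of "hvec x"] by (simp add: xk X_def a_def)
  have XE: "X = C + S / 2 - a"
    using assms(2) by (simp add: k(4) mink_simps xk X_def a_def E C_def S_def)
  have "mink (hvec x) (hvec x) = - (X * X) + 4 * (a * a)"
    by (simp add: x mink_simps products)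
  then have XX: "X * X = 1 + 4 * (a * a)" by simp
  have "X - 2 * a \<le> C + S / 2"
    using assms(1) by (simp add: mem_T X_def a_def E C_def S_def)
  then have a0: "a \<ge> 0" using XE by simp
  have X1: "X \<ge> 1" using one_le_mink by (simp add: X_def)
  have "a = S / 2"
  proof (rule ccontr)
    assume "a \<noteq> S / 2"
    define h where "h = S / 2"
    have "C * C = 1 + 4 * h * h" "X = C + h - a" using C(1) XE by (simp_all add: h_def)
    then have "(h - a) * (X + C + 4 * (a + h)) = 0" using XX by algebra
    then have "(S / 2 - a) * (X + C + 4 * (a + S / 2)) = 0" by (simp add: h_def)
    then have "X + C + 4 * (a + S / 2) = 0" using \<open>a \<noteq> S / 2\<close> by simp
    then show False using X1 C a0 by simp
  qed
  then have "2 * a = sinh R" "X = cosh R" using XE by (simp_all add: C_def S_def)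
  then show ?thesis using x by simp
qed

section \<open>First-order conditions at points of the regular triangle\<close>

lemma strict_near:
  fixes \<gamma> :: "real \<Rightarrow> hyp2"
  assumes "continuous_on UNIV (\<lambda>t. hvec (\<gamma> t))" "- mink (hvec (\<gamma> 0)) (hvec p) + mink (hvec (\<gamma> 0)) e < exp r"
  obtains \<epsilon> where "\<epsilon> > 0" "\<And>t. \<bar>t\<bar> < \<epsilon> \<Longrightarrow> - mink (hvec (\<gamma> t)) (hvec p) + mink (hvec (\<gamma> t)) e < exp r"
proof -
  have "open {t. - mink (hvec (\<gamma> t)) (hvec p) + mink (hvec (\<gamma> t)) e < exp r}"
    by (intro open_Collect_less continuous_intros assms(1))
  then obtain \<epsilon> where "\<epsilon> > 0" "ball 0 \<epsilon> \<subseteq> {t. - mink (hvec (\<gamma> t)) (hvec p) + mink (hvec (\<gamma> t)) e < exp r}"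
    using assms(2) unfolding open_contains_ball by auto
  then show thesis using that[of \<epsilon>] by (auto simp: subset_iff dist_real_def)
qed

text \<open>A strict constraint survives a small motion, and a tight one survives if the motion
  follows its own horocycle.\<close>

lemma arc_near:
  assumes h: "horo_tangent x m l"
    and e: "\<And>e. e \<in> {e1, e2, e3} \<Longrightarrow> - mink (hvec x) (hvec p) + mink (hvec x) e < exp r \<or>
      l = exp (- r) *\<^sub>R (hvec p - e)"
  obtains \<epsilon> where "\<epsilon> > 0" "\<And>t. \<bar>t\<bar> < \<epsilon> \<Longrightarrow> horo x m l t \<in> T"
proof -
  have cont: "continuous_on UNIV (\<lambda>t. hvec (horo x m l t))"
    by (intro continuous_hvec_comp continuous_horo[OF h] continuous_on_id)
  have "\<exists>\<epsilon>>0. \<forall>t. \<bar>t\<bar> < \<epsilon> \<longrightarrow> - mink (hvec (horo x m l t)) (hvec p) + mink (hvec (horo x m l t)) e \<le> exp r"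
    if "e \<in> {e1, e2, e3}" for e
    using e[OF that]
  proof
    assume "- mink (hvec x) (hvec p) + mink (hvec x) e < exp r"
    then show ?thesis using strict_near[OF cont, of e] by (metis horo_0 less_imp_le)
  next
    assume l: "l = exp (- r) *\<^sub>R (hvec p - e)"
    have "horo x m l t \<in> horoball l" for t
      using horo_mem_horocycle[OF h, of t] by (simp add: horoball_def horocycle_def)
    then show ?thesis unfolding l horoball_exp_iff by (intro exI[of _ 1]) auto
  qed
  then obtain f where f: "\<And>e. e \<in> {e1, e2, e3} \<Longrightarrow> f e > 0"
    "\<And>e t. e \<in> {e1, e2, e3} \<Longrightarrow> \<bar>t\<bar> < f e \<Longrightarrow>
      - mink (hvec (horo x m l t)) (hvec p) + mink (hvec (horo x m l t)) e \<le> exp r" by metis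
  define \<epsilon> where "\<epsilon> = min (f e1) (min (f e2) (f e3))"
  show thesis
  proof (rule that[of \<epsilon>])
    show "\<epsilon> > 0" using f(1) by (simp add: \<epsilon>_def)
    fix t :: real assume "\<bar>t\<bar> < \<epsilon>"
    then show "horo x m l t \<in> T" using f(2) by (simp add: \<epsilon>_def mem_T)
  qed
qed

lemma side_tangent:
  assumes "- mink (hvec x) (hvec p) + mink (hvec x) e = exp r" "unit_tangent p e"
  obtains m where "horo_tangent x m (exp (- r) *\<^sub>R (hvec p - e))"
proof -
  have "mink (hvec x) (exp (- r) *\<^sub>R (hvec p - e)) = - (exp (- r) * (- mink (hvec x) (hvec p) + mink (hvec x) e))"
    by (simp add: mink_simps algebra_simps)
  also have "\<dots> = -1" unfolding assms(1) by (simp add: exp_minus)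
  finally have "x \<in> horocycle (exp (- r) *\<^sub>R (hvec p - e))" by (simp add: horocycle_def)
  then show thesis using horocycle_param[OF lightlike_side[OF assms(2)]] that by metis
qed

lemma horo_frame:
  assumes h: "horo_tangent x m l" and "mink v (hvec x) = 0" "mink v m = 0"
  shows "v = mink v l *\<^sub>R (l - hvec x)"
proof -
  have l: "mink (hvec x) l = -1" "mink l (hvec x) = -1" "mink l l = 0"
    "mink m (hvec x) = 0" "mink m l = 0" "mink m m = 1"
    using h by (auto simp: horo_tangent_def lightlike_def mink_commute)
  have n: "mink (l - hvec x) (hvec x) = 0" "mink (l - hvec x) (l - hvec x) = 1"
    by (simp_all add: mink_simps l)
  obtain k where k: "mink k (hvec x) = 0" "mink k (l - hvec x) = 0" "mink k k = 1"
    and ex: "\<And>v. v = (- mink v (hvec x)) *\<^sub>R hvec x + mink v (l - hvec x) *\<^sub>R (l - hvec x) + mink v k *\<^sub>R k"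
    using obtain_orthonormal_frame[OF n] by metis
  have mk: "m = mink m k *\<^sub>R k" using ex[of m] by (simp add: mink_simps l)
  have "mink m k \<noteq> 0"
  proof
    assume "mink m k = 0"
    then have "m = 0" using mk by simp
    then show False using l by simp
  qed
  moreover have "mink v m = mink m k * mink v k" by (subst mk) (simp add: mink_simps)
  ultimately have "mink v k = 0" using assms(3) by simp
  then show ?thesis using ex[of v] assms(2) by (simp add: mink_simps)
qed

end

text \<open>The product with \<open>k\<close> is quadratic in \<open>t\<close>, so a minimum at 0
  forces a vanishing linear and a nonnegative quadratic coefficient. It is applied to lightlike
  \<open>k\<close>, where the latter collides with \<open>mink l k \<le> 0\<close>, and to the
  normals of half-planes.\<close>

lemma arc_minimum:
  assumes h: "horo_tangent x m l" and \<epsilon>: "\<epsilon> > 0"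
    and le: "\<And>t. \<bar>t\<bar> < \<epsilon> \<Longrightarrow> mink (hvec x) k \<le> mink (hvec (horo x m l t)) k"
  shows "mink m k = 0" "mink l k \<ge> 0"
proof -
  have nn: "0 \<le> t * mink m k + t\<^sup>2 * (mink l k / 2)" if "\<bar>t\<bar> < \<epsilon>" for t
    using le[OF that] by (simp add: mink_horo[OF h])
  have "- mink m k \<le> 0"
  proof (rule quadratic_nonpos[OF \<epsilon>, of _ "- mink l k / 2"])
    fix t assume "0 < t" "t < \<epsilon>"
    then show "t * - mink m k + t\<^sup>2 * (- mink l k / 2) \<le> 0" using nn[of t] by simp
  qed
  moreover have "mink m k \<le> 0"
  proof (rule quadratic_nonpos[OF \<epsilon>, of _ "- mink l k / 2"])
    fix t assume "0 < t" "t < \<epsilon>"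
    then show "t * mink m k + t\<^sup>2 * (- mink l k / 2) \<le> 0" using nn[of "- t"] by simp
  qed
  ultimately show 0: "mink m k = 0" by simp
  have "0 \<le> (\<epsilon> / 2)\<^sup>2 * (mink l k / 2)" using nn[of "\<epsilon> / 2"] \<epsilon> 0 by simp
  then show "mink l k \<ge> 0" using \<epsilon> by (simp add: zero_le_mult_iff)
qed

context regular_triangle
begin

lemma p_mem_T: "p \<in> T"
  using cball_subset_T r by (auto dest: subsetD[of _ _ p])

text \<open>Minimality along the side makes \<open>k\<close> a positive multiple of the vector
  \<open>l\<close> of this side. The functional is then constant along the side and has the same
  value at the vertex \<open>v\<close>.\<close>

lemma minimum_on_side:
  assumes k: "lightlike k" and x: "\<And>y. y \<in> T \<Longrightarrow> mink (hvec x) k \<le> mink (hvec y) k"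
    and act: "- mink (hvec x) (hvec p) + mink (hvec x) e1 = exp r"
      "- mink (hvec x) (hvec p) + mink (hvec x) e2 < exp r"
      "- mink (hvec x) (hvec p) + mink (hvec x) e3 < exp r"
    and v: "v \<in> horoball k" "hvec v = cosh R *\<^sub>R hvec p - sinh R *\<^sub>R e2"
  shows "x \<in> horoball k"
proof -
  define l where "l = exp (- r) *\<^sub>R (hvec p - e1)"
  obtain m where h: "horo_tangent x m l"
    using side_tangent[OF act(1) unit_tangents(1)] by (metis l_def)
  obtain \<epsilon> where \<epsilon>: "\<epsilon> > 0" "\<And>t. \<bar>t\<bar> < \<epsilon> \<Longrightarrow> horo x m l t \<in> T"
    by (rule arc_near[OF h]) (use act in \<open>auto simp: l_def\<close>)
  note min = arc_minimum[OF h \<epsilon>(1) x[OF \<epsilon>(2)]]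
  have hl: "lightlike l" "mink (hvec x) l = -1" "mink m (hvec x) = 0" "mink (hvec x) m = 0"
    using h by (auto simp: horo_tangent_def mink_commute)
  have lk: "mink l k = 0" using min(2) mink_lightlike_nonpos[OF hl(1) k] by simp
  define c where "c = mink (hvec x) k"
  have kc: "mink k (hvec x) = c" by (simp add: c_def mink_commute)
  define w where "w = k + c *\<^sub>R hvec x"
  have "mink w (hvec x) = 0" "mink w m = 0"
    using min(1) hl by (simp_all add: w_def mink_simps kc mink_commute[of k m])
  then have "w = mink w l *\<^sub>R (l - hvec x)" by (rule horo_frame[OF h])
  moreover have "mink w l = - c" using lk hl by (simp add: w_def mink_simps mink_commute[of k l])
  ultimately have "k = - c *\<^sub>R l" by (simp add: w_def algebra_simps)
  moreover have "mink (hvec v) l = -1"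
  proof -
    have "mink (hvec v) l = exp (- r) * - (cosh R + sinh R / 2)"
      by (simp add: v(2) l_def mink_simps products)
    then show ?thesis unfolding E[symmetric] by (simp add: exp_minus)
  qed
  ultimately have "mink (hvec v) k = c" by (simp add: mink_simps)
  then show ?thesis using v(1) by (simp add: horoball_def c_def)
qed

text \<open>At an interior point every horocycle through \<open>x\<close> may be followed, so
  \<open>k\<close> is orthogonal to their vectors. Two opposite ones add up to a multiple of
  \<open>hvec x\<close>, whose product with \<open>k\<close> is negative.\<close>

lemma minimum_not_interior:
  assumes k: "lightlike k" and x: "\<And>y. y \<in> T \<Longrightarrow> mink (hvec x) k \<le> mink (hvec y) k"
    and int: "\<And>e. e \<in> {e1, e2, e3} \<Longrightarrow> - mink (hvec x) (hvec p) + mink (hvec x) e < exp r"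
  shows False
proof -
  have zero: "mink l k = 0" if l: "lightlike l" "mink (hvec x) l = -1" for l
  proof -
    have "x \<in> horocycle l" using l by (simp add: horocycle_def)
    then obtain m where h: "horo_tangent x m l" using horocycle_param[OF l(1)] by metis
    obtain \<epsilon> where \<epsilon>: "\<epsilon> > 0" "\<And>t. \<bar>t\<bar> < \<epsilon> \<Longrightarrow> horo x m l t \<in> T"
      by (rule arc_near[OF h]) (use int in auto)
    show ?thesis
      using arc_minimum(2)[OF h \<epsilon>(1) x[OF \<epsilon>(2)]] mink_lightlike_nonpos[OF l(1) k] by simp
  qed
  obtain n where n: "mink n (hvec x) = 0" "mink n n = 1"
    using lightlike_decompose[OF k, of x] by metis
  then have xn: "mink (hvec x) n = 0" by (simp add: mink_commute)
  have "mink (hvec x - n) k = 0" "mink (hvec x - - n) k = 0"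
    using lightlike_tangent[of n x 1] lightlike_tangent[of "- n" x 1] n xn
    by (intro zero; simp add: mink_simps)+
  then have "mink (hvec x) k = 0" by (simp add: mink_simps)
  then show False using lightlike_neg[OF k, of x] by simp
qed

text \<open>The minimum over \<open>T\<close> of the functional defining a horoball is attained at a vertex, since
  the functional is strictly concave along all horocyclic arcs not concentric with the horoball.\<close>

lemma T_subset_horoball:
  assumes k: "lightlike k"
    and v: "\<And>e. e \<in> {e1, e2, e3} \<Longrightarrow> \<exists>v\<in>horoball k. hvec v = cosh R *\<^sub>R hvec p - sinh R *\<^sub>R e"
  shows "T \<subseteq> horoball k"
proof -
  interpret r1: regular_triangle p e2 e3 e1 r R by (rule rotate)
  interpret r2: regular_triangle p e3 e1 e2 r R by (rule r1.rotate)
  have rot: "{e2, e3, e1} = {e1, e2, e3}" "{e3, e1, e2} = {e1, e2, e3}" by auto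
  have "continuous_on T (\<lambda>y. mink (hvec y) k)" by (intro continuous_intros continuous_on_id)
  then obtain x where x: "x \<in> T" "\<And>y. y \<in> T \<Longrightarrow> mink (hvec x) k \<le> mink (hvec y) k"
    using continuous_attains_inf[OF compact_T, of "\<lambda>y. mink (hvec y) k"] p_mem_T by blast
  define g where "g = (\<lambda>e. - mink (hvec x) (hvec p) + mink (hvec x) e)"
  have g: "g e1 \<le> exp r" "g e2 \<le> exp r" "g e3 \<le> exp r" using x(1) by (simp_all add: mem_T g_def)
  have vert: "x \<in> horoball k" if "hvec x = cosh R *\<^sub>R hvec p - sinh R *\<^sub>R e" "e \<in> {e1, e2, e3}" for e
    using v[OF that(2)] that(1) by (metis Rep_hyp2_inject)
  note act = g_def[THEN fun_cong, symmetric]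
  obtain v1 where v1: "v1 \<in> horoball k" "hvec v1 = cosh R *\<^sub>R hvec p - sinh R *\<^sub>R e1" using v[of e1] by auto
  obtain v2 where v2: "v2 \<in> horoball k" "hvec v2 = cosh R *\<^sub>R hvec p - sinh R *\<^sub>R e2" using v[of e2] by auto
  obtain v3 where v3: "v3 \<in> horoball k" "hvec v3 = cosh R *\<^sub>R hvec p - sinh R *\<^sub>R e3" using v[of e3] by auto
  have "x \<in> horoball k"
  proof -
    consider "g e2 = exp r" "g e3 = exp r" | "g e3 = exp r" "g e1 = exp r" | "g e1 = exp r" "g e2 = exp r"
      | "g e1 = exp r" "g e2 < exp r" "g e3 < exp r" | "g e2 = exp r" "g e3 < exp r" "g e1 < exp r"
      | "g e3 = exp r" "g e1 < exp r" "g e2 < exp r" | "g e1 < exp r" "g e2 < exp r" "g e3 < exp r"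
      using g unfolding order_le_less by blast
    then show ?thesis
    proof cases
      case 1
      then show ?thesis using two_active[OF x(1)] vert[of e1] unfolding act by auto
    next
      case 2
      then show ?thesis using r1.two_active[of x] x(1) vert[of e2] unfolding act rot by auto
    next
      case 3
      then show ?thesis using r2.two_active[of x] x(1) vert[of e3] unfolding act rot by auto
    next
      case 4
      then show ?thesis using minimum_on_side[OF k x(2) _ _ _ v2] unfolding act by auto
    next
      case 5
      then show ?thesis
        by (intro r1.minimum_on_side[OF k _ _ _ _ v3]) (use x(2) in \<open>auto simp: g_def rot\<close>)
    next
      case 6
      then show ?thesis
        by (intro r2.minimum_on_side[OF k _ _ _ _ v1]) (use x(2) in \<open>auto simp: g_def rot\<close>)
    next
      case 7
      then show ?thesis using minimum_not_interior[OF k x(2)] unfolding act by auto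
    qed
  qed
  then show ?thesis using x(2) by (force simp: horoball_def)
qed

section \<open>The minimal width of a regular triangle\<close>

lemma support_not_interior:
  assumes u: "mink u u = 1" "T \<subseteq> half_plane u" and x: "mink (hvec x) u = 0"
    and int: "\<And>e. e \<in> {e1, e2, e3} \<Longrightarrow> - mink (hvec x) (hvec p) + mink (hvec x) e < exp r"
  shows False
proof -
  have ux: "mink u (hvec x) = 0" using x by (simp add: mink_commute)
  have "\<exists>y. hvec y = cosh t *\<^sub>R hvec x + sinh t *\<^sub>R u" for t
    using obtain_exp[OF ux u(1), of t] by metis
  then obtain \<gamma> where \<gamma>: "\<And>t. hvec (\<gamma> t) = cosh t *\<^sub>R hvec x + sinh t *\<^sub>R u" by metis
  have cont: "continuous_on UNIV (\<lambda>t. hvec (\<gamma> t))"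
    unfolding \<gamma> by (intro continuous_intros)
  have g0: "hvec (\<gamma> 0) = hvec x" by (simp add: \<gamma>)
  have "\<exists>\<epsilon>>0. \<forall>t. \<bar>t\<bar> < \<epsilon> \<longrightarrow> - mink (hvec (\<gamma> t)) (hvec p) + mink (hvec (\<gamma> t)) e < exp r"
    if "e \<in> {e1, e2, e3}" for e
    using strict_near[OF cont, of e] int[OF that] unfolding g0 by metis
  then obtain f where f: "\<And>e. e \<in> {e1, e2, e3} \<Longrightarrow> f e > 0"
    "\<And>e t. e \<in> {e1, e2, e3} \<Longrightarrow> \<bar>t\<bar> < f e \<Longrightarrow> - mink (hvec (\<gamma> t)) (hvec p) + mink (hvec (\<gamma> t)) e < exp r"
    by metis
  define t where "t = min (f e1) (min (f e2) (f e3)) / 2"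
  have t: "0 < t" "\<bar>t\<bar> < f e1" "\<bar>t\<bar> < f e2" "\<bar>t\<bar> < f e3"
    using f(1)[of e1] f(1)[of e2] f(1)[of e3] by (auto simp: t_def min_def)
  have "\<gamma> t \<in> T" using f(2) t by (simp add: mem_T less_imp_le)
  then have "mink (hvec (\<gamma> t)) u \<le> 0" using u(2) by (auto simp: half_plane_def)
  moreover have "mink (hvec (\<gamma> t)) u = sinh t" by (simp add: \<gamma> mink_simps x u)
  ultimately show False using t by simp
qed

text \<open>The support line must be the tangent geodesic of the side,
  \<open>u = hvec x - l\<close>, and the opposite vertex \<open>v\<close> is far enough. Its
  distance from the line increases with \<open>X = cosh (dist x p)\<close>, and on the side
  \<open>X\<close> is at least \<open>cosh r\<close>, attained at the contact point with the
  disk.\<close>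

lemma support_on_side:
  assumes u: "mink u u = 1" "T \<subseteq> half_plane u" and x: "mink (hvec x) u = 0"
    and act: "- mink (hvec x) (hvec p) + mink (hvec x) e1 = exp r"
      "- mink (hvec x) (hvec p) + mink (hvec x) e2 < exp r"
      "- mink (hvec x) (hvec p) + mink (hvec x) e3 < exp r"
  shows "\<exists>y\<in>T. sinh (R + r) \<le> - mink (hvec y) u"
proof -
  define l where "l = exp (- r) *\<^sub>R (hvec p - e1)"
  obtain m where h: "horo_tangent x m l"
    using side_tangent[OF act(1) unit_tangents(1)] by (metis l_def)
  obtain \<epsilon> where \<epsilon>: "\<epsilon> > 0" "\<And>t. \<bar>t\<bar> < \<epsilon> \<Longrightarrow> horo x m l t \<in> T"
    by (rule arc_near[OF h]) (use act in \<open>auto simp: l_def\<close>)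
  have "mink (hvec x) (- u) \<le> mink (hvec (horo x m l t)) (- u)" if "\<bar>t\<bar> < \<epsilon>" for t
    using \<epsilon>(2)[OF that] u(2) x by (auto simp: half_plane_def)
  note min = arc_minimum[OF h \<epsilon>(1) this]
  have um: "mink u m = 0" and ul: "mink u l \<le> 0" using min by (simp_all add: mink_commute)
  have ux: "mink u (hvec x) = 0" using x by (simp add: mink_commute)
  define c where "c = mink u l"
  have uc: "u = c *\<^sub>R (l - hvec x)" unfolding c_def by (rule horo_frame[OF h ux um])
  have hl: "mink l l = 0" "mink (hvec x) l = -1" "mink l (hvec x) = -1"
    using h by (auto simp: horo_tangent_def lightlike_def mink_commute)
  have "c * c = 1" using u(1) by (simp add: uc mink_simps hl)
  then have "c = -1" using ul by (simp add: c_def square_eq_1_iff)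
  then have ue: "u = hvec x - l" using uc by simp
  obtain v where v: "hvec v = cosh R *\<^sub>R hvec p - sinh R *\<^sub>R e1" "v \<in> T" using vertex by blast
  define X where "X = - mink (hvec x) (hvec p)"
  define C S Er where "C = cosh R" and "S = sinh R" and "Er = exp r"
  have C: "C > S" "S > 0" using CS sinh_less_cosh_real[of R] unfolding C_def S_def by blast+
  have Er: "Er > 0" by (simp add: Er_def)
  have Er_eq: "Er = C + S / 2" by (simp add: Er_def E C_def S_def)
  have a: "mink (hvec x) e1 = Er - X" using act(1) by (simp add: X_def Er_def)
  have "(Er - X)\<^sup>2 \<le> X\<^sup>2 - 1"
    using tangent_component_le[of e1 p x] unit_tangentD[OF unit_tangents(1)] by (simp add: a X_def)
  then have "Er\<^sup>2 + 1 \<le> 2 * Er * X" by (simp add: power2_eq_square algebra_simps)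
  then have X: "(Er + 1 / Er) / 2 \<le> X" using Er by (simp add: field_simps power2_eq_square)
  have "mink (hvec v) (hvec x) = - (C * X + S * (Er - X))"
    using a by (simp add: v(1) mink_simps C_def S_def X_def mink_commute[of _ "hvec x"] algebra_simps)
  moreover have "mink (hvec v) l = - ((C - S) / Er)"
    by (simp add: v(1) l_def mink_simps products C_def S_def Er_def exp_minus field_simps)
  ultimately have "- mink (hvec v) u = (C - S) * X + S * Er - (C - S) / Er"
    by (simp add: ue mink_simps algebra_simps)
  moreover have "(C - S) * ((Er + 1 / Er) / 2) \<le> (C - S) * X"
    using X C by (intro mult_left_mono) auto
  moreover have "(C - S) * ((Er + 1 / Er) / 2) + S * Er - (C - S) / Er = sinh (R + r)"
    unfolding width_exp C_def[symmetric] S_def[symmetric] Er_eq[symmetric] using Er by (simp add: field_simps)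
  ultimately have "sinh (R + r) \<le> - mink (hvec v) u" by linarith
  then show ?thesis using v(2) by blast
qed

text \<open>For a support line through the vertex \<open>z\<close>, the inner unit normal \<open>- u\<close> either points
  between the two other vertices, so the point at distance \<open>R + r\<close> along the normal ray is still in
  \<open>T\<close>, or it lies between the direction of such a vertex and the normal to a side, and that vertex
  is far enough. Both cases rest on \<open>cosh_width_le\<close>, which says that \<open>R + r\<close> is at most the
  distance of two vertices.\<close>

lemma support_at_vertex:
  assumes u: "mink u u = 1" "T \<subseteq> half_plane u" and x: "mink (hvec z) u = 0"
    and z: "hvec z = cosh R *\<^sub>R hvec p - sinh R *\<^sub>R e1" and le: "mink u e3 \<le> mink u e2"
  shows "\<exists>y\<in>T. sinh (R + r) \<le> - mink (hvec y) u"
proof -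
  obtain k where k: "mink k (hvec p) = 0" "mink k e1 = 0" "mink k k = 1"
    "e2 = (-1/2) *\<^sub>R e1 + (sqrt 3 / 2) *\<^sub>R k" "e3 = (-1/2) *\<^sub>R e1 - (sqrt 3 / 2) *\<^sub>R k"
    and ex: "\<And>v. v = (- mink v (hvec p)) *\<^sub>R hvec p + mink v e1 *\<^sub>R e1 + mink v k *\<^sub>R k"
    using basis by metis
  define C S B A C3 where "C = cosh R" and "S = sinh R" and "B = sqrt 3 / 2"
    and "A = S + C / 2" and "C3 = 3/2 * C"
  define Er where "Er = C + S / 2"
  have C: "C * C = 1 + S * S" "C > 0" "S > 0" using CS by (simp_all add: C_def S_def power2_eq_square)
  have Er0: "Er > 0" using C by (simp add: Er_def)
  have Er: "exp r = Er" by (simp add: E Er_def C_def S_def)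
  have B: "B * B = 3/4" "B > 0" by (simp_all add: B_def)
  define cb where "cb = (\<lambda>a b c. a *\<^sub>R hvec p + b *\<^sub>R e1 + c *\<^sub>R k)"
  have mc: "mink (cb a b c) (cb a' b' c') = - (a * a') + b * b' + c * c'" for a b c a' b' c'
    by (simp add: cb_def mink_simps products k mink_commute[of "hvec p" k] mink_commute[of e1 k])
  have cadd: "cb a b c + cb a' b' c' = cb (a + a') (b + b') (c + c')"
    and cscale: "s *\<^sub>R cb a b c = cb (s * a) (s * b) (s * c)" for a b c a' b' c' s
    by (simp_all add: cb_def algebra_simps)
  have cbI: "a = a' \<Longrightarrow> b = b' \<Longrightarrow> c = c' \<Longrightarrow> cb a b c = cb a' b' c'" for a b c a' b' c'
    by simp
  have pc: "hvec p = cb 1 0 0" and e1c: "e1 = cb 0 1 0" and e2c: "e2 = cb 0 (-1/2) B"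
    and e3c: "e3 = cb 0 (-1/2) (- B)" by (simp_all add: cb_def k B_def)
  have zc: "hvec z = cb C (- S) 0" by (simp add: cb_def z C_def S_def)
  \<comment> \<open>Coordinates of \<open>u\<close> in the tangent plane at \<open>z\<close>:
    \<open>x\<close> along the ray from \<open>p\<close> through \<open>z\<close>, \<open>y\<close>
    along \<open>k\<close>.\<close>
  define x y where "x = - mink u (hvec p) / S" and "y = mink u k"
  have up: "mink u (hvec p) = - (S * x)" using C by (simp add: x_def)
  have "C * mink u (hvec p) = S * mink u e1"
    using assms(3) by (simp add: z mink_simps C_def S_def mink_commute[of _ u])
  then have "S * (mink u e1 + C * x) = 0" unfolding up by (simp add: algebra_simps)
  then have "mink u e1 + C * x = 0" using C(3) by simp
  then have ue: "mink u e1 = - (C * x)" by (simp add: eq_neg_iff_add_eq_0)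
  have uc: "u = cb (S * x) (- C * x) y"
    using ex[of u] by (simp add: up ue y_def cb_def)
  have "x * x * (C * C - S * S) + y * y = 1"
    using u(1) by (simp add: uc mc algebra_simps)
  then have xy: "x\<^sup>2 + y\<^sup>2 = 1" unfolding C(1) by (simp add: power2_eq_square)
  have "mink u (hvec p) \<le> 0" using u(2) p_mem_T by (auto simp: half_plane_def mink_commute)
  then have x0: "0 \<le> x" using C by (simp add: up zero_le_mult_iff)
  have "y * B \<ge> 0" using le by (simp add: uc e2c e3c mc)
  then have y0: "0 \<le> y" using B by (simp add: zero_le_mult_iff)
  have AB: "A * A + B * B = Er * Er"
  proof -
    have "4 * (A * A + B * B) = 4 * S * S + 4 * S * C + C * C + 3"
      by (simp add: A_def B(1) algebra_simps)
    also have "\<dots> = 4 * (C * C) + 4 * S * C + S * S" by (simp add: C(1))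
    also have "\<dots> = 4 * (Er * Er)" by (simp add: Er_def algebra_simps)
    finally show ?thesis by simp
  qed
  \<comment> \<open>The side of \<open>e2\<close> as a horocycle through \<open>z\<close>, its unit
    tangent at \<open>z\<close>, and its length up to the other end \<open>v3\<close>.\<close>
  define l m t where "l = exp (- r) *\<^sub>R (hvec p - e2)"
    and "m = cb (- (B * S / Er)) (B * C / Er) (A / Er)" and "t = 2 * S * B"
  have lc: "l = cb (1 / Er) (1 / (2 * Er)) (- (B / Er))"
    by (simp add: l_def exp_minus Er k(4) B_def cb_def algebra_simps) (simp add: field_simps)
  have h: "horo_tangent z m l"
    unfolding horo_tangent_def
  proof (intro conjI)
    show "lightlike l" unfolding l_def by (rule lightlike_side[OF unit_tangents(2)])
    show "mink (hvec z) l = -1"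
    proof -
      have "mink (hvec z) l = - ((C + S / 2) / Er)"
        by (simp add: zc lc mc add_divide_distrib)
      then show ?thesis unfolding Er_def[symmetric] using Er0 by simp
    qed
    show "mink m (hvec z) = 0" by (simp add: m_def zc mc)
    show "mink m l = 0" using Er0 by (simp add: m_def lc mc A_def field_simps)
    have "mink m m = (B * B * (C * C - S * S) + A * A) / (Er * Er)"
      by (simp add: m_def mc algebra_simps add_divide_distrib diff_divide_distrib)
    also have "\<dots> = 1" using AB Er0 unfolding C(1) by (simp add: add.commute)
    finally show "mink m m = 1" .
  qed
  obtain v3 where v3: "hvec v3 = cosh R *\<^sub>R hvec p - sinh R *\<^sub>R e3" "v3 \<in> T"
  proof -
    interpret r1: regular_triangle p e2 e3 e1 r R by (rule rotate)
    interpret r2: regular_triangle p e3 e1 e2 r R by (rule r1.rotate)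
    have "{e3, e1, e2} = {e1, e2, e3}" by auto
    then show thesis using r2.vertex that by metis
  qed
  obtain v2 where v2: "hvec v2 = cosh R *\<^sub>R hvec p - sinh R *\<^sub>R e2" "v2 \<in> T"
  proof -
    interpret r1: regular_triangle p e2 e3 e1 r R by (rule rotate)
    have "{e2, e3, e1} = {e1, e2, e3}" by auto
    then show thesis using r1.vertex that by metis
  qed
  have v3c: "hvec v3 = cb C (S / 2) (S * B)"
    by (simp add: v3(1) cb_def k(5) B_def C_def S_def algebra_simps)
  have v2c: "hvec v2 = cb C (S / 2) (- (S * B))"
    by (simp add: v2(1) cb_def k(4) B_def C_def S_def algebra_simps)
  have tt: "t\<^sup>2 / 2 = 3/2 * (S * S)" using B(1) by (simp add: t_def power2_eq_square)
  have tB: "t * B = 3/2 * S" using B(1) by (simp add: t_def)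
  have "hvec (horo z m l t) = hvec v3"
    unfolding hvec_horo[OF h]
    unfolding tt zc m_def lc v3c cscale cadd
  proof (rule cbI)
    have "t * (- (B * S / Er)) = - (t * B) * S / Er" by simp
    then show "C + t * - (B * S / Er) + 3/2 * (S * S) * (1 / Er) = C" by (simp add: tB)
    have "t * (B * C / Er) = (t * B) * C / Er" by simp
    also have "\<dots> = 3/2 * S * C / Er" by (simp add: tB)
    finally have 1: "t * (B * C / Er) = 3/2 * S * C / Er" .
    have "3/2 * S * C / Er + 3/2 * (S * S) * (1 / (2 * Er)) = 3/2 * S * (C + S / 2) / Er"
      by (simp add: add_divide_distrib distrib_left)
    also have "\<dots> = 3/2 * S" unfolding Er_def[symmetric] using Er0 by simp
    finally show "- S + t * (B * C / Er) + 3/2 * (S * S) * (1 / (2 * Er)) = S / 2"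
      unfolding 1 by linarith
    have "0 + t * (A / Er) + 3/2 * (S * S) * - (B / Er) = S * B * (2 * A - 3/2 * S) / Er"
      by (simp add: t_def diff_divide_distrib right_diff_distrib mult_ac)
    also have "2 * A - 3/2 * S = Er" by (simp add: A_def Er_def)
    finally show "0 + t * (A / Er) + 3/2 * (S * S) * - (B / Er) = S * B" using Er0 by simp
  qed
  then have "horo z m l t \<in> T" using v3(2) by (simp add: Rep_hyp2_inject)
  moreover obtain z' where "hvec z' = cosh R *\<^sub>R hvec p - sinh R *\<^sub>R e1" "z' \<in> T" using vertex by blast
  then have "z \<in> T" using z by (metis Rep_hyp2_inject)
  ultimately have arc: "horo z m l (s * t) \<in> T" if "0 \<le> s" "s \<le> 1" for s
    using horo_mem_h_convex[OF h_convex_T h] that by blast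
  \<comment> \<open>The side starts at \<open>z\<close> on the line and stays in the half-plane, so
    its initial derivative has a sign. This bounds the slope of \<open>(x, y)\<close> by that of
    \<open>(A, B)\<close>.\<close>
  have "t * mink m u \<le> 0"
  proof (rule quadratic_nonpos[of 1 _ "t\<^sup>2 / 2 * mink l u"])
    fix s :: real assume s: "0 < s" "s < 1"
    have "mink (hvec (horo z m l (s * t))) u \<le> 0"
      using arc[of s] s u(2) by (auto simp: half_plane_def)
    then show "s * (t * mink m u) + s\<^sup>2 * (t\<^sup>2 / 2 * mink l u) \<le> 0"
      by (simp add: mink_horo[OF h] assms(3) power_mult_distrib mult.assoc)
  qed simp
  then have "mink m u \<le> 0" using C B by (simp add: t_def mult_le_0_iff)
  moreover have "mink m u = (y * A - x * B * (C * C - S * S)) / Er"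
    by (simp add: m_def uc mc algebra_simps add_divide_distrib diff_divide_distrib)
  ultimately have slope: "y * A \<le> x * B" using Er0 unfolding C(1) by (simp add: divide_le_0_iff)
  define D where "D = 1 + 3/2 * S\<^sup>2"
  define cw sw where "cw = cosh (R + r)" and "sw = sinh (R + r)"
  have cwD: "cw \<le> D" using cosh_width_le by (simp add: cw_def D_def S_def)
  have D1: "D > 1" using C by (simp add: D_def)
  have sw: "sw > 0" using R r by (simp add: sw_def)
  have cw1: "cw \<ge> 1" by (simp add: cw_def cosh_real_ge_1)
  have C3: "C3 > 0" using C by (simp add: C3_def)
  have A0: "A > 0" using C by (simp add: A_def add_pos_pos)
  show ?thesis
  \<comment> \<open>Seen from \<open>z\<close>, the vertex \<open>v2\<close> lies in direction
    \<open>- (C3, B)\<close>. The case condition thus places the inner normal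
    \<open>- (x, y)\<close> between the axis and \<open>v2\<close>.\<close>
  proof (cases "y * C3 \<le> x * B")
    case True
    have rel: "A * C3 - B\<^sup>2 = 3/2 * S * Er" "C3\<^sup>2 + B\<^sup>2 = 3/2 * (D + 1)" "3/2 * S\<^sup>2 = D - 1"
      using C(1) B(1) by (simp_all add: A_def C3_def Er_def D_def power2_eq_square algebra_simps)
    have sw2: "sw\<^sup>2 = (cw - 1) * (cw + 1)"
      using hyperbolic_pythagoras[of "R + r"] by (simp add: cw_def sw_def power2_eq_square algebra_simps)
    have bound: "Er * (cw - 1) \<le> sw * (A * x - B * y)"
      using tanh_half_bound[OF xy x0 y0 True C3 _ Er0 C(3) D1 _ cw1 rel cwD sw2] B sw by simp
    have "sw * (A * x - B * y) \<le> sw * (A * x + B * y)"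
      using sw B y0 by (intro mult_left_mono) auto
    then have bound': "Er * (cw - 1) \<le> sw * (A * x + B * y)" using bound by linarith
    have uz: "mink (- u) (hvec z) = 0" "mink (- u) (- u) = 1"
      using assms(3) u(1) by (simp_all add: mink_commute)
    obtain q where q: "hvec q = cw *\<^sub>R hvec z + sw *\<^sub>R (- u)"
      using obtain_exp[OF uz, of "R + r"] by (auto simp: cw_def sw_def)
    have qc: "hvec q = cb (cw * C - sw * (S * x)) (- (cw * S) + sw * (C * x)) (- (sw * y))"
      by (simp add: q zc uc cb_def algebra_simps)
    have x1: "x \<le> 1"
    proof -
      have "x\<^sup>2 \<le> 1\<^sup>2" using xy zero_le_power2[of y] unfolding one_power2 by linarith
      then show ?thesis by (rule power2_le_imp_le) simp
    qed
    have "q \<in> T"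
      unfolding mem_T
    proof (intro conjI)
      have "- mink (hvec q) (hvec p) + mink (hvec q) e1 = (C - S) * (cw + sw * x)"
        by (simp add: qc pc e1c mc algebra_simps)
      also have "\<dots> \<le> (C - S) * (cw + sw * 1)"
        using x1 sw cosh_minus_sinh[of R] by (intro mult_left_mono add_left_mono) (auto simp: C_def S_def)
      also have "\<dots> = (C - S) * exp (R + r)" by (simp add: cw_def sw_def cosh_plus_sinh)
      also have "\<dots> = (C * C - S * S) * Er"
        unfolding width_exp C_def[symmetric] S_def[symmetric] Er_def[symmetric] by (simp add: algebra_simps)
      finally show "- mink (hvec q) (hvec p) + mink (hvec q) e1 \<le> exp r"
        unfolding C(1) by (simp add: Er)
      have "- mink (hvec q) (hvec p) + mink (hvec q) e2 = Er * cw - sw * (A * x + B * y)"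
        by (simp add: qc pc e2c mc Er_def A_def algebra_simps)
      then show "- mink (hvec q) (hvec p) + mink (hvec q) e2 \<le> exp r"
        using bound' by (simp add: Er algebra_simps)
      have "- mink (hvec q) (hvec p) + mink (hvec q) e3 = Er * cw - sw * (A * x - B * y)"
        by (simp add: qc pc e3c mc Er_def A_def algebra_simps)
      then show "- mink (hvec q) (hvec p) + mink (hvec q) e3 \<le> exp r"
        using bound by (simp add: Er algebra_simps)
    qed
    moreover have "- mink (hvec q) u = sw" by (simp add: q mink_simps assms(3) u(1))
    ultimately show ?thesis unfolding sw_def by (metis order_refl)
  next
    case False
    have AC3: "A \<le> C3"
      using C cosh_minus_sinh[of R] exp_gt_zero[of "- R"] unfolding A_def C3_def C_def S_def by linarith
    have sec: "(A * C3 + B\<^sup>2) / Er \<le> x * C3 + y * B"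
      using sector_inner_bound[OF xy x0 y0 _ slope C3 B(2) A0 Er0 AC3] False AB
      by (simp add: power2_eq_square)
    have "- mink (hvec v2) u = S * (x * C3 + y * B)"
      by (simp add: v2c uc mc C3_def algebra_simps)
    moreover have "S * ((A * C3 + B\<^sup>2) / Er) \<le> S * (x * C3 + y * B)"
      using sec C by (intro mult_left_mono) auto
    \<comment> \<open>As \<open>(C - S) / Er = exp (- (R + r))\<close>, the bound for
      \<open>v2\<close> becomes \<open>D - exp (- (R + r))\<close>, which by \<open>cwD\<close> is
      at least \<open>cosh (R + r) - exp (- (R + r)) = sinh (R + r)\<close>.\<close>
    moreover have "S * ((A * C3 + B\<^sup>2) / Er) = D - (C - S) / Er"
    proof -
      have "S * (A * C3 + B\<^sup>2) = D * Er - (C - S)"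
      proof -
        have "4 * (S * (A * C3 + B\<^sup>2)) = 6 * S * S * C + 3 * S * (C * C) + 3 * S"
          by (simp add: A_def C3_def power2_eq_square B(1) algebra_simps)
        also have "\<dots> = 4 * (D * Er - (C - S))"
          unfolding C(1) by (simp add: D_def Er_def power2_eq_square algebra_simps)
        finally show ?thesis by simp
      qed
      then show ?thesis using Er0 by (simp add: diff_divide_distrib)
    qed
    moreover have "sw = cw - (C - S) / Er"
      unfolding sw_def cw_def width_exp Er_def C_def S_def by (simp add: field_simps)
    ultimately have "sw \<le> - mink (hvec v2) u" using cwD by linarith
    then show ?thesis using v2(2) by (auto simp: sw_def)
  qed
qed

lemma support_at_vertex':
  assumes u: "mink u u = 1" "T \<subseteq> half_plane u" and x: "mink (hvec z) u = 0"
    and z: "hvec z = cosh R *\<^sub>R hvec p - sinh R *\<^sub>R e1"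
  shows "\<exists>y\<in>T. sinh (R + r) \<le> - mink (hvec y) u"
proof (cases "mink u e3 \<le> mink u e2")
  case True
  then show ?thesis using support_at_vertex[OF u x z] by blast
next
  case False
  interpret sw: regular_triangle p e1 e3 e2 r R by (rule swap)
  have "{e1, e3, e2} = {e1, e2, e3}" by auto
  then show ?thesis using sw.support_at_vertex[of u z] u x z False by auto
qed

lemma support_width:
  assumes u: "mink u u = 1" "T \<subseteq> half_plane u" and x: "x \<in> T" "mink (hvec x) u = 0"
  shows "\<exists>y\<in>T. sinh (R + r) \<le> - mink (hvec y) u"
proof -
  interpret r1: regular_triangle p e2 e3 e1 r R by (rule rotate)
  interpret r2: regular_triangle p e3 e1 e2 r R by (rule r1.rotate)
  have rot: "{e2, e3, e1} = {e1, e2, e3}" "{e3, e1, e2} = {e1, e2, e3}" by auto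
  define g where "g = (\<lambda>e. - mink (hvec x) (hvec p) + mink (hvec x) e)"
  have g: "g e1 \<le> exp r" "g e2 \<le> exp r" "g e3 \<le> exp r" using x(1) by (simp_all add: mem_T g_def)
  note act = g_def[THEN fun_cong, symmetric]
  consider "g e2 = exp r" "g e3 = exp r" | "g e3 = exp r" "g e1 = exp r" | "g e1 = exp r" "g e2 = exp r"
    | "g e1 = exp r" "g e2 < exp r" "g e3 < exp r" | "g e2 = exp r" "g e3 < exp r" "g e1 < exp r"
    | "g e3 = exp r" "g e1 < exp r" "g e2 < exp r" | "g e1 < exp r" "g e2 < exp r" "g e3 < exp r"
    using g unfolding order_le_less by blast
  then show ?thesis
  proof cases
    case 1
    then show ?thesis using support_at_vertex'[OF u x(2) two_active[OF x(1)]] unfolding act by auto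
  next
    case 2
    then show ?thesis using r1.support_at_vertex'[OF u(1) _ x(2) r1.two_active] u(2) x(1) unfolding act rot by auto
  next
    case 3
    then show ?thesis using r2.support_at_vertex'[OF u(1) _ x(2) r2.two_active] u(2) x(1) unfolding act rot by auto
  next
    case 4
    then show ?thesis using support_on_side[OF u x(2)] unfolding act by auto
  next
    case 5
    then show ?thesis using r1.support_on_side[OF u(1) _ x(2)] u(2) unfolding act rot by auto
  next
    case 6
    then show ?thesis using r2.support_on_side[OF u(1) _ x(2)] u(2) unfolding act rot by auto
  next
    case 7
    then show ?thesis using support_not_interior[OF u x(2)] unfolding act by auto
  qed
qed

lemma minimal_width_T: "minimal_lassak_width T = R + r"
proof (rule antisym)
  have third: "(1/3) *\<^sub>R e1 + (1/3) *\<^sub>R e2 + (1/3) *\<^sub>R e3 = 0"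
    using sum_zero by (simp flip: scaleR_add_right)
  show "minimal_lassak_width T \<le> R + r"
    by (rule contact_width_bound(1)[OF compact_T cball_subset_T order_refl unit_tangents _ _ _ _ third _ r R E])
      (simp_all add: products)
  have "T \<subseteq> horo_polygon p {e1} r" by (auto simp: horo_polygon_def)
  then have ne: "{H. supporting_line T H} \<noteq> {}"
    using contact_supporting_line[OF unit_tangents(1) r cball_subset_T] by blast
  show "R + r \<le> minimal_lassak_width T"
    unfolding minimal_lassak_width_def
  proof (rule cINF_greatest[OF ne])
    fix H assume "H \<in> {H. supporting_line T H}"
    then obtain u where u: "mink u u = 1" "H = line u" "H \<inter> T \<noteq> {}" "T \<subseteq> half_plane u"
      using supporting_lineE[of T H] by (metis mem_Collect_eq)
    then obtain x where "x \<in> T" "mink (hvec x) u = 0" by (auto simp: line_def)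
    then obtain y where y: "y \<in> T" "sinh (R + r) \<le> - mink (hvec y) u"
      using support_width[OF u(1,4)] by blast
    have "sinh (R + r) \<le> sinh (infdist y H)"
      using y(2) sinh_infdist_line[OF u(1), of y] by (simp add: u(2))
    then have "R + r \<le> infdist y H" by simp
    then show "R + r \<le> lassak_width T H"
      using le_lassak_width[OF compact_T y(1), of H] by linarith
  qed
qed

end

section \<open>Congruence and existence of regular triangles\<close>

lemma regular_triangle_edge_radius:
  fixes r :: real
  assumes "r > 0"
  obtains R where "R > 0" "exp r = cosh R + sinh R / 2"
proof -
  define h where "h = (\<lambda>R :: real. cosh R + sinh R / 2)"
  have "continuous_on {0..r + 1} h" unfolding h_def by (intro continuous_intros) auto
  moreover have "h 0 \<le> exp r" using assms by (simp add: h_def)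
  moreover have "exp r \<le> h (r + 1)"
  proof -
    have "2 \<le> exp (1::real)" using exp_ge_add_one_self[of 1] by simp
    then have "2 * exp r \<le> exp (r + 1)" by (simp add: exp_add)
    also have "\<dots> \<le> 2 * h (r + 1)"
      using assms exp_gt_zero[of "- (r + 1)"] by (simp add: h_def cosh_field_def sinh_field_def field_simps)
    finally show ?thesis by simp
  qed
  ultimately obtain R where R: "0 \<le> R" "h R = exp r"
    using IVT'[of h 0 "exp r" "r + 1"] assms by auto
  have "R \<noteq> 0"
  proof
    assume "R = 0"
    then have "exp r = 1" using R(2) by (simp add: h_def)
    then show False using assms by simp
  qed
  then show thesis using that[of R] R by (simp add: h_def)
qed

lemma edge_radius_mono:
  fixes R R' :: real
  assumes "0 \<le> R" "R < R'"
  shows "cosh R + sinh R / 2 < cosh R' + sinh R' / 2"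
proof -
  have "cosh R < cosh R'" using assms by (simp add: cosh_real_nonneg_less_iff)
  moreover have "sinh R < sinh R'" using assms by simp
  ultimately show ?thesis by linarith
qed

text \<open>The width as a function \<open>h\<close> of \<open>R\<close> alone is continuous,
  vanishes at 0 and satisfies \<open>h w \<ge> w\<close>, as the logarithm in it is
  nonnegative.\<close>

lemma width_parameters:
  fixes w :: real
  assumes "w > 0"
  obtains R r where "R > 0" "r > 0" "exp r = cosh R + sinh R / 2" "R + r = w"
proof -
  define h where "h = (\<lambda>R :: real. R + ln (cosh R + sinh R / 2))"
  have pos: "cosh R + sinh R / 2 \<ge> 1" if "R \<ge> 0" for R :: real
    using that cosh_real_ge_1[of R] by (simp add: add_increasing2)
  have "continuous_on {0..w} h"
    unfolding h_def by (intro continuous_intros) (use pos in force)+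
  moreover have "h 0 \<le> w" using assms by (simp add: h_def)
  moreover have "w \<le> h w" using pos[of w] assms by (simp add: h_def)
  ultimately obtain R where R: "0 \<le> R" "h R = w"
    using IVT'[of h 0 w w] assms by auto
  then have R0: "R > 0" using assms by (cases "R = 0") (auto simp: h_def)
  define r where "r = ln (cosh R + sinh R / 2)"
  have "1 < cosh R + sinh R / 2" using edge_radius_mono[of 0 R] R0 by simp
  then have "r > 0" "exp r = cosh R + sinh R / 2" by (simp_all add: r_def)
  then show thesis using that[of R r] R0 R(2) by (simp add: h_def r_def)
qed

lemma tripod_exists: "\<exists>p e1 e2 e3. tripod p e1 e2 e3"
proof -
  define p where "p = Abs_hyp2 (0, 1)"
  have p: "hvec p = (0, 1)"
    unfolding p_def by (rule Abs_hyp2_inverse) (simp add: mink_coords)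
  have "tripod p (1, 0) (Complex (-1/2) (sqrt 3 / 2), 0) (Complex (-1/2) (- sqrt 3 / 2), 0)"
    by (simp add: tripod_def unit_tangent_def p mink_coords)
  then show ?thesis by blast
qed

text \<open>A map preserving \<open>mink\<close> may exchange the sheets; the condition at
  \<open>p\<close> excludes this, since the product with \<open>hvec q\<close> decides the sheet.
  The right inverse \<open>\<psi>\<close> gives surjectivity.\<close>

lemma hyp2_congruentI:
  fixes \<phi> :: "complex \<times> real \<Rightarrow> complex \<times> real"
  assumes \<phi>: "\<And>v w. mink (\<phi> v) (\<phi> w) = mink v w" and \<phi>p: "\<phi> (hvec p) = hvec q"
    and \<psi>: "\<And>v. \<phi> (\<psi> v) = v"
    and A: "\<And>x y. hvec y = \<phi> (hvec x) \<Longrightarrow> x \<in> A \<longleftrightarrow> y \<in> B"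
  shows "hyp2_congruent A B"
proof -
  have "\<exists>y. hvec y = \<phi> (hvec x)" for x
    using obtain_hyp2[of "\<phi> (hvec x)" q] \<phi>[of "hvec x" "hvec x"] \<phi>[of "hvec x" "hvec p"]
      mink_Rep_neg[of x p] \<phi>p by (metis mink_Rep_self)
  then obtain f where f: "\<And>x. hvec (f x) = \<phi> (hvec x)" by metis
  have dist: "dist (f x) (f y) = dist x y" for x y
    by (simp add: dist_hyp2_def f \<phi>)
  have inj: "inj f"
    by (rule injI) (metis dist dist_eq_0_iff)
  have "\<exists>x. f x = y" for y
  proof -
    have "mink (\<psi> (hvec y)) (\<psi> (hvec y)) = -1"
      using \<phi>[of "\<psi> (hvec y)" "\<psi> (hvec y)"] by (simp add: \<psi>)
    moreover have "mink (\<psi> (hvec y)) (hvec p) < 0"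
      using \<phi>[of "\<psi> (hvec y)" "hvec p"] mink_Rep_neg[of y q] by (simp add: \<psi> \<phi>p)
    ultimately obtain x where "hvec x = \<psi> (hvec y)" using obtain_hyp2 by metis
    then have "hvec (f x) = hvec y" by (simp add: f \<psi>)
    then show ?thesis by (auto simp: Rep_hyp2_inject)
  qed
  then have surj: "surj f" by (metis surjI surj_def)
  have "f ` A = B"
  proof
    show "f ` A \<subseteq> B" using A f by blast
    show "B \<subseteq> f ` A"
    proof
      fix y assume "y \<in> B"
      obtain x where "f x = y" using surj by (metis surjD)
      then show "y \<in> f ` A" using A[OF f, of x] \<open>y \<in> B\<close> by blast
    qed
  qed
  then show ?thesis
    unfolding hyp2_congruent_def using dist inj surj by (metis bijI)
qed

lemma regular_triangles_congruent:
  assumes "regular_triangle p e1 e2 e3 r R" "regular_triangle q f1 f2 f3 r R"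
  shows "hyp2_congruent (horo_polygon p {e1, e2, e3} r) (horo_polygon q {f1, f2, f3} r)"
proof -
  interpret e: regular_triangle p e1 e2 e3 r R by fact
  interpret f: regular_triangle q f1 f2 f3 r R by fact
  obtain k where k: "mink k (hvec p) = 0" "mink k e1 = 0" "mink k k = 1"
    "e2 = (-1/2) *\<^sub>R e1 + (sqrt 3 / 2) *\<^sub>R k" "e3 = (-1/2) *\<^sub>R e1 - (sqrt 3 / 2) *\<^sub>R k"
    and ek: "\<And>v. v = (- mink v (hvec p)) *\<^sub>R hvec p + mink v e1 *\<^sub>R e1 + mink v k *\<^sub>R k"
    using e.basis by metis
  obtain j where j: "mink j (hvec q) = 0" "mink j f1 = 0" "mink j j = 1"
    "f2 = (-1/2) *\<^sub>R f1 + (sqrt 3 / 2) *\<^sub>R j" "f3 = (-1/2) *\<^sub>R f1 - (sqrt 3 / 2) *\<^sub>R j"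
    and fj: "\<And>v. v = (- mink v (hvec q)) *\<^sub>R hvec q + mink v f1 *\<^sub>R f1 + mink v j *\<^sub>R j"
    using f.basis by metis
  define \<phi> where "\<phi> = (\<lambda>v. (- mink v (hvec p)) *\<^sub>R hvec q + mink v e1 *\<^sub>R f1 + mink v k *\<^sub>R j)"
  define \<psi> where "\<psi> = (\<lambda>v. (- mink v (hvec q)) *\<^sub>R hvec p + mink v f1 *\<^sub>R e1 + mink v j *\<^sub>R k)"
  have kc: "mink (hvec p) k = 0" "mink e1 k = 0" "mink (hvec q) j = 0" "mink f1 j = 0"
    using k j by (simp_all add: mink_commute)
  note pr = e.products f.products k(1-3) j(1-3) kc
  have coords: "mink (\<phi> v) (hvec q) = mink v (hvec p)" "mink (\<phi> v) f1 = mink v e1"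
    "mink (\<phi> v) j = mink v k" for v
    by (simp_all add: \<phi>_def mink_simps pr)
  show ?thesis
  proof (rule hyp2_congruentI[where \<phi> = \<phi> and \<psi> = \<psi> and p = p and q = q])
    fix v w
    have "mink v w = mink v ((- mink w (hvec p)) *\<^sub>R hvec p + mink w e1 *\<^sub>R e1 + mink w k *\<^sub>R k)"
      by (subst ek[of w]) simp
    also have "\<dots> = mink (\<phi> v) ((- mink w (hvec p)) *\<^sub>R hvec q + mink w e1 *\<^sub>R f1 + mink w k *\<^sub>R j)"
      unfolding mink_simps coords ..
    finally show "mink (\<phi> v) (\<phi> w) = mink v w" by (simp add: \<phi>_def)
    show "\<phi> (hvec p) = hvec q" by (simp add: \<phi>_def pr)
    have "mink (\<psi> v) (hvec p) = mink v (hvec q)" "mink (\<psi> v) e1 = mink v f1" "mink (\<psi> v) k = mink v j"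
      by (simp_all add: \<psi>_def mink_simps pr)
    then show "\<phi> (\<psi> v) = v" unfolding \<phi>_def using fj[of v] by simp
  next
    fix x y assume y: "hvec y = \<phi> (hvec x)"
    have "mink (hvec y) f2 = mink (hvec x) e2" "mink (hvec y) f3 = mink (hvec x) e3"
      unfolding y j(4,5) k(4,5) by (simp_all add: mink_simps coords)
    then show "x \<in> horo_polygon p {e1, e2, e3} r \<longleftrightarrow> y \<in> horo_polygon q {f1, f2, f3} r"
      unfolding e.mem_T f.mem_T by (simp add: y coords)
  qed
qed

section \<open>Agreement with the definition by angles and tangent horoballs\<close>

lemma direction_exp:
  assumes n: "unit_tangent p n" and z: "hvec z = cosh r *\<^sub>R hvec p + sinh r *\<^sub>R n"
  shows "direction p z = sinh r *\<^sub>R n"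
  using unit_tangentD[OF n] by (simp add: direction_def z mink_simps)

lemma angle_at_exp:
  assumes m: "unit_tangent p m" and n: "unit_tangent p n" and r: "r > 0"
    and x: "hvec x = cosh r *\<^sub>R hvec p + sinh r *\<^sub>R m" and y: "hvec y = cosh r *\<^sub>R hvec p + sinh r *\<^sub>R n"
  shows "angle_at p x y = 2 * pi / 3 \<longleftrightarrow> mink m n = -1/2"
proof -
  have s: "sinh r > 0" using r by simp
  have "angle_at p x y = arccos (sinh r * sinh r * mink m n / (sqrt (sinh r * sinh r) * sqrt (sinh r * sinh r)))"
    using unit_tangentD[OF m] unit_tangentD[OF n]
    by (simp add: angle_at_def direction_exp[OF m x] direction_exp[OF n y] mink_simps Let_def)
  also have "\<dots> = arccos (mink m n)" using s by simp
  finally have eq: "angle_at p x y = arccos (mink m n)" .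
  have "(mink m n)\<^sup>2 \<le> 1"
    using mink_orthogonal_Cauchy_Schwarz[of m p n] m n by (simp add: unit_tangent_def)
  then have b: "-1 \<le> mink m n" "mink m n \<le> 1" by (simp_all add: abs_square_le_1 abs_le_iff)
  have "cos (2 * pi / 3) = (-1/2 :: real)" by (simp add: cos_120)
  then have "arccos (-1/2) = 2 * pi / 3" using arccos_cos[of "2 * pi / 3"] by simp
  then show ?thesis
    unfolding eq using b cos_arccos[of "mink m n"] \<open>cos (2 * pi / 3) = -1/2\<close> by metis
qed

lemma sphere_exp:
  assumes "z \<in> sphere p r" "r > 0"
  obtains n where "unit_tangent p n" "hvec z = cosh r *\<^sub>R hvec p + sinh r *\<^sub>R n"
proof -
  have "p \<noteq> z" "dist p z = r" using assms by auto
  then show thesis using obtain_direction[of p z] that by (metis unit_tangent_def)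
qed

lemma exp_sphere:
  assumes "unit_tangent p n" "hvec z = cosh r *\<^sub>R hvec p + sinh r *\<^sub>R n" "r > 0"
  shows "z \<in> sphere p r"
proof -
  have "cosh (dist p z) = cosh r"
    using unit_tangentD[OF assms(1)] by (simp add: cosh_dist_hyp2 assms(2) mink_simps)
  then have "dist p z = r" by (metis arcosh_cosh_real assms(3) less_imp_le zero_le_dist)
  then show ?thesis by simp
qed

text \<open>Write \<open>l = c *\<^sub>R (hvec p - f)\<close>. Containing the disk means
  \<open>c \<le> exp (- r)\<close>, and passing through \<open>z\<close> means
  \<open>c * (cosh r + sinh r * mink n f) = 1\<close>; as \<open>mink n f \<le> 1\<close>, both are
  sharp, so \<open>c = exp (- r)\<close> and \<open>f = n\<close>.\<close>

lemma tangent_horoball_iff: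
  assumes n: "unit_tangent p n" and z: "hvec z = cosh r *\<^sub>R hvec p + sinh r *\<^sub>R n" and r: "r > 0"
  shows "tangent_horoball p r z B \<longleftrightarrow> B = horoball (exp (- r) *\<^sub>R (hvec p - n))"
proof
  note N = unit_tangentD[OF n]
  assume "tangent_horoball p r z B"
  then obtain l where l: "lightlike l" "B = horoball l" "cball p r \<subseteq> B" "horocycle l \<inter> sphere p r = {z}"
    by (auto simp: tangent_horoball_def)
  define c where "c = - mink (hvec p) l"
  obtain f where f: "mink f (hvec p) = 0" "mink f f = 1" and lf: "l = c *\<^sub>R (hvec p - f)"
    using lightlike_decompose[OF l(1), of p] by (metis c_def)
  have c0: "c > 0" using lightlike_neg[OF l(1)] by (simp add: c_def)
  have cle: "c \<le> exp (- r)"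
    using cball_subset_horoball[OF l(1), of r p] l(2,3) r by (simp add: c_def)
  have "mink (hvec z) l = -1" using l(4) by (auto simp: horocycle_def)
  then have eq: "c * (cosh r + sinh r * mink n f) = 1"
    using N f by (simp add: lf z mink_simps mink_commute[of "hvec p" f] algebra_simps)
  have "(mink n f)\<^sup>2 \<le> 1"
    using mink_orthogonal_Cauchy_Schwarz[of n p f] N f by simp
  then have b: "mink n f \<le> 1" by (simp add: abs_square_le_1 abs_le_iff)
  have s: "sinh r > 0" using r by simp
  have "c * (cosh r + sinh r * mink n f) \<le> c * (cosh r + sinh r * 1)"
    using b c0 s by (intro mult_left_mono add_left_mono) auto
  also have "\<dots> = c * exp r" by (simp add: cosh_plus_sinh)
  finally have "1 \<le> c * exp r" using eq by simp
  moreover have "c * exp r \<le> exp (- r) * exp r" using cle by (intro mult_right_mono) auto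
  ultimately have "c * exp r = exp (- r) * exp r" by (simp flip: exp_add)
  then have c: "c = exp (- r)" by simp
  then have "c * exp r = 1" by (simp add: exp_minus)
  then have "c * (cosh r + sinh r * mink n f) = c * exp r" using eq by simp
  then have "cosh r + sinh r * mink n f = exp r" using c0 by (metis mult_left_cancel less_irrefl)
  then have "mink n f = 1" using s by (simp flip: cosh_plus_sinh)
  then have "mink (n - f) (n - f) = 0" using N f by (simp add: mink_simps mink_commute[of f n])
  moreover have "mink (n - f) (hvec p) = 0" using N f by (simp add: mink_simps)
  ultimately have "n - f = 0" using mink_orthogonal_nonneg(2) by blast
  then show "B = horoball (exp (- r) *\<^sub>R (hvec p - n))" using l(2) lf c by simp
next
  note N = unit_tangentD[OF n]
  define l where "l = exp (- r) *\<^sub>R (hvec p - n)"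
  assume B: "B = horoball (exp (- r) *\<^sub>R (hvec p - n))"
  have ll: "lightlike l" using lightlike_tangent[of n p "exp (- r)"] N by (simp add: l_def)
  moreover have "cball p r \<subseteq> horoball l"
    using cball_subset_horoball[OF ll, of r p] r N by (simp add: l_def mink_simps)
  moreover have "horocycle l \<inter> sphere p r = {z}"
  proof (intro equalityI subsetI)
    fix x assume x: "x \<in> horocycle l \<inter> sphere p r"
    have xp: "mink (hvec x) (hvec p) = - cosh r"
      using x cosh_dist_hyp2[of x p] by (auto simp: dist_commute)
    have "exp (- r) * (cosh r + mink (hvec x) n) = 1"
      using x by (simp add: horocycle_def l_def mink_simps xp algebra_simps)
    then have "cosh r + mink (hvec x) n = cosh r + sinh r"
      unfolding cosh_plus_sinh by (simp add: exp_minus field_simps)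
    then have "mink (hvec x) (hvec z) = -1"
      using hyperbolic_pythagoras[of r] by (simp add: z mink_simps xp power2_eq_square)
    then show "x \<in> {z}" by (simp add: mink_Rep_eq_iff)
  next
    fix x assume "x \<in> {z}"
    have "mink (hvec z) l = - (exp (- r) * (cosh r + sinh r))"
      using N by (simp add: l_def z mink_simps algebra_simps)
    also have "\<dots> = -1" unfolding cosh_plus_sinh by (simp flip: exp_add)
    finally show "x \<in> horocycle l \<inter> sphere p r"
      using \<open>x \<in> {z}\<close> exp_sphere[OF n z r] by (simp add: horocycle_def)
  qed
  ultimately show "tangent_horoball p r z B"
    unfolding tangent_horoball_def B l_def[symmetric] by blast
qed

lemma regular_horocyclic_triangle_iff:
  "regular_horocyclic_triangle T \<longleftrightarrow>
    (\<exists>p e1 e2 e3 r. r > 0 \<and> tripod p e1 e2 e3 \<and> T = horo_polygon p {e1, e2, e3} r)"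
proof
  assume "regular_horocyclic_triangle T"
  then obtain p r z1 z2 z3 B1 B2 B3 where r: "r > 0"
    and z: "z1 \<in> sphere p r" "z2 \<in> sphere p r" "z3 \<in> sphere p r"
    and ang: "angle_at p z1 z2 = 2 * pi / 3" "angle_at p z2 z3 = 2 * pi / 3" "angle_at p z3 z1 = 2 * pi / 3"
    and B: "tangent_horoball p r z1 B1" "tangent_horoball p r z2 B2" "tangent_horoball p r z3 B3"
    and T: "T = B1 \<inter> B2 \<inter> B3"
    unfolding regular_horocyclic_triangle_def by blast
  obtain e1 where e1: "unit_tangent p e1" "hvec z1 = cosh r *\<^sub>R hvec p + sinh r *\<^sub>R e1"
    using sphere_exp[OF z(1) r] .
  obtain e2 where e2: "unit_tangent p e2" "hvec z2 = cosh r *\<^sub>R hvec p + sinh r *\<^sub>R e2"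
    using sphere_exp[OF z(2) r] .
  obtain e3 where e3: "unit_tangent p e3" "hvec z3 = cosh r *\<^sub>R hvec p + sinh r *\<^sub>R e3"
    using sphere_exp[OF z(3) r] .
  have "tripod p e1 e2 e3"
    using ang angle_at_exp[OF e1(1) e2(1) r e1(2) e2(2)] angle_at_exp[OF e2(1) e3(1) r e2(2) e3(2)]
      angle_at_exp[OF e3(1) e1(1) r e3(2) e1(2)] e1(1) e2(1) e3(1) by (simp add: tripod_def)
  moreover have "T = horo_polygon p {e1, e2, e3} r"
    using B unfolding T tangent_horoball_iff[OF e1 r] tangent_horoball_iff[OF e2 r] tangent_horoball_iff[OF e3 r]
    by (auto simp: horo_polygon_def horoball_exp_iff)
  ultimately show "\<exists>p e1 e2 e3 r. r > 0 \<and> tripod p e1 e2 e3 \<and> T = horo_polygon p {e1, e2, e3} r"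
    using r by blast
next
  assume "\<exists>p e1 e2 e3 r. r > 0 \<and> tripod p e1 e2 e3 \<and> T = horo_polygon p {e1, e2, e3} r"
  then obtain p e1 e2 e3 r where r: "r > 0" and tri: "tripod p e1 e2 e3"
    and T: "T = horo_polygon p {e1, e2, e3} r" by blast
  have e: "unit_tangent p e1" "unit_tangent p e2" "unit_tangent p e3" using tri by (auto simp: tripod_def)
  have "\<exists>z. hvec z = cosh r *\<^sub>R hvec p + sinh r *\<^sub>R f" if "unit_tangent p f" for f
    using that obtain_exp[of f p r] by (metis unit_tangent_def)
  then obtain z1 z2 z3 where z1: "hvec z1 = cosh r *\<^sub>R hvec p + sinh r *\<^sub>R e1"
    and z2: "hvec z2 = cosh r *\<^sub>R hvec p + sinh r *\<^sub>R e2" and z3: "hvec z3 = cosh r *\<^sub>R hvec p + sinh r *\<^sub>R e3"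
    using e by metis
  define H where "H = (\<lambda>f. horoball (exp (- r) *\<^sub>R (hvec p - f)))"
  have "T = H e1 \<inter> H e2 \<inter> H e3"
    unfolding T H_def by (auto simp: horo_polygon_def horoball_exp_iff)
  moreover have "tangent_horoball p r z1 (H e1)" "tangent_horoball p r z2 (H e2)" "tangent_horoball p r z3 (H e3)"
    unfolding H_def tangent_horoball_iff[OF e(1) z1 r] tangent_horoball_iff[OF e(2) z2 r]
      tangent_horoball_iff[OF e(3) z3 r] by auto
  moreover have "angle_at p z1 z2 = 2 * pi / 3" "angle_at p z2 z3 = 2 * pi / 3" "angle_at p z3 z1 = 2 * pi / 3"
    using tri angle_at_exp[OF e(1,2) r z1 z2] angle_at_exp[OF e(2,3) r z2 z3] angle_at_exp[OF e(3,1) r z3 z1]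
    by (simp_all add: tripod_def)
  moreover have "z1 \<in> sphere p r" "z2 \<in> sphere p r" "z3 \<in> sphere p r"
    using exp_sphere[OF e(1) z1 r] exp_sphere[OF e(2) z2 r] exp_sphere[OF e(3) z3 r] by auto
  ultimately show "regular_horocyclic_triangle T"
    unfolding regular_horocyclic_triangle_def using r by blast
qed

text \<open>A point outside of \<open>K\<close> is cut off by a horoball containing
  \<open>K\<close>; this horoball contains the vertices, hence all of \<open>T\<close>.\<close>

lemma (in regular_triangle) T_subset_h_convex:
  assumes K: "compact K" "h_convex K"
    and v: "\<And>e. e \<in> {e1, e2, e3} \<Longrightarrow> \<exists>x\<in>K. hvec x = cosh R *\<^sub>R hvec p - sinh R *\<^sub>R e"
  shows "T \<subseteq> K"
proof (rule ccontr)
  assume "\<not> T \<subseteq> K"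
  then obtain x where x: "x \<in> T" "x \<notin> K" by blast
  have "K \<noteq> {}" using v[of e1] by auto
  then obtain l where l: "lightlike l" "K \<subseteq> horoball l" "x \<notin> horoball l"
    using h_convex_separation[OF K _ x(2)] by metis
  have "T \<subseteq> horoball l"
    using v l(2) by (intro T_subset_horoball[OF l(1)]) blast
  then show False using x(1) l(3) by blast
qed

section \<open>Comparison of inradii and uniqueness\<close>

lemma inradius_pos:
  assumes "h_convex_body K"
  shows "inradius K > 0"
  using incenter[OF assms] by metis

theorem theorem4p6:
  fixes w :: real
  assumes "w > 0"
  shows "(\<exists>T. regular_horocyclic_triangle T \<and> minimal_lassak_width T = w) \<and>
    (\<forall>T. regular_horocyclic_triangle T \<and> minimal_lassak_width T = w \<longrightarrow>
      h_convex_body T \<and>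
      (\<forall>K. h_convex_body K \<and> minimal_lassak_width K \<ge> w \<longrightarrow>
        inradius T \<le> inradius K \<and>
        (inradius K = inradius T \<longrightarrow> hyp2_congruent K T)))"
proof (intro conjI allI impI)
  obtain R r where Rr: "R > 0" "r > 0" "exp r = cosh R + sinh R / 2" "R + r = w"
    using width_parameters[OF assms] .
  obtain p e1 e2 e3 where "tripod p e1 e2 e3" using tripod_exists by metis
  then interpret regular_triangle p e1 e2 e3 r R
    using Rr by unfold_locales
  show "\<exists>T. regular_horocyclic_triangle T \<and> minimal_lassak_width T = w"
    using minimal_width_T Rr tripod by (metis regular_horocyclic_triangle_iff)
next
  fix T assume T: "regular_horocyclic_triangle T \<and> minimal_lassak_width T = w"
  then obtain p e1 e2 e3 r where r: "r > 0" and tri: "tripod p e1 e2 e3"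
    and Teq: "T = horo_polygon p {e1, e2, e3} r"
    by (metis regular_horocyclic_triangle_iff)
  obtain R where R: "R > 0" "exp r = cosh R + sinh R / 2" using regular_triangle_edge_radius[OF r] .
  interpret t: regular_triangle p e1 e2 e3 r R using r tri R by unfold_locales
  have w: "w = R + r" using T t.minimal_width_T by (simp add: Teq)
  show "h_convex_body T" unfolding Teq by (rule t.h_convex_body_T)
  fix K assume K: "h_convex_body K \<and> minimal_lassak_width K \<ge> w"
  then have KB: "h_convex_body K" and Kw: "R + r \<le> minimal_lassak_width K" by (auto simp: w)
  obtain R' where R': "R' > 0" "exp (inradius K) = cosh R' + sinh R' / 2"
    using regular_triangle_edge_radius[OF inradius_pos[OF KB]] .
  have sum: "R + r \<le> R' + inradius K"
    using Kw inscribed_width_bound(1)[OF KB R'] by linarith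
  have Tr: "inradius T = r" unfolding Teq by (rule t.inradius_T)
  \<comment> \<open>A smaller inradius of \<open>K\<close> would require \<open>R' > R\<close> by
    \<open>sum\<close>, but inradius and vertex distance increase together.\<close>
  show "inradius T \<le> inradius K"
  proof (rule ccontr)
    assume "\<not> inradius T \<le> inradius K"
    then have lt: "inradius K < r" by (simp add: Tr)
    then have "R < R'" using sum by linarith
    then have "exp r < exp (inradius K)"
      unfolding R(2) R'(2) using R(1) by (intro edge_radius_mono) auto
    then show False using lt by simp
  qed
  assume "inradius K = inradius T"
  then have rK: "inradius K = r" by (simp add: Tr)
  have "R' = R"
    using edge_radius_mono[of R R'] edge_radius_mono[of R' R] R R' rK by (cases R R' rule: linorder_cases) auto
  note contact = inscribed_width_bound(2)[OF KB R', unfolded rK this, OF Kw]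
  obtain q f1 f2 f3 where f: "tripod q f1 f2 f3" "K \<subseteq> horo_polygon q {f1, f2, f3} r"
    "\<forall>f\<in>{f1, f2, f3}. \<exists>x\<in>K. hvec x = cosh R *\<^sub>R hvec q - sinh R *\<^sub>R f"
    using contact by metis
  interpret f: regular_triangle q f1 f2 f3 r R using r f(1) R by unfold_locales
  have "horo_polygon q {f1, f2, f3} r \<subseteq> K"
    using KB f(3) by (intro f.T_subset_h_convex) (auto simp: h_convex_body_def)
  then have "K = horo_polygon q {f1, f2, f3} r" using f(2) by blast
  then show "hyp2_congruent K T"
    unfolding Teq
    using regular_triangles_congruent[OF f.regular_triangle_axioms t.regular_triangle_axioms] by simp
qed

end
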